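(* Let $(\lambda_{h_n},u_{h_n})\in\mathbb{R}\times V_{h_n}$ be the eigenpair approximation produced by the Full Multigrid Scheme (defined in the context) with $p$ correction steps per level. Assume Assumptions A, B1 and B2 (stated in the context) hold, and that at each correction step of the scheme (level $k=2,\dots,n$, step $\ell=0,\dots,p-1$) the multigrid iteration has the error reduction rate $$\|\widehat u^{(\ell+1)}_{h_k}-\widetilde u^{(\ell+1)}_{h_k}\|_a\le\theta\,\|\widehat u^{(\ell+1)}_{h_k}-u^{(\ell)}_{h_k}\|_a$$ and the current eigenpair approximation satisfies $$|\bar\lambda_{h_k}-\lambda^{(\ell)}_{h_k}|+\|\bar u_{h_k}-u^{(\ell)}_{h_k}\|_0\le C_u\,\eta_a(V_H)\,\|\bar u_{h_k}-u^{(\ell)}_{h_k}\|_a.$$ Let $$\gamma=\theta+\Big(C_u\theta+(1+\theta)(\widetilde C_u+C_f)\big(1+C_u\eta_a(V_H)\big)\Big)\eta_a(V_H),$$ where $\widetilde C_u$ is a constant depending on the desired eigenpair. Then, under the condition $\beta\gamma^p<1$, $$\|\bar u_{h_n}-u_{h_n}\|_a\le C\,\frac{\gamma^p}{1-\beta\gamma^p}\,\delta_{h_n}(u),$$ $$|\bar\lambda_{h_n}-\lambda_{h_n}|+\|\bar u_{h_n}-u_{h_n}\|_0\le C\,\frac{\gamma^p}{1-\beta\gamma^p}\,\eta_a(V_H)\,\delta_{h_n}(u).$$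
   Context: **Continuous problem.** $\Omega\subset\mathbb{R}^d$ ($d=2,3$) is a bounded domain with Lipschitz boundary, $V=H_0^1(\Omega)$, $\|\cdot\|_s$ is the $H^s(\Omega)$ norm (so $\|\cdot\|_0$ is the $L^2(\Omega)$ norm), $(\cdot,\cdot)$ is the $L^2(\Omega)$ inner product. $\mathcal{A}$ is a symmetric positive definite matrix (function) of suitable regularity and $f(x,u)$ is a function nonlinear in $u$. Put $$a(u,v)=\int_\Omega(\mathcal{A}\nabla u\cdot\nabla v+f(x,u)v)\,d\Omega,\quad b(u,v)=\int_\Omega uv\,d\Omega,\quad \widehat a(w,v)=\int_\Omega\mathcal{A}\nabla w\cdot\nabla v\,d\Omega,\quad \|v\|_a=\sqrt{\widehat a(v,v)}.$$ The desired eigenpair $(\lambda,u)\in\mathbb{R}\times V$ satisfies $b(u,u)=1$ and $a(u,v)=\lambda b(u,v)$ for all $v\in V$; only the case of a simple eigenvalue is considered. **Finite element spaces.** For a shape-regular mesh $\mathcal{T}_h$ of $\Omega$ with mesh size $h$, $V_h\subset V$ is the space of continuous functions that are linear on each cell, and $\delta_h(u)=\inf_{v_h\in V_h}\|u-v_h\|_a$. The discrete eigenpair $(\bar\lambda_h,\bar u_h)\in\mathbb{R}\times V_h$ (the approximation of $(\lambda,u)$) satisfies $b(\bar u_h,\bar u_h)=1$ and $a(\bar u_h,v_h)=\bar\lambda_h b(\bar u_h,v_h)$ for all $v_h\in V_h$. There is a coarse mesh $\mathcal{T}_H$ with space $V_H$ and successive regular refinements $\mathcal{T}_{h_1},\dots,\mathcal{T}_{h_n}$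 ($\mathcal{T}_{h_1}$ obtained from $\mathcal{T}_H$) with $h_k=h_{k-1}/\beta$, $\beta>1$, giving nested spaces $V_H\subseteq V_{h_1}\subset V_{h_2}\subset\cdots\subset V_{h_n}$. The following approximation relations are in force: $\eta_a(V_H)\ge C\delta_{h_1}(u)$ and $\delta_{h_k}(u)=\frac1\beta\delta_{h_{k-1}}(u)$ for $k=2,\dots,n$. **Constants.** The letter $C$, with or without subscripts, denotes a generic positive constant which may differ at different occurrences. $C_u$ depends on the regularity of the mesh and the exact eigenfunction but is independent of the mesh size. **Assumption A.** $|(f(x,w)-f(x,v),\psi)|\le C_f\|w-v\|_0\|\psi\|_a$ for all $w,v,\psi\in V$. **Assumption B1.** The discrete eigenpair satisfies $$\|u-\bar u_h\|_a\le(1+C_u\eta_a(V_h))\delta_h(u),\qquad|\lambda-\bar\lambda_h|+\|u-\bar u_h\|_0\le C_u\eta_a(V_h)\|u-\bar u_h\|_a,$$ where $\eta_a(V_h)$ depends on the finite dimensional space $V_h$, $\lim_{h\to0}\eta_a(V_h)=0$, and $\eta_a(\widetilde V_h)\le\eta_a(V_h)$ whenever $V_h\subset\widetilde V_h\subset V$. **Assumption B2.** If $V^h$ is a subspace of $V_h$ and $(\lambda^h,u^h)\in\mathbb{R}\times V^h$ is the eigenpair approximation defined by $b(u^h,u^h)=1$ and $a(u^h,v^h)=\lambda^hb(u^h,v^h)$ for all $v^h\in V^h$, then $$\|\bar u_h-u^h\|_a\le(1+C_u\eta_a(V^h))\inf_{v^h\in V^h}\|\bar u_h-v^h\|_a,\qquad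 |\bar\lambda_h-\lambda^h|+\|\bar u_h-u^h\|_0\le C_u\eta_a(V^h)\|\bar u_h-u^h\|_a.$$ **One Correction Step** $(\lambda^{(\ell+1)}_{h_k},u^{(\ell+1)}_{h_k})=EigenMG(V_H,\lambda^{(\ell)}_{h_k},u^{(\ell)}_{h_k},V_{h_k},m)$: 1. Let $\widehat u^{(\ell+1)}_{h_k}\in V_{h_k}$ be defined by $\widehat a(\widehat u^{(\ell+1)}_{h_k},v)=(\lambda^{(\ell)}_{h_k}u^{(\ell)}_{h_k}-f(x,u^{(\ell)}_{h_k}),v)$ for all $v\in V_{h_k}$. Perform $m$ multigrid iteration steps for this linear problem with initial value $u^{(\ell)}_{h_k}$, giving $\widetilde u^{(\ell+1)}_{h_k}=MG(V_{h_k},\lambda^{(\ell)}_{h_k}u^{(\ell)}_{h_k}-f(x,u^{(\ell)}_{h_k}),u^{(\ell)}_{h_k},m)\in V_{h_k}$ (arguments: working space, right-hand side, initial guess, number of iterations). 2. Set $V_{H,h_k}=V_H+\mathrm{span}\{\widetilde u^{(\ell+1)}_{h_k}\}$ and let $(\lambda^{(\ell+1)}_{h_k},u^{(\ell+1)}_{h_k})\in\mathbb{R}\times V_{H,h_k}$ be the eigenpair approximation with $b(u^{(\ell+1)}_{h_k},u^{(\ell+1)}_{h_k})=1$ and $a(u^{(\ell+1)}_{h_k},v)=\lambda^{(\ell+1)}_{h_k}b(u^{(\ell+1)}_{h_k},v)$ for all $v\in V_{H,h_k}$. **Full Multigrid Scheme.** 1. Solve the nonlinear eigenvalue problem on $V_{h_1}$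 for the desired eigenpair: $(\lambda_{h_1},u_{h_1})\in\mathbb{R}\times V_{h_1}$ with $b(u_{h_1},u_{h_1})=1$ and $a(u_{h_1},v)=\lambda_{h_1}b(u_{h_1},v)$ for all $v\in V_{h_1}$; that is, $(\lambda_{h_1},u_{h_1})=(\bar\lambda_{h_1},\bar u_{h_1})$. 2. For $k=2,\dots,n$: set $\lambda^{(0)}_{h_k}=\lambda_{h_{k-1}}$, $u^{(0)}_{h_k}=u_{h_{k-1}}$; for $\ell=0,\dots,p-1$ set $(\lambda^{(\ell+1)}_{h_k},u^{(\ell+1)}_{h_k})=EigenMG(V_H,\lambda^{(\ell)}_{h_k},u^{(\ell)}_{h_k},V_{h_k},m)$; then set $\lambda_{h_k}=\lambda^{(p)}_{h_k}$, $u_{h_k}=u^{(p)}_{h_k}$. The output is $(\lambda_{h_n},u_{h_n})\in\mathbb{R}\times V_{h_n}$. *)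

theory Defs
  imports "HOL-Analysis.Analysis"
begin

section \<open>Lipschitz domains and Sobolev spaces\<close>

type_synonym 'n fn = "real^'n \<Rightarrow> real"

text \<open>
  Functions on \<open>\<Omega>\<close> are represented by functions on the whole space; their values outside
  \<open>\<Omega>\<close> are irrelevant for everything defined in this section.
\<close>

text \<open>
  Locally, in suitable orthonormal coordinates with last axis \<open>e\<close>, the domain is the strict epigraph
  of a Lipschitz function \<open>\<psi>\<close> of the remaining coordinates, i.e. of the component
  \<open>y - (y \<bullet> e) e\<close> of \<open>y\<close> orthogonal to \<open>e\<close>.
\<close>

definition lipschitz_boundary :: "(real^'n) set \<Rightarrow> bool" where
  "lipschitz_boundary \<Omega> \<longleftrightarrow>
     (\<forall>x\<in>frontier \<Omega>. \<exists>r>0. \<exists>e L. \<exists>\<psi> :: 'n fn. norm e = 1 \<and> L-lipschitz_on UNIV \<psi> \<and>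
        (\<forall>y\<in>ball x r. y \<in> \<Omega> \<longleftrightarrow> \<psi> (y - (y \<bullet> e) *\<^sub>R e) < y \<bullet> e))"

definition bounded_lipschitz_domain :: "(real^'n) set \<Rightarrow> bool" where
  "bounded_lipschitz_domain \<Omega> \<longleftrightarrow>
     open \<Omega> \<and> connected \<Omega> \<and> \<Omega> \<noteq> {} \<and> bounded \<Omega> \<and> lipschitz_boundary \<Omega>"

definition L2 :: "(real^'n) set \<Rightarrow> 'n fn set" where
  "L2 \<Omega> = {v. v \<in> borel_measurable (lebesgue_on \<Omega>) \<and> integrable (lebesgue_on \<Omega>) (\<lambda>x. (v x)\<^sup>2)}"

definition inner_L2 :: "(real^'n) set \<Rightarrow> 'n fn \<Rightarrow> 'n fn \<Rightarrow> real" where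
  "inner_L2 \<Omega> u v = (LINT x | lebesgue_on \<Omega>. u x * v x)"

definition norm_L2 :: "(real^'n) set \<Rightarrow> 'n fn \<Rightarrow> real" where
  "norm_L2 \<Omega> v = sqrt (inner_L2 \<Omega> v v)"

definition classical_gradient :: "'n fn \<Rightarrow> real^'n \<Rightarrow> real^'n" where
  "classical_gradient \<phi> x = (\<chi> i. frechet_derivative \<phi> (at x) (axis i 1))"

text \<open>The space $C^1_c(\Omega)$ of test functions.\<close>

definition C1c :: "(real^'n) set \<Rightarrow> 'n fn set" where
  "C1c \<Omega> = {\<phi>. (\<forall>x. \<phi> differentiable (at x)) \<and> continuous_on UNIV (classical_gradient \<phi>) \<and>
               compact (closure {x. \<phi> x \<noteq> 0}) \<and> closure {x. \<phi> x \<noteq> 0} \<subseteq> \<Omega>}"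

text \<open>
  First-order weak derivatives are tested against $C^1_c(\Omega)$, and $H^1_0(\Omega)$ is the closure
  of $C^1_c(\Omega)$ in the $H^1$ norm (the convention of Gilbarg and Trudinger).
\<close>

definition is_weak_gradient :: "(real^'n) set \<Rightarrow> 'n fn \<Rightarrow> (real^'n \<Rightarrow> real^'n) \<Rightarrow> bool" where
  "is_weak_gradient \<Omega> v G \<longleftrightarrow>
     G \<in> borel_measurable (lebesgue_on \<Omega>) \<and>
     integrable (lebesgue_on \<Omega>) (\<lambda>x. (norm (G x))\<^sup>2) \<and>
     (\<forall>\<phi>\<in>C1c \<Omega>. \<forall>i. (LINT x | lebesgue_on \<Omega>. v x * classical_gradient \<phi> x $ i)
                    = - (LINT x | lebesgue_on \<Omega>. G x $ i * \<phi> x))"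

definition H1 :: "(real^'n) set \<Rightarrow> 'n fn set" where
  "H1 \<Omega> = {v \<in> L2 \<Omega>. \<exists>G. is_weak_gradient \<Omega> v G}"

text \<open>The weak gradient is unique up to null sets; a representative is chosen.\<close>

definition grad :: "(real^'n) set \<Rightarrow> 'n fn \<Rightarrow> real^'n \<Rightarrow> real^'n" where
  "grad \<Omega> v = (SOME G. is_weak_gradient \<Omega> v G)"

definition norm_H1 :: "(real^'n) set \<Rightarrow> 'n fn \<Rightarrow> real" where
  "norm_H1 \<Omega> v = sqrt ((LINT x | lebesgue_on \<Omega>. (v x)\<^sup>2)
                      + (LINT x | lebesgue_on \<Omega>. (norm (grad \<Omega> v x))\<^sup>2))"

definition H10 :: "(real^'n) set \<Rightarrow> 'n fn set" where
  "H10 \<Omega> = {v \<in> H1 \<Omega>. \<exists>\<phi> :: nat \<Rightarrow> 'n fn.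
      (\<forall>j. \<phi> j \<in> C1c \<Omega>) \<and> (\<lambda>j. norm_H1 \<Omega> (\<lambda>x. v x - \<phi> j x)) \<longlonglongrightarrow> 0}"


section \<open>The nonlinear eigenvalue problem\<close>

text \<open>
  ``Symmetric positive definite of suitable regularity'': symmetric, with bounded measurable
  coefficients, and positive definite uniformly on \<open>\<Omega>\<close>.
\<close>

definition spd_coefficient :: "(real^'n) set \<Rightarrow> (real^'n \<Rightarrow> real^'n^'n) \<Rightarrow> bool" where
  "spd_coefficient \<Omega> \<A> \<longleftrightarrow>
     (\<forall>i j. (\<lambda>x. \<A> x $ i $ j) \<in> borel_measurable (lebesgue_on \<Omega>)) \<and>
     (\<exists>K. \<forall>x\<in>\<Omega>. \<forall>i j. \<bar>\<A> x $ i $ j\<bar> \<le> K) \<and>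
     (\<forall>x\<in>\<Omega>. transpose (\<A> x) = \<A> x) \<and>
     (\<exists>\<alpha>>0. \<forall>x\<in>\<Omega>. \<forall>\<xi>. \<alpha> * (\<xi> \<bullet> \<xi>) \<le> (\<A> x *v \<xi>) \<bullet> \<xi>)"

definition a_hat :: "(real^'n) set \<Rightarrow> (real^'n \<Rightarrow> real^'n^'n) \<Rightarrow> 'n fn \<Rightarrow> 'n fn \<Rightarrow> real" where
  "a_hat \<Omega> \<A> w v = (LINT x | lebesgue_on \<Omega>. (\<A> x *v grad \<Omega> w x) \<bullet> grad \<Omega> v x)"

definition a_form ::
  "(real^'n) set \<Rightarrow> (real^'n \<Rightarrow> real^'n^'n) \<Rightarrow> (real^'n \<Rightarrow> real \<Rightarrow> real) \<Rightarrow> 'n fn \<Rightarrow> 'n fn \<Rightarrow> real" where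
  "a_form \<Omega> \<A> f u v =
     (LINT x | lebesgue_on \<Omega>. (\<A> x *v grad \<Omega> u x) \<bullet> grad \<Omega> v x + f x (u x) * v x)"

definition norm_a :: "(real^'n) set \<Rightarrow> (real^'n \<Rightarrow> real^'n^'n) \<Rightarrow> 'n fn \<Rightarrow> real" where
  "norm_a \<Omega> \<A> v = sqrt (a_hat \<Omega> \<A> v v)"

text \<open>
  The form \<open>a\<close> has to make sense on $H^1_0 \times H^1_0$; since the integral in HOL is total, this
  standing requirement on \<open>f\<close> is explicit.
\<close>

definition admissible_nonlinearity :: "(real^'n) set \<Rightarrow> (real^'n \<Rightarrow> real \<Rightarrow> real) \<Rightarrow> bool" where
  "admissible_nonlinearity \<Omega> f \<longleftrightarrow>
     (\<forall>v\<in>H10 \<Omega>. \<forall>\<psi>\<in>H10 \<Omega>. integrable (lebesgue_on \<Omega>) (\<lambda>x. f x (v x) * \<psi> x))"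

definition is_eigenpair ::
  "(real^'n) set \<Rightarrow> (real^'n \<Rightarrow> real^'n^'n) \<Rightarrow> (real^'n \<Rightarrow> real \<Rightarrow> real) \<Rightarrow> 'n fn set \<Rightarrow> real \<times> 'n fn \<Rightarrow> bool"
  where
  "is_eigenpair \<Omega> \<A> f W = (\<lambda>(\<mu>, w).
     w \<in> W \<and> inner_L2 \<Omega> w w = 1 \<and> (\<forall>v\<in>W. a_form \<Omega> \<A> f w v = \<mu> * inner_L2 \<Omega> w v))"

definition simple_eigenvalue ::
  "(real^'n) set \<Rightarrow> (real^'n \<Rightarrow> real^'n^'n) \<Rightarrow> (real^'n \<Rightarrow> real \<Rightarrow> real) \<Rightarrow> real \<times> 'n fn \<Rightarrow> bool" where
  "simple_eigenvalue \<Omega> \<A> f = (\<lambda>(\<mu>, u).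
     \<forall>w. is_eigenpair \<Omega> \<A> f (H10 \<Omega>) (\<mu>, w) \<longrightarrow>
       (AE x in lebesgue_on \<Omega>. w x = u x) \<or> (AE x in lebesgue_on \<Omega>. w x = - u x))"

definition assumption_A ::
  "(real^'n) set \<Rightarrow> (real^'n \<Rightarrow> real^'n^'n) \<Rightarrow> (real^'n \<Rightarrow> real \<Rightarrow> real) \<Rightarrow> real \<Rightarrow> bool" where
  "assumption_A \<Omega> \<A> f C\<^sub>f \<longleftrightarrow>
     (\<forall>w\<in>H10 \<Omega>. \<forall>v\<in>H10 \<Omega>. \<forall>\<psi>\<in>H10 \<Omega>.
        \<bar>inner_L2 \<Omega> (\<lambda>x. f x (w x) - f x (v x)) \<psi>\<bar>
          \<le> C\<^sub>f * norm_L2 \<Omega> (\<lambda>x. w x - v x) * norm_a \<Omega> \<A> \<psi>)"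


section \<open>Finite element spaces\<close>

text \<open>Meshes are face-to-face simplicial subdivisions of the closed domain.\<close>

definition mesh_of :: "(real^'n) set \<Rightarrow> (real^'n) set set \<Rightarrow> bool" where
  "mesh_of \<Omega> \<T> \<longleftrightarrow>
     triangulation \<T> \<and> (\<forall>T\<in>\<T>. int CARD('n) simplex T) \<and> \<Union>\<T> = closure \<Omega>"

definition mesh_size :: "(real^'n) set set \<Rightarrow> real" where
  "mesh_size \<T> = Max (diameter ` \<T>)"

definition shape_regular :: "real \<Rightarrow> (real^'n) set set \<Rightarrow> bool" where
  "shape_regular \<sigma> \<T> \<longleftrightarrow> (\<forall>T\<in>\<T>. \<exists>x. \<exists>\<rho>>0. cball x \<rho> \<subseteq> T \<and> diameter T \<le> \<sigma> * \<rho>)"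

definition refines :: "(real^'n) set set \<Rightarrow> (real^'n) set set \<Rightarrow> bool" where
  "refines \<T>' \<T> \<longleftrightarrow> (\<forall>T'\<in>\<T>'. \<exists>T\<in>\<T>. T' \<subseteq> T)"

text \<open>
  Elements of the finite element space are normalised to vanish off the closed domain, so that they
  are determined by their values at the mesh vertices.
\<close>

definition fe_space :: "(real^'n) set \<Rightarrow> (real^'n) set set \<Rightarrow> 'n fn set" where
  "fe_space \<Omega> \<T> = {v \<in> H10 \<Omega>. continuous_on (closure \<Omega>) v \<and>
      (\<forall>T\<in>\<T>. \<exists>c g. \<forall>x\<in>T. v x = c + g \<bullet> x) \<and> (\<forall>x. x \<notin> closure \<Omega> \<longrightarrow> v x = 0)}"

definition linear_subspace :: "'n fn set \<Rightarrow> bool" where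
  "linear_subspace W \<longleftrightarrow> (\<lambda>x. 0) \<in> W \<and> (\<forall>v\<in>W. \<forall>w\<in>W. (\<lambda>x. v x + w x) \<in> W) \<and>
     (\<forall>c. \<forall>v\<in>W. (\<lambda>x. c * v x) \<in> W)"

definition add_span :: "'n fn set \<Rightarrow> 'n fn \<Rightarrow> 'n fn set" where
  "add_span W w = {(\<lambda>x. v x + c * w x) | v c. v \<in> W}"

definition best_approx ::
  "(real^'n) set \<Rightarrow> (real^'n \<Rightarrow> real^'n^'n) \<Rightarrow> 'n fn set \<Rightarrow> 'n fn \<Rightarrow> real" where
  "best_approx \<Omega> \<A> W u = (INF v\<in>W. norm_a \<Omega> \<A> (\<lambda>x. u x - v x))"


section \<open>The approximating eigenpairs and the error assumptions\<close>

text \<open>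
  The discrete equations do not determine a solution uniquely (there are other eigenvalues, and
  signs), so ``the eigenpair approximation'' of the desired eigenpair is a choice: \<open>ep W\<close> is the
  approximation in the subspace \<open>W\<close>. A requirement on \<open>ep W\<close> is only made when it actually is an
  eigenpair on \<open>W\<close>; this is required for the finite element spaces and for the enriched spaces
  that occur in the multigrid scheme.
\<close>

type_synonym 'n approx = "'n fn set \<Rightarrow> real \<times> 'n fn"

definition mesh_family ::
  "(real^'n) set \<Rightarrow> (real^'n \<Rightarrow> real^'n^'n) \<Rightarrow> (real^'n \<Rightarrow> real \<Rightarrow> real) \<Rightarrow> real \<Rightarrow> (real^'n) set set set
     \<Rightarrow> 'n approx \<Rightarrow> bool" where
  "mesh_family \<Omega> \<A> f \<sigma> \<M> ep \<longleftrightarrow>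
     (\<forall>\<T>\<in>\<M>. mesh_of \<Omega> \<T> \<and> shape_regular \<sigma> \<T> \<and>
             is_eigenpair \<Omega> \<A> f (fe_space \<Omega> \<T>) (ep (fe_space \<Omega> \<T>)))"

definition assumption_B1 ::
  "(real^'n) set \<Rightarrow> (real^'n \<Rightarrow> real^'n^'n) \<Rightarrow> real \<times> 'n fn \<Rightarrow> (real^'n) set set set
     \<Rightarrow> 'n approx \<Rightarrow> ('n fn set \<Rightarrow> real) \<Rightarrow> real \<Rightarrow> bool" where
  "assumption_B1 \<Omega> \<A> = (\<lambda>(\<mu>, u) \<M> ep \<eta> C\<^sub>u.
     (\<forall>\<T>\<in>\<M>. let V = fe_space \<Omega> \<T>; (\<mu>h, uh) = ep V; err = norm_a \<Omega> \<A> (\<lambda>x. u x - uh x) in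
        err \<le> (1 + C\<^sub>u * \<eta> V) * best_approx \<Omega> \<A> V u \<and>
        \<bar>\<mu> - \<mu>h\<bar> + norm_L2 \<Omega> (\<lambda>x. u x - uh x) \<le> C\<^sub>u * \<eta> V * err) \<and>
     ((\<lambda>\<T>. \<eta> (fe_space \<Omega> \<T>)) \<longlongrightarrow> 0) (inf (filtercomap mesh_size (at_right 0)) (principal \<M>)) \<and>
     (\<forall>W W'. linear_subspace W \<and> linear_subspace W' \<and> W \<subseteq> W' \<and> W' \<subseteq> H10 \<Omega> \<longrightarrow> \<eta> W' \<le> \<eta> W))"

definition assumption_B2 ::
  "(real^'n) set \<Rightarrow> (real^'n \<Rightarrow> real^'n^'n) \<Rightarrow> (real^'n \<Rightarrow> real \<Rightarrow> real) \<Rightarrow> (real^'n) set set set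
     \<Rightarrow> 'n approx \<Rightarrow> ('n fn set \<Rightarrow> real) \<Rightarrow> real \<Rightarrow> bool" where
  "assumption_B2 \<Omega> \<A> f \<M> ep \<eta> C\<^sub>u \<longleftrightarrow>
     (\<forall>\<T>\<in>\<M>. \<forall>W. linear_subspace W \<and> W \<subseteq> fe_space \<Omega> \<T> \<and> is_eigenpair \<Omega> \<A> f W (ep W) \<longrightarrow>
        (let (\<mu>h, uh) = ep (fe_space \<Omega> \<T>); (\<mu>w, uw) = ep W;
             err = norm_a \<Omega> \<A> (\<lambda>x. uh x - uw x) in
           err \<le> (1 + C\<^sub>u * \<eta> W) * best_approx \<Omega> \<A> W uh \<and>
           \<bar>\<mu>h - \<mu>w\<bar> + norm_L2 \<Omega> (\<lambda>x. uh x - uw x) \<le> C\<^sub>u * \<eta> W * err))"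

text \<open>
  \<open>\<T>H\<close> is the coarse mesh and \<open>\<T> 1, \<dots>, \<T> n\<close> are the successive refinements; \<open>C\<^sub>0\<close> is the
  generic constant in $\eta_a(V_H) \ge C\,\delta_{h_1}(u)$.
\<close>

definition mesh_hierarchy ::
  "(real^'n) set \<Rightarrow> (real^'n \<Rightarrow> real^'n^'n) \<Rightarrow> 'n fn \<Rightarrow> (real^'n) set set set \<Rightarrow> ('n fn set \<Rightarrow> real)
     \<Rightarrow> real \<Rightarrow> real \<Rightarrow> (real^'n) set set \<Rightarrow> (nat \<Rightarrow> (real^'n) set set) \<Rightarrow> nat \<Rightarrow> bool" where
  "mesh_hierarchy \<Omega> \<A> u \<M> \<eta> \<beta> C\<^sub>0 \<T>H \<T> n \<longleftrightarrow>
     1 \<le> n \<and> \<T>H \<in> \<M> \<and> (\<forall>k\<in>{1..n}. \<T> k \<in> \<M>) \<and>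
     refines (\<T> 1) \<T>H \<and> fe_space \<Omega> \<T>H \<subseteq> fe_space \<Omega> (\<T> 1) \<and>
     C\<^sub>0 * best_approx \<Omega> \<A> (fe_space \<Omega> (\<T> 1)) u \<le> \<eta> (fe_space \<Omega> \<T>H) \<and>
     (\<forall>k\<in>{2..n}.
        refines (\<T> k) (\<T> (k - 1)) \<and>
        mesh_size (\<T> k) = mesh_size (\<T> (k - 1)) / \<beta> \<and>
        fe_space \<Omega> (\<T> (k - 1)) \<subset> fe_space \<Omega> (\<T> k) \<and>
        best_approx \<Omega> \<A> (fe_space \<Omega> (\<T> k)) u
          = 1 / \<beta> * best_approx \<Omega> \<A> (fe_space \<Omega> (\<T> (k - 1))) u)"


section \<open>The full multigrid scheme\<close>

text \<open>
  A linear multigrid solver takes the working space, the right-hand side, the initial guess and the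
  number of iterations. It is an arbitrary operator here; the only property ever required of it is
  the error reduction rate.
\<close>

type_synonym 'n solver = "'n fn set \<Rightarrow> 'n fn \<Rightarrow> 'n fn \<Rightarrow> nat \<Rightarrow> 'n fn"

text \<open>
  One correction step from \<open>(\<mu>, w)\<close> to \<open>(\<mu>', w')\<close>, with exact solution \<open>wh\<close> of the linear problem
  and its multigrid approximation \<open>wt\<close>.
\<close>

definition eigen_mg_step ::
  "(real^'n) set \<Rightarrow> (real^'n \<Rightarrow> real^'n^'n) \<Rightarrow> (real^'n \<Rightarrow> real \<Rightarrow> real) \<Rightarrow> 'n approx \<Rightarrow> 'n solver
     \<Rightarrow> 'n fn set \<Rightarrow> real \<Rightarrow> 'n fn \<Rightarrow> 'n fn set \<Rightarrow> nat \<Rightarrow> 'n fn \<Rightarrow> 'n fn \<Rightarrow> real \<Rightarrow> 'n fn \<Rightarrow> bool" where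
  "eigen_mg_step \<Omega> \<A> f ep MG VH \<mu> w Vh m wh wt \<mu>' w' \<longleftrightarrow>
     (let rhs = (\<lambda>x. \<mu> * w x - f x (w x)) in
        wh \<in> Vh \<and> (\<forall>v\<in>Vh. a_hat \<Omega> \<A> wh v = inner_L2 \<Omega> rhs v) \<and>
        wt = MG Vh rhs w m \<and> wt \<in> Vh \<and>
        (\<mu>', w') = ep (add_span VH wt) \<and>
        is_eigenpair \<Omega> \<A> f (add_span VH wt) (\<mu>', w'))"

text \<open>
  \<open>lam k l, w k l\<close> are the iterates $\lambda^{(l)}_{h_k}, u^{(l)}_{h_k}$; \<open>wh k l, wt k l\<close> are
  $\widehat u^{(l+1)}_{h_k}, \widetilde u^{(l+1)}_{h_k}$; \<open>Lam k, U k\<close> is the output of level \<open>k\<close>.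
\<close>

definition full_multigrid ::
  "(real^'n) set \<Rightarrow> (real^'n \<Rightarrow> real^'n^'n) \<Rightarrow> (real^'n \<Rightarrow> real \<Rightarrow> real) \<Rightarrow> 'n approx \<Rightarrow> 'n solver
     \<Rightarrow> (real^'n) set set \<Rightarrow> (nat \<Rightarrow> (real^'n) set set) \<Rightarrow> nat \<Rightarrow> nat \<Rightarrow> nat
     \<Rightarrow> (nat \<Rightarrow> nat \<Rightarrow> real) \<Rightarrow> (nat \<Rightarrow> nat \<Rightarrow> 'n fn) \<Rightarrow> (nat \<Rightarrow> nat \<Rightarrow> 'n fn) \<Rightarrow> (nat \<Rightarrow> nat \<Rightarrow> 'n fn)
     \<Rightarrow> (nat \<Rightarrow> real) \<Rightarrow> (nat \<Rightarrow> 'n fn) \<Rightarrow> bool" where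
  "full_multigrid \<Omega> \<A> f ep MG \<T>H \<T> n p m lam w wh wt Lam U \<longleftrightarrow>
     (Lam 1, U 1) = ep (fe_space \<Omega> (\<T> 1)) \<and>
     (\<forall>k\<in>{2..n}.
        lam k 0 = Lam (k - 1) \<and> w k 0 = U (k - 1) \<and>
        (\<forall>l<p. eigen_mg_step \<Omega> \<A> f ep MG (fe_space \<Omega> \<T>H) (lam k l) (w k l)
                 (fe_space \<Omega> (\<T> k)) m (wh k l) (wt k l) (lam k (Suc l)) (w k (Suc l))) \<and>
        Lam k = lam k p \<and> U k = w k p)"

definition mg_error_reduction ::
  "(real^'n) set \<Rightarrow> (real^'n \<Rightarrow> real^'n^'n) \<Rightarrow> real \<Rightarrow> nat \<Rightarrow> nat
     \<Rightarrow> (nat \<Rightarrow> nat \<Rightarrow> 'n fn) \<Rightarrow> (nat \<Rightarrow> nat \<Rightarrow> 'n fn) \<Rightarrow> (nat \<Rightarrow> nat \<Rightarrow> 'n fn) \<Rightarrow> bool" where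
  "mg_error_reduction \<Omega> \<A> \<theta> n p w wh wt \<longleftrightarrow>
     (\<forall>k\<in>{2..n}. \<forall>l<p. norm_a \<Omega> \<A> (\<lambda>x. wh k l x - wt k l x)
                     \<le> \<theta> * norm_a \<Omega> \<A> (\<lambda>x. wh k l x - w k l x))"

definition iterates_estimate ::
  "(real^'n) set \<Rightarrow> (real^'n \<Rightarrow> real^'n^'n) \<Rightarrow> 'n approx \<Rightarrow> real \<Rightarrow> real
     \<Rightarrow> (nat \<Rightarrow> (real^'n) set set) \<Rightarrow> nat \<Rightarrow> nat
     \<Rightarrow> (nat \<Rightarrow> nat \<Rightarrow> real) \<Rightarrow> (nat \<Rightarrow> nat \<Rightarrow> 'n fn) \<Rightarrow> bool" where
  "iterates_estimate \<Omega> \<A> ep C\<^sub>u \<eta>H \<T> n p lam w \<longleftrightarrow>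
     (\<forall>k\<in>{2..n}. \<forall>l<p. let (\<mu>h, uh) = ep (fe_space \<Omega> (\<T> k)) in
        \<bar>\<mu>h - lam k l\<bar> + norm_L2 \<Omega> (\<lambda>x. uh x - w k l x)
          \<le> C\<^sub>u * \<eta>H * norm_a \<Omega> \<A> (\<lambda>x. uh x - w k l x))"

end

theory Submission
  imports Defs
begin

text \<open>
  One correction step contracts the energy error \<open>\<parallel>u\<^sub>h - w\<parallel>\<^sub>a\<close>, \<open>u\<^sub>h\<close> being the discrete
  eigenfunction, by the factor \<open>\<gamma>\<close>: testing the equation for \<open>u\<^sub>h\<close> and the linear problem with
  their difference, Assumption A and the Poincare inequality bound the distance from \<open>u\<^sub>h\<close> to the
  exact solution of the linear problem by a multiple of \<open>\<eta>\<^sub>a(V\<^sub>H)\<close> times the current error; the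
  multigrid reduction adds a factor \<open>\<theta>\<close>, and Assumption B2 turns the distance to the enriched space
  into an eigenfunction error. The errors \<open>\<epsilon>\<^sub>k\<close> at the ends of the levels then satisfy
  \<open>\<epsilon>\<^sub>k \<le> \<gamma>\<^sup>p (D \<delta>\<^sub>k + \<epsilon>\<^bsub>k-1\<^esub>)\<close> with \<open>\<delta>\<^bsub>k-1\<^esub> = \<beta> \<delta>\<^sub>k\<close>, which sums to the geometric bound.

  The condition \<open>\<beta> \<gamma>\<^sup>p < 1\<close> forces \<open>\<gamma> < 1\<close> and hence \<open>C\<^sub>f \<eta>\<^sub>a(V\<^sub>H) < 1\<close>, so the discrete eigenvalues
  are bounded by a constant that can be fixed before the meshes are chosen.

  The energy norm is a seminorm only because weak gradients are unique up to null sets; since \<open>grad\<close>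
  is an arbitrary representative, this uniqueness is needed already for the triangle inequality.
\<close>

section \<open>Semi-inner products\<close>

text \<open>The obstacle is a circle among the constants. \<open>Ct\<^sub>u\<close> contains the
  bound \<open>M\<close> for the discrete eigenvalues, because the equation of the discrete
  eigenfunction multiplies an L2 error by such an eigenvalue; \<open>M\<close> comes from Assumption
  B1 and so presupposes a bound for \<eta>_a(V_H); and that bound has to come from \<gamma>, which
  contains \<open>Ct\<^sub>u\<close>. The summand \<open>C\<^sub>f\<close> next to
  \<open>Ct\<^sub>u\<close> in \<gamma> breaks the circle: it alone bounds \<eta>_a(V_H) by
  \<open>1 / C\<^sub>f\<close>, whatever \<open>Ct\<^sub>u\<close> is.

  Uniqueness of weak gradients is the fundamental lemma of the calculus of variations for test
  functions that are merely C^1. Mollification is replaced by squares of truncated quadratics on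
  countably many balls, which approximate indicators of open sets, and by outer regularity of
  Lebesgue measure. Integration by parts for C^1 functions serves again in the Poincare inequality,
  which converts the L2 terms of the error equation into energy norms.\<close>

text \<open>No definiteness is asked for: functions that agree almost everywhere are not identified,
  so the L2 form and the energy form may vanish on nonzero functions. The domain is a set, so that
  one form can be restricted to subspaces. Linearity is stated on the left only; symmetry supplies
  the other side.\<close>

definition semi_inner_on :: "'n fn set \<Rightarrow> ('n fn \<Rightarrow> 'n fn \<Rightarrow> real) \<Rightarrow> bool" where
  "semi_inner_on W B \<longleftrightarrow> linear_subspace W \<and>
     (\<forall>u\<in>W. \<forall>v\<in>W. B u v = B v u) \<and> (\<forall>u\<in>W. 0 \<le> B u u) \<and>
     (\<forall>u\<in>W. \<forall>v\<in>W. \<forall>w\<in>W. B (\<lambda>x. u x + v x) w = B u w + B v w) \<and>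
     (\<forall>c. \<forall>u\<in>W. \<forall>w\<in>W. B (\<lambda>x. c * u x) w = c * B u w)"

lemma linear_subspace_zero: "linear_subspace W \<Longrightarrow> (\<lambda>x. 0) \<in> W"
  and linear_subspace_add: "linear_subspace W \<Longrightarrow> v \<in> W \<Longrightarrow> w \<in> W \<Longrightarrow> (\<lambda>x. v x + w x) \<in> W"
  and linear_subspace_scale: "linear_subspace W \<Longrightarrow> v \<in> W \<Longrightarrow> (\<lambda>x. c * v x) \<in> W"
  by (auto simp: linear_subspace_def)

lemma linear_subspace_diff:
  assumes "linear_subspace W" "v \<in> W" "w \<in> W"
  shows "(\<lambda>x. v x - w x) \<in> W"
  using linear_subspace_add[OF assms(1,2) linear_subspace_scale[OF assms(1,3), of "-1"]] by simp

text \<open>Keeping both coefficients free lets one identity serve Cauchy-Schwarz, the triangle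
  inequality, scaling and the value at zero.\<close>

lemma semi_inner_on_expand:
  assumes B: "semi_inner_on W B" and "u \<in> W" "v \<in> W"
  shows "B (\<lambda>x. s * u x + t * v x) (\<lambda>x. s * u x + t * v x)
           = s\<^sup>2 * B u u + 2 * s * t * B u v + t\<^sup>2 * B v v"
proof -
  have lin: "linear_subspace W" and sym: "\<And>x y. x \<in> W \<Longrightarrow> y \<in> W \<Longrightarrow> B x y = B y x"
    and add: "\<And>x y z. x \<in> W \<Longrightarrow> y \<in> W \<Longrightarrow> z \<in> W \<Longrightarrow> B (\<lambda>a. x a + y a) z = B x z + B y z"
    and scale: "\<And>c x z. x \<in> W \<Longrightarrow> z \<in> W \<Longrightarrow> B (\<lambda>a. c * x a) z = c * B x z"
    using B by (auto simp: semi_inner_on_def)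
  let ?w = "\<lambda>x. s * u x + t * v x"
  have su: "(\<lambda>x. s * u x) \<in> W" and tv: "(\<lambda>x. t * v x) \<in> W" and w: "?w \<in> W"
    using lin assms(2,3) by (auto intro!: linear_subspace_add linear_subspace_scale)
  have *: "B ?w z = s * B u z + t * B v z" if "z \<in> W" for z
    using add[OF su tv that] scale[OF assms(2) that] scale[OF assms(3) that] by simp
  have "B ?w ?w = s * B ?w u + t * B ?w v"
    using *[OF w] sym[OF assms(2) w] sym[OF assms(3) w] by simp
  also have "\<dots> = s * (s * B u u + t * B v u) + t * (s * B u v + t * B v v)"
    using *[OF assms(2)] *[OF assms(3)] by simp
  finally show ?thesis
    using sym[OF assms(3,2)] by (simp add: algebra_simps power2_eq_square)
qed

lemma semi_inner_on_nonneg: "semi_inner_on W B \<Longrightarrow> u \<in> W \<Longrightarrow> 0 \<le> B u u"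
  by (auto simp: semi_inner_on_def)

lemma semi_inner_on_Cauchy_Schwarz:
  assumes B: "semi_inner_on W B" and "u \<in> W" "v \<in> W"
  shows "\<bar>B u v\<bar> \<le> sqrt (B u u) * sqrt (B v v)"
proof -
  have nn: "0 \<le> s\<^sup>2 * B u u + 2 * s * t * B u v + t\<^sup>2 * B v v" for s t
  proof -
    have "(\<lambda>x. s * u x + t * v x) \<in> W"
      using B assms(2,3) by (auto simp: semi_inner_on_def intro!: linear_subspace_add linear_subspace_scale)
    then show ?thesis
      using semi_inner_on_nonneg[OF B, of "\<lambda>x. s * u x + t * v x"] semi_inner_on_expand[OF assms, of s t]
      by simp
  qed
  have vv: "0 \<le> B v v"
    using semi_inner_on_nonneg[OF B assms(3)] .
  have "(B u v)\<^sup>2 \<le> B u u * B v v"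
  proof (cases "B v v = 0")
    case True
    have "B u v = 0"
    proof (rule ccontr)
      assume ne: "B u v \<noteq> 0"
      \<comment> \<open>With \<open>B v v = 0\<close> the quadratic form is affine in t, and this t
        makes its value -1.\<close>
      have "0 \<le> B u u + 2 * (- (B u u + 1) / (2 * B u v)) * B u v"
        using nn[of 1 "- (B u u + 1) / (2 * B u v)"] True by simp
      then show False
        using ne semi_inner_on_nonneg[OF B assms(2)] by (simp add: field_simps)
    qed
    then show ?thesis
      using True by simp
  next
    case False
    then have pos: "0 < B v v"
      using vv by simp
    \<comment> \<open>The residual of projecting u onto v, with the denominator \<open>B v v\<close>
      cleared.\<close>
    have "0 \<le> (B v v)\<^sup>2 * B u u + 2 * B v v * (- B u v) * B u v + (- B u v)\<^sup>2 * B v v"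
      by (rule nn)
    also have "\<dots> = B v v * (B u u * B v v - (B u v)\<^sup>2)"
      by (simp add: algebra_simps power2_eq_square)
    finally show ?thesis
      using pos by (simp add: zero_le_mult_iff)
  qed
  then have "sqrt ((B u v)\<^sup>2) \<le> sqrt (B u u * B v v)"
    by (rule real_sqrt_le_mono)
  then show ?thesis
    by (simp add: real_sqrt_mult)
qed

lemma semi_inner_on_triangle:
  assumes B: "semi_inner_on W B" and "u \<in> W" "v \<in> W"
  shows "sqrt (B (\<lambda>x. u x + v x) (\<lambda>x. u x + v x)) \<le> sqrt (B u u) + sqrt (B v v)"
proof (rule real_le_lsqrt)
  have "B (\<lambda>x. u x + v x) (\<lambda>x. u x + v x) = B u u + 2 * B u v + B v v"
    using semi_inner_on_expand[OF assms, of 1 1] by simp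
  also have "\<dots> \<le> B u u + 2 * (sqrt (B u u) * sqrt (B v v)) + B v v"
    using semi_inner_on_Cauchy_Schwarz[OF assms] by simp
  also have "\<dots> = (sqrt (B u u) + sqrt (B v v))\<^sup>2"
    using semi_inner_on_nonneg[OF B] assms(2,3) by (simp add: power2_sum)
  finally show "B (\<lambda>x. u x + v x) (\<lambda>x. u x + v x) \<le> (sqrt (B u u) + sqrt (B v v))\<^sup>2" .
qed (use semi_inner_on_nonneg[OF B] assms in auto)

lemma semi_inner_on_scale:
  assumes "semi_inner_on W B" "u \<in> W"
  shows "sqrt (B (\<lambda>x. c * u x) (\<lambda>x. c * u x)) = \<bar>c\<bar> * sqrt (B u u)"
  using semi_inner_on_expand[OF assms assms(2), of c 0] by (simp add: real_sqrt_mult)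

lemma semi_inner_on_zero:
  assumes "semi_inner_on W B"
  shows "B (\<lambda>x. 0) (\<lambda>x. 0) = 0"
proof -
  have "(\<lambda>x. 0) \<in> W"
    using assms by (auto simp: semi_inner_on_def linear_subspace_def)
  then show ?thesis
    using semi_inner_on_expand[OF assms, of "\<lambda>x. 0" "\<lambda>x. 0" 0 0] by simp
qed

lemma semi_inner_on_triangle_diff:
  assumes B: "semi_inner_on W B" and "u \<in> W" "v \<in> W" "w \<in> W"
  shows "sqrt (B (\<lambda>x. u x - w x) (\<lambda>x. u x - w x))
          \<le> sqrt (B (\<lambda>x. u x - v x) (\<lambda>x. u x - v x)) + sqrt (B (\<lambda>x. v x - w x) (\<lambda>x. v x - w x))"
proof -
  have lin: "linear_subspace W"
    using B by (simp add: semi_inner_on_def)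
  show ?thesis
    using semi_inner_on_triangle[OF B linear_subspace_diff[OF lin assms(2,3)]
        linear_subspace_diff[OF lin assms(3,4)]] by simp
qed

lemma semi_inner_on_minus_commute:
  assumes B: "semi_inner_on W B" and "u \<in> W" "v \<in> W"
  shows "sqrt (B (\<lambda>x. u x - v x) (\<lambda>x. u x - v x)) = sqrt (B (\<lambda>x. v x - u x) (\<lambda>x. v x - u x))"
  using semi_inner_on_scale[OF B linear_subspace_diff[OF _ assms(2,3)], of "-1"] B
  by (simp add: semi_inner_on_def)

lemma semi_inner_on_subset:
  "semi_inner_on W B \<Longrightarrow> linear_subspace W' \<Longrightarrow> W' \<subseteq> W \<Longrightarrow> semi_inner_on W' B"
  unfolding semi_inner_on_def by blast

lemma semi_inner_on_diff:
  assumes B: "semi_inner_on W B" and "u \<in> W" "v \<in> W" "w \<in> W"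
  shows "B (\<lambda>x. u x - v x) w = B u w - B v w"
proof -
  have lin: "linear_subspace W"
    and add: "\<And>x y z. x \<in> W \<Longrightarrow> y \<in> W \<Longrightarrow> z \<in> W \<Longrightarrow> B (\<lambda>a. x a + y a) z = B x z + B y z"
    using B by (auto simp: semi_inner_on_def)
  show ?thesis
    using add[OF linear_subspace_diff[OF lin assms(2,3)] assms(3,4)] by simp
qed

section \<open>Square integrable functions\<close>

lemma L2_mult_integrable:
  assumes "u \<in> L2 \<Omega>" "v \<in> L2 \<Omega>"
  shows "integrable (lebesgue_on \<Omega>) (\<lambda>x. u x * v x)"
proof (rule Bochner_Integration.integrable_bound)
  show "integrable (lebesgue_on \<Omega>) (\<lambda>x. (u x)\<^sup>2 + (v x)\<^sup>2)"
    using assms by (auto simp: L2_def)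
  show "(\<lambda>x. u x * v x) \<in> borel_measurable (lebesgue_on \<Omega>)"
    using assms by (auto simp: L2_def)
  have "\<bar>a * b\<bar> \<le> a\<^sup>2 + b\<^sup>2" for a b :: real
  proof -
    have "2 * \<bar>a * b\<bar> \<le> a\<^sup>2 + b\<^sup>2"
      using sum_squares_bound[of "\<bar>a\<bar>" "\<bar>b\<bar>"] by (simp add: abs_mult)
    then show ?thesis
      by linarith
  qed
  then show "AE x in lebesgue_on \<Omega>. norm (u x * v x) \<le> norm ((u x)\<^sup>2 + (v x)\<^sup>2)"
    by simp
qed

lemma linear_subspace_L2: "linear_subspace (L2 \<Omega>)"
proof -
  have "(\<lambda>x. u x + v x) \<in> L2 \<Omega>" if "u \<in> L2 \<Omega>" "v \<in> L2 \<Omega>" for u v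
    using that L2_mult_integrable[OF that] by (auto simp: L2_def power2_sum mult.assoc)
  then show ?thesis
    by (auto simp: linear_subspace_def L2_def power_mult_distrib)
qed

lemma semi_inner_on_L2: "semi_inner_on (L2 \<Omega>) (inner_L2 \<Omega>)"
  unfolding semi_inner_on_def inner_L2_def
  using linear_subspace_L2
  by (auto simp: L2_mult_integrable distrib_right mult.assoc intro: Bochner_Integration.integral_cong)

section \<open>Test functions\<close>

lemma classical_gradient_unique:
  assumes "(\<phi> has_derivative (\<lambda>h. g \<bullet> h)) (at x)"
  shows "classical_gradient \<phi> x = g"
  unfolding classical_gradient_def frechet_derivative_at[OF assms, symmetric]
  by (simp add: vec_eq_iff inner_axis)

lemma has_derivative_classical_gradient:
  assumes "\<phi> differentiable (at x)"
  shows "(\<phi> has_derivative (\<lambda>h. classical_gradient \<phi> x \<bullet> h)) (at x)"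
proof -
  let ?D = "frechet_derivative \<phi> (at x)"
  have D: "(\<phi> has_derivative ?D) (at x)"
    using assms frechet_derivative_works by blast
  then interpret linear ?D
    by (rule has_derivative_linear)
  have "?D h = classical_gradient \<phi> x \<bullet> h" for h
  proof -
    have "?D h = ?D (\<Sum>i\<in>UNIV. (h $ i) *\<^sub>R axis i 1)"
      using basis_expansion[of h] by (simp add: scalar_mult_eq_scaleR)
    also have "\<dots> = (\<Sum>i\<in>UNIV. h $ i * ?D (axis i 1))"
      by (simp add: sum scale)
    also have "\<dots> = classical_gradient \<phi> x \<bullet> h"
      by (simp add: classical_gradient_def inner_vec_def mult.commute)
    finally show ?thesis .
  qed
  then have "?D = (\<lambda>h. classical_gradient \<phi> x \<bullet> h)"
    by blast
  then show ?thesis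
    using D by metis
qed

text \<open>Any convenient compact set K may stand in for the exact support, whose closure is then a
  closed subset of K. This keeps sums and products manageable, where the exact support is not
  known.\<close>

lemma C1cI:
  assumes der: "\<And>x. (\<phi> has_derivative (\<lambda>h. G x \<bullet> h)) (at x)"
    and cont: "continuous_on UNIV G" and K: "compact K" "K \<subseteq> \<Omega>" "\<And>x. x \<notin> K \<Longrightarrow> \<phi> x = 0"
  shows "\<phi> \<in> C1c \<Omega>" and "classical_gradient \<phi> = G"
proof -
  show G: "classical_gradient \<phi> = G"
    using classical_gradient_unique[OF der] by blast
  have sub: "closure {x. \<phi> x \<noteq> 0} \<subseteq> K"
    using K by (intro closure_minimal) (auto simp: compact_imp_closed)
  then have "compact (closure {x. \<phi> x \<noteq> 0})"
    using K(1) compact_Int_closed[OF K(1) closed_closure] by (metis inf.absorb2)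
  moreover have "\<phi> differentiable (at x)" for x
    using der differentiable_def by blast
  ultimately show "\<phi> \<in> C1c \<Omega>"
    using sub K(2) cont by (auto simp: C1c_def G)
qed

lemma C1cE:
  assumes "\<phi> \<in> C1c \<Omega>"
  obtains K where "\<And>x. (\<phi> has_derivative (\<lambda>h. classical_gradient \<phi> x \<bullet> h)) (at x)"
    "continuous_on UNIV (classical_gradient \<phi>)" "continuous_on UNIV \<phi>" "compact K" "K \<subseteq> \<Omega>"
    "\<And>x. x \<notin> K \<Longrightarrow> \<phi> x = 0" "\<And>x. x \<notin> K \<Longrightarrow> classical_gradient \<phi> x = 0"
proof (rule that[of "closure {x. \<phi> x \<noteq> 0}"])
  let ?K = "closure {x. \<phi> x \<noteq> 0}"
  show der: "\<And>x. (\<phi> has_derivative (\<lambda>h. classical_gradient \<phi> x \<bullet> h)) (at x)"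
    using assms by (auto simp: C1c_def intro: has_derivative_classical_gradient)
  show "continuous_on UNIV \<phi>"
    by (intro continuous_at_imp_continuous_on ballI has_derivative_continuous[OF der])
  show zero: "\<phi> x = 0" if "x \<notin> ?K" for x
    using that closure_subset[of "{x. \<phi> x \<noteq> 0}"] by blast
  show "classical_gradient \<phi> x = 0" if "x \<notin> ?K" for x
  proof (rule classical_gradient_unique)
    have "((\<lambda>x. 0) has_derivative (\<lambda>h. 0)) (at x)"
      by simp
    then have "(\<phi> has_derivative (\<lambda>h. 0)) (at x)"
      by (rule has_derivative_transform_within_open[OF _ open_Compl[OF closed_closure]])
        (use that in simp, metis ComplD zero)
    then show "(\<phi> has_derivative (\<lambda>h. 0 \<bullet> h)) (at x)"
      by simp
  qed
qed (use assms in \<open>auto simp: C1c_def\<close>)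

text \<open>The factor \<open>g\<close> may have unbounded support, so that constants, coordinate
  functions and the saturation quotient below are covered as well as squares of test
  functions.\<close>

lemma C1c_mult:
  assumes "\<phi> \<in> C1c \<Omega>"
    and g: "\<And>x. (g has_derivative (\<lambda>h. G x \<bullet> h)) (at x)" "continuous_on UNIV G"
  shows "(\<lambda>x. \<phi> x * g x) \<in> C1c \<Omega>"
    and "classical_gradient (\<lambda>x. \<phi> x * g x) = (\<lambda>x. \<phi> x *\<^sub>R G x + g x *\<^sub>R classical_gradient \<phi> x)"
proof -
  obtain K where *: "\<And>x. (\<phi> has_derivative (\<lambda>h. classical_gradient \<phi> x \<bullet> h)) (at x)"
    "continuous_on UNIV (classical_gradient \<phi>)" "continuous_on UNIV \<phi>" "compact K" "K \<subseteq> \<Omega>"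
    "\<And>x. x \<notin> K \<Longrightarrow> \<phi> x = 0"
    using C1cE[OF assms(1)] by metis
  have der: "((\<lambda>x. \<phi> x * g x) has_derivative
      (\<lambda>h. (\<phi> x *\<^sub>R G x + g x *\<^sub>R classical_gradient \<phi> x) \<bullet> h)) (at x)" for x
    by (rule has_derivative_eq_rhs[OF has_derivative_mult[OF *(1) g(1)]])
      (auto simp: fun_eq_iff inner_add_left)
  have "continuous_on UNIV g"
    by (intro continuous_at_imp_continuous_on ballI has_derivative_continuous[OF g(1)])
  then have cont: "continuous_on UNIV (\<lambda>x. \<phi> x *\<^sub>R G x + g x *\<^sub>R classical_gradient \<phi> x)"
    using *(2,3) g(2) by (intro continuous_intros)
  show "(\<lambda>x. \<phi> x * g x) \<in> C1c \<Omega>"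
    and "classical_gradient (\<lambda>x. \<phi> x * g x) = (\<lambda>x. \<phi> x *\<^sub>R G x + g x *\<^sub>R classical_gradient \<phi> x)"
    using C1cI[OF der cont *(4,5)] *(6) by auto
qed

lemma linear_subspace_C1c: "linear_subspace (C1c \<Omega>)"
proof -
  have "(\<lambda>x. 0) \<in> C1c \<Omega>"
    by (rule C1cI(1)[of _ "\<lambda>x. 0" "{}"]) auto
  moreover have "(\<lambda>x. \<phi> x + \<psi> x) \<in> C1c \<Omega>" if \<phi>: "\<phi> \<in> C1c \<Omega>" and \<psi>: "\<psi> \<in> C1c \<Omega>" for \<phi> \<psi>
  proof -
    obtain K where K: "\<And>x. (\<phi> has_derivative (\<lambda>h. classical_gradient \<phi> x \<bullet> h)) (at x)"
      "continuous_on UNIV (classical_gradient \<phi>)" "compact K" "K \<subseteq> \<Omega>" "\<And>x. x \<notin> K \<Longrightarrow> \<phi> x = 0"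
      using C1cE[OF \<phi>] by metis
    obtain L where L: "\<And>x. (\<psi> has_derivative (\<lambda>h. classical_gradient \<psi> x \<bullet> h)) (at x)"
      "continuous_on UNIV (classical_gradient \<psi>)" "compact L" "L \<subseteq> \<Omega>" "\<And>x. x \<notin> L \<Longrightarrow> \<psi> x = 0"
      using C1cE[OF \<psi>] by metis
    show ?thesis
    proof (rule C1cI(1)[where K = "K \<union> L" and G = "\<lambda>x. classical_gradient \<phi> x + classical_gradient \<psi> x"])
      show "((\<lambda>x. \<phi> x + \<psi> x) has_derivative
          (\<lambda>h. (classical_gradient \<phi> x + classical_gradient \<psi> x) \<bullet> h)) (at x)" for x
        unfolding inner_add_left by (intro has_derivative_add K L)
    qed (use K L in \<open>auto intro: continuous_intros\<close>)
  qed
  moreover have "(\<lambda>x. c * \<phi> x) \<in> C1c \<Omega>" if "\<phi> \<in> C1c \<Omega>" for c \<phi>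
    using C1c_mult(1)[OF that, of "\<lambda>x. c" "\<lambda>x. 0"] by (simp add: mult.commute)
  ultimately show ?thesis
    by (simp add: linear_subspace_def)
qed

section \<open>Integrals of compactly supported functions and integration by parts\<close>

text \<open>Translation invariance is a property of the whole space; this moves integrals over the
  domain there for integrands that vanish outside it.\<close>

lemma integral_lebesgue_on_eq_lborel:
  fixes h :: "'a::euclidean_space \<Rightarrow> real"
  assumes "\<Omega> \<in> sets lebesgue" "h \<in> borel_measurable borel" "\<And>x. x \<notin> \<Omega> \<Longrightarrow> h x = 0"
  shows "(LINT x | lebesgue_on \<Omega>. h x) = (LINT x | lborel. h x)"
proof -
  have "(\<lambda>x. indicator \<Omega> x *\<^sub>R h x) = h"
    using assms(3) by (auto simp: indicator_def fun_eq_iff)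
  then have "(LINT x | lebesgue_on \<Omega>. h x) = (LINT x | lebesgue. h x)"
    using integral_restrict_space[of \<Omega> lebesgue h] assms(1) by simp
  then show ?thesis
    using integral_completion[of h lborel] assms(2) by simp
qed

lemma integrable_continuous_compact_support:
  fixes h :: "'a::euclidean_space \<Rightarrow> real"
  assumes "continuous_on UNIV h" "compact K" "\<And>x. x \<notin> K \<Longrightarrow> h x = 0"
  shows "integrable lborel h"
proof -
  have "(\<lambda>x. indicator K x *\<^sub>R h x) = h"
    using assms(3) by (auto simp: indicator_def fun_eq_iff)
  then show ?thesis
    using borel_integrable_compact[OF assms(2) continuous_on_subset[OF assms(1)]] by simp
qed

lemma continuous_compact_support_L2:
  assumes "continuous_on UNIV h" "compact K" "\<And>x. x \<notin> K \<Longrightarrow> h x = 0" "\<Omega> \<in> sets lebesgue"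
  shows "h \<in> L2 \<Omega>"
proof -
  have "integrable lborel (\<lambda>x. (h x)\<^sup>2)"
    using assms by (intro integrable_continuous_compact_support[of _ K] continuous_intros) auto
  then have "integrable lebesgue (\<lambda>x. (h x)\<^sup>2)"
    by (simp add: integrable_completion)
  then have "integrable (lebesgue_on \<Omega>) (\<lambda>x. (h x)\<^sup>2)"
    using assms(4) integrable_mult_indicator[OF assms(4), of "\<lambda>x. (h x)\<^sup>2"] by (simp add: integrable_restrict_space)
  moreover have "h \<in> borel_measurable (lebesgue_on \<Omega>)"
    using borel_measurable_continuous_onI[OF assms(1)]
    by (intro measurable_restrict_space1 measurable_completion) simp
  ultimately show ?thesis
    by (simp add: L2_def)
qed

text \<open>The integral of a difference quotient vanishes by translation invariance.\<close>

lemma integral_classical_gradient_C1c: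
  assumes "\<phi> \<in> C1c \<Omega>"
  shows "(LINT x | lborel. classical_gradient \<phi> x $ i) = 0"
proof -
  obtain K where K: "\<And>x. (\<phi> has_derivative (\<lambda>h. classical_gradient \<phi> x \<bullet> h)) (at x)"
    "continuous_on UNIV (classical_gradient \<phi>)" "continuous_on UNIV \<phi>" "compact K"
    "\<And>x. x \<notin> K \<Longrightarrow> \<phi> x = 0" "\<And>x. x \<notin> K \<Longrightarrow> classical_gradient \<phi> x = 0"
    using C1cE[OF assms] by metis
  define e :: "real^'a" where "e = axis i 1"
  define s where "s n x = real (Suc n) * (\<phi> ((1 / real (Suc n)) *\<^sub>R e + x) - \<phi> x)" for n x
  have e1: "norm e = 1"
    by (simp add: e_def norm_axis_1)
  obtain R where R: "\<And>x. x \<in> K \<Longrightarrow> norm x \<le> R"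
    using compact_imp_bounded[OF K(4)] by (auto simp: bounded_iff)
  have "compact (classical_gradient \<phi> ` K)"
    using K(2,4) by (intro compact_continuous_image) (auto intro: continuous_on_subset)
  then obtain M0 where M0: "\<And>x. x \<in> K \<Longrightarrow> norm (classical_gradient \<phi> x) \<le> M0"
    using compact_imp_bounded by (force simp: bounded_iff)
  define M where "M = max 0 M0"
  have M: "norm (classical_gradient \<phi> x) \<le> M" for x
    using M0[of x] K(6)[of x] by (cases "x \<in> K") (auto simp: M_def)
  have int_\<phi>: "integrable lborel \<phi>"
    by (rule integrable_continuous_compact_support[OF K(3,4,5)])
  have trans: "integrable lborel (\<lambda>x. \<phi> (a + x)) \<and> (LINT x | lborel. \<phi> (a + x)) = (LINT x | lborel. \<phi> x)" for a
  proof -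
    have meas: "\<phi> \<in> borel_measurable borel"
      by (rule borel_measurable_continuous_onI[OF K(3)])
    show ?thesis
      using integrable_distr_eq[of "(+) a" lborel borel \<phi>] integral_distr[of "(+) a" lborel borel \<phi>]
        meas int_\<phi> by (simp add: lborel_distr_plus)
  qed
  have s0: "(LINT x | lborel. s n x) = 0" for n
    using trans int_\<phi> by (simp add: s_def Bochner_Integration.integral_diff)
  have lim: "(\<lambda>n. s n x) \<longlonglongrightarrow> classical_gradient \<phi> x $ i" for x
  proof -
    have 1: "((\<lambda>t. t *\<^sub>R e + x) has_derivative (\<lambda>t. t *\<^sub>R e)) (at (0::real))"
      by (auto intro!: derivative_eq_intros)
    have 2: "(\<phi> has_derivative (\<lambda>h. classical_gradient \<phi> x \<bullet> h)) (at (0 *\<^sub>R e + x))"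
      using K(1) by simp
    have "((\<lambda>t. \<phi> (t *\<^sub>R e + x)) has_derivative (\<lambda>t. classical_gradient \<phi> x \<bullet> (t *\<^sub>R e))) (at 0)"
      using diff_chain_at[of "\<lambda>t. t *\<^sub>R e + x" _ 0 \<phi>, OF 1 2] by (simp add: o_def)
    then have "((\<lambda>t. \<phi> (t *\<^sub>R e + x)) has_field_derivative (classical_gradient \<phi> x $ i)) (at 0)"
      by (simp add: has_field_derivative_def e_def inner_axis mult_commute_abs)
    then have "((\<lambda>h. (\<phi> (h *\<^sub>R e + x) - \<phi> x) / h) \<longlongrightarrow> classical_gradient \<phi> x $ i) (at 0)"
      by (simp add: has_field_derivative_iff)
    moreover have "filterlim (\<lambda>n. 1 / real (Suc n)) (at 0) sequentially"
      using LIMSEQ_Suc[OF lim_1_over_n[where 'a=real]] by (auto simp: filterlim_at)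
    ultimately have "((\<lambda>n. (\<phi> ((1 / real (Suc n)) *\<^sub>R e + x) - \<phi> x) / (1 / real (Suc n)))
        \<longlongrightarrow> classical_gradient \<phi> x $ i) sequentially"
      by (rule filterlim_compose)
    then show ?thesis
      by (simp add: s_def mult.commute)
  qed
  have lip: "\<bar>\<phi> (h + x) - \<phi> x\<bar> \<le> M * norm h" for h x
  proof -
    have "onorm (\<lambda>h. classical_gradient \<phi> y \<bullet> h) \<le> M" for y
    proof (rule onorm_le)
      show "norm (classical_gradient \<phi> y \<bullet> h) \<le> M * norm h" for h
        using Cauchy_Schwarz_ineq2[of "classical_gradient \<phi> y" h] M[of y]
          mult_right_mono[OF M[of y], of "norm h"] by simp
    qed
    then show ?thesis
      using differentiable_bound[of UNIV \<phi> "\<lambda>y h. classical_gradient \<phi> y \<bullet> h" M "h + x" x] K(1) by simp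
  qed
  \<comment> \<open>The shifts have length at most 1, so all difference quotients vanish outside the
    ball of radius \<open>R + 1\<close>, one unit larger than a ball containing K. Inside it the
    Lipschitz constant M bounds them.\<close>
  have bound: "norm (s n x) \<le> indicator (cball 0 (R + 1)) x *\<^sub>R M" for n x
  proof (cases "norm x \<le> R + 1")
    case True
    have "norm (s n x) = real (Suc n) * \<bar>\<phi> ((1 / real (Suc n)) *\<^sub>R e + x) - \<phi> x\<bar>"
      by (simp add: s_def abs_mult)
    also have "\<dots> \<le> real (Suc n) * (M * norm ((1 / real (Suc n)) *\<^sub>R e))"
      by (intro mult_left_mono lip) auto
    also have "\<dots> = M"
      using e1 by simp
    finally show ?thesis
      using True by simp
  next
    case False
    let ?y = "(1 / real (Suc n)) *\<^sub>R e"
    have "norm ?y \<le> 1"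
      using e1 by simp
    moreover have "norm x \<le> norm (?y + x) + norm ?y"
      using norm_triangle_ineq4[of "?y + x" ?y] by (simp only: add_diff_cancel_left')
    ultimately have "norm (?y + x) > R"
      using False by linarith
    then have "\<phi> ((1 / real (Suc n)) *\<^sub>R e + x) = 0" "\<phi> x = 0"
      using R K(5) False by (meson not_le, force)
    then show ?thesis
      using False by (simp add: s_def)
  qed
  have "(\<lambda>n. LINT x | lborel. s n x) \<longlonglongrightarrow> (LINT x | lborel. classical_gradient \<phi> x $ i)"
  proof (rule integral_dominated_convergence[where w = "\<lambda>x. indicator (cball 0 (R + 1)) x *\<^sub>R M"])
    show "(\<lambda>x. classical_gradient \<phi> x $ i) \<in> borel_measurable lborel"
      using K(2) by (auto intro!: borel_measurable_continuous_onI continuous_intros)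
    show "s n \<in> borel_measurable lborel" for n
      unfolding s_def using trans int_\<phi> by (intro borel_measurable_integrable) auto
    show "integrable lborel (\<lambda>x. indicator (cball 0 (R + 1)) x *\<^sub>R M)"
      by (rule borel_integrable_compact) auto
  qed (use lim bound in auto)
  then show ?thesis
    using LIMSEQ_unique[OF _ tendsto_const[of 0]] s0 by simp
qed

lemma C1c_L2:
  assumes "\<phi> \<in> C1c \<Omega>" "\<Omega> \<in> sets lebesgue"
  shows "\<phi> \<in> L2 \<Omega>" and "(\<lambda>x. classical_gradient \<phi> x $ i) \<in> L2 \<Omega>"
proof -
  obtain K where K: "continuous_on UNIV (classical_gradient \<phi>)" "continuous_on UNIV \<phi>" "compact K"
    "\<And>x. x \<notin> K \<Longrightarrow> \<phi> x = 0" "\<And>x. x \<notin> K \<Longrightarrow> classical_gradient \<phi> x = 0"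
    using C1cE[OF assms(1)] by metis
  show "\<phi> \<in> L2 \<Omega>"
    using K assms(2) by (intro continuous_compact_support_L2[of _ K]) auto
  show "(\<lambda>x. classical_gradient \<phi> x $ i) \<in> L2 \<Omega>"
    using K assms(2) by (intro continuous_compact_support_L2[of _ K] continuous_intros) auto
qed

text \<open>The integrand is a partial derivative of the test function \<phi> g. It stays a single
  integral; splitting it is left to the uses, where the integrability of both terms is known from
  L2.\<close>

lemma integration_by_parts_C1c:
  assumes "\<phi> \<in> C1c \<Omega>" "\<Omega> \<in> sets lebesgue"
    and g: "\<And>x. (g has_derivative (\<lambda>h. G x \<bullet> h)) (at x)" "continuous_on UNIV G"
  shows "(LINT x | lebesgue_on \<Omega>. \<phi> x * G x $ i + g x * classical_gradient \<phi> x $ i) = 0"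
proof -
  let ?p = "\<lambda>x. \<phi> x * g x"
  note p = C1c_mult[OF assms(1) g]
  obtain K where K: "continuous_on UNIV (classical_gradient ?p)" "K \<subseteq> \<Omega>"
    "\<And>x. x \<notin> K \<Longrightarrow> classical_gradient ?p x = 0"
    using C1cE[OF p(1)] by metis
  have "(LINT x | lebesgue_on \<Omega>. classical_gradient ?p x $ i) = (LINT x | lborel. classical_gradient ?p x $ i)"
  proof (rule integral_lebesgue_on_eq_lborel[OF assms(2)])
    show "(\<lambda>x. classical_gradient ?p x $ i) \<in> borel_measurable borel"
      using K(1) by (intro borel_measurable_continuous_onI continuous_intros)
    show "\<And>x. x \<notin> \<Omega> \<Longrightarrow> classical_gradient ?p x $ i = 0"
      using K(2,3) by (metis subsetD zero_index)
  qed
  also have "\<dots> = 0"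
    by (rule integral_classical_gradient_C1c[OF p(1)])
  finally show ?thesis
    by (simp add: p(2))
qed

section \<open>The fundamental lemma of the calculus of variations\<close>

lemma C1c_mono: "\<Omega> \<subseteq> \<Omega>' \<Longrightarrow> C1c \<Omega> \<subseteq> C1c \<Omega>'"
  by (auto simp: C1c_def)

text \<open>Squaring the positive part removes its kink at 0, which gives an elementary cut-off of
  exactly the smoothness that \<open>C1c\<close> demands.\<close>

lemma DERIV_max_0_square: "((\<lambda>t. (max 0 t)\<^sup>2) has_field_derivative 2 * max 0 t) (at (t::real))"
proof (cases t "0::real" rule: linorder_cases)
  case less
  have "((\<lambda>t. 0) has_field_derivative 0) (at t)"
    by simp
  then have "((\<lambda>t. (max 0 t)\<^sup>2) has_field_derivative 0) (at t)"
    by (rule has_field_derivative_transform_within_open[of _ _ _ "{..<0}"]) (use less in auto)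
  then show ?thesis
    using less by simp
next
  case equal
  have "((\<lambda>h. (max 0 h)\<^sup>2 / h) \<longlongrightarrow> 0) (at (0::real))"
  proof (rule Lim_null_comparison)
    show "\<forall>\<^sub>F h in at (0::real). norm ((max 0 h)\<^sup>2 / h) \<le> \<bar>h\<bar>"
      by (rule always_eventually) (auto simp: max_def power2_eq_square)
    show "((\<lambda>h. \<bar>h\<bar>) \<longlongrightarrow> 0) (at (0::real))"
      by (intro tendsto_rabs_zero tendsto_ident_at)
  qed
  then show ?thesis
    using equal by (simp add: has_field_derivative_iff)
next
  case greater
  have "((\<lambda>t. t\<^sup>2) has_field_derivative 2 * t) (at t)"
    by (auto intro!: derivative_eq_intros)
  then have "((\<lambda>t. (max 0 t)\<^sup>2) has_field_derivative 2 * t) (at t)"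
    by (rule has_field_derivative_transform_within_open[of _ _ _ "{0<..}"]) (use greater in auto)
  then show ?thesis
    using greater by simp
qed

lemma ball_bump_C1c:
  assumes "cball c r \<subseteq> U" "0 \<le> r"
  shows "(\<lambda>x. (max 0 (r\<^sup>2 - (norm (x - c))\<^sup>2))\<^sup>2) \<in> C1c U"
proof (rule C1cI(1)[where K = "cball c r"
      and G = "\<lambda>x. - (4 * max 0 (r\<^sup>2 - (norm (x - c))\<^sup>2)) *\<^sub>R (x - c)"])
  fix x
  have 1: "((\<lambda>x. r\<^sup>2 - (norm (x - c))\<^sup>2) has_derivative (\<lambda>h. - (2 * ((x - c) \<bullet> h)))) (at x)"
    unfolding power2_norm_eq_inner
    by (auto intro!: derivative_eq_intros simp: inner_commute)
  have 2: "((\<lambda>t. (max 0 t)\<^sup>2) has_derivative (*) (2 * max 0 (r\<^sup>2 - (norm (x - c))\<^sup>2)))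
      (at (r\<^sup>2 - (norm (x - c))\<^sup>2))"
    using DERIV_max_0_square by (simp add: has_field_derivative_def)
  show "((\<lambda>x. (max 0 (r\<^sup>2 - (norm (x - c))\<^sup>2))\<^sup>2) has_derivative
      (\<lambda>h. (- (4 * max 0 (r\<^sup>2 - (norm (x - c))\<^sup>2)) *\<^sub>R (x - c)) \<bullet> h)) (at x)"
    by (rule has_derivative_eq_rhs[OF diff_chain_at[OF 1 2, unfolded o_def]]) auto
  show "(max 0 (r\<^sup>2 - (norm (x - c))\<^sup>2))\<^sup>2 = 0" if "x \<notin> cball c r"
    using that assms(2) power_mono[of r "norm (x - c)" 2] by (simp add: dist_norm norm_minus_commute)
qed (use assms in \<open>auto intro!: continuous_intros\<close>)

text \<open>The map t \<mapsto> j t / (1 + j t) fixes 0 and tends to 1 for t > 0 as j grows, so it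
  pushes a nonnegative test function towards the indicator of its positivity set without enlarging
  the support. It is written as \<phi> times a C^1 factor so that the product rule applies.\<close>

lemma C1c_saturate:
  assumes \<phi>: "\<phi> \<in> C1c U" and nn: "\<And>x. 0 \<le> \<phi> x" and "0 \<le> (j::real)"
  shows "(\<lambda>x. \<phi> x * (j / (1 + j * \<phi> x))) \<in> C1c U"
proof -
  obtain K where K: "\<And>x. (\<phi> has_derivative (\<lambda>h. classical_gradient \<phi> x \<bullet> h)) (at x)"
    "continuous_on UNIV (classical_gradient \<phi>)" "continuous_on UNIV \<phi>"
    using C1cE[OF \<phi>] by metis
  have ne: "1 + j * \<phi> x \<noteq> 0" for x
    using mult_nonneg_nonneg[OF assms(3) nn[of x]] by linarith
  show ?thesis
  proof (rule C1c_mult(1)[OF \<phi>])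
    fix x
    have "((\<lambda>t. j / (1 + j * t)) has_field_derivative - (j\<^sup>2 / (1 + j * \<phi> x)\<^sup>2)) (at (\<phi> x))"
      using ne[of x] by (auto intro!: derivative_eq_intros simp: power2_eq_square)
    then show "((\<lambda>x. j / (1 + j * \<phi> x)) has_derivative
        (\<lambda>h. (- (j\<^sup>2 / (1 + j * \<phi> x)\<^sup>2) *\<^sub>R classical_gradient \<phi> x) \<bullet> h)) (at x)"
      unfolding has_field_derivative_def
      by (rule has_derivative_eq_rhs[OF diff_chain_at[OF K(1), unfolded o_def]]) auto
    show "continuous_on UNIV (\<lambda>x. - (j\<^sup>2 / (1 + j * \<phi> x)\<^sup>2) *\<^sub>R classical_gradient \<phi> x)"
      using K ne by (intro continuous_intros) auto
  qed
qed

text \<open>The closed balls have to lie in U so that each bump is compactly supported there, while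
  the open ones cover. Lindelof makes the cover countable, and nonemptiness allows an enumeration by
  all naturals.\<close>

lemma open_eq_Union_balls_sequence:
  fixes U :: "'a::euclidean_space set"
  assumes "open U" "U \<noteq> {}"
  obtains c :: "nat \<Rightarrow> 'a" and r where "\<And>n. 0 < r n" "\<And>n. cball (c n) (r n) \<subseteq> U"
    "U = (\<Union>n. ball (c n) (r n))"
proof -
  define F where "F = {ball x r | x r. 0 < r \<and> cball x r \<subseteq> U}"
  have F: "\<Union>F = U"
  proof
    show "U \<subseteq> \<Union>F"
    proof
      fix x
      assume "x \<in> U"
      then obtain e where "e > 0" "cball x e \<subseteq> U"
        using assms(1) open_contains_cball by blast
      then show "x \<in> \<Union>F"
        unfolding F_def by (intro UnionI[of "ball x e"]) auto
    qed
    show "\<Union>F \<subseteq> U"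
      using ball_subset_cball unfolding F_def by blast
  qed
  have "\<And>S. S \<in> F \<Longrightarrow> open S"
    by (auto simp: F_def)
  then obtain F' where F': "F' \<subseteq> F" "countable F'" "\<Union>F' = \<Union>F"
    using Lindelof by metis
  have "F' \<noteq> {}"
    using F F' assms(2) by auto
  then have range: "range (from_nat_into F') = F'"
    using F'(2) by simp
  have "\<exists>c r. from_nat_into F' n = ball c r \<and> 0 < r \<and> cball c r \<subseteq> U" for n
    using F'(1) range unfolding F_def by blast
  then obtain c r where cr: "\<And>n. from_nat_into F' n = ball (c n) (r n) \<and> 0 < r n \<and> cball (c n) (r n) \<subseteq> U"
    by metis
  have "U = (\<Union>n. ball (c n) (r n))"
    using range F F'(3) cr by (metis (no_types, lifting) SUP_cong)
  then show ?thesis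
    using cr by (intro that[of r c]) auto
qed

text \<open>The j-th function is the sum of the first j bumps, saturated with parameter j. Each
  point of U lies in some ball, whose bump enters the sum eventually; off U all bumps
  vanish.\<close>

lemma C1c_approx_indicator_open:
  assumes "open (U :: (real^'n) set)"
  obtains \<phi> :: "nat \<Rightarrow> real^'n \<Rightarrow> real" where "\<And>j. \<phi> j \<in> C1c U" "\<And>j x. 0 \<le> \<phi> j x" "\<And>j x. \<phi> j x \<le> 1"
    "\<And>x. (\<lambda>j. \<phi> j x) \<longlonglongrightarrow> indicator U x"
proof (cases "U = {}")
  case True
  then show ?thesis
    using linear_subspace_zero[OF linear_subspace_C1c] by (intro that[of "\<lambda>j x. 0"]) auto
next
  case False
  obtain c :: "nat \<Rightarrow> real^'n" and r where r: "\<And>n. 0 < r n" and sub: "\<And>n. cball (c n) (r n) \<subseteq> U"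
    and U: "U = (\<Union>n. ball (c n) (r n))"
    using open_eq_Union_balls_sequence[OF assms False] by metis
  define b where "b n x = (max 0 ((r n)\<^sup>2 - (norm (x - c n))\<^sup>2))\<^sup>2" for n x
  define g where "g j x = (\<Sum>n<j. b n x)" for j x
  have b: "b n \<in> C1c U" for n
    using ball_bump_C1c[OF sub[of n]] r[of n] by (simp add: b_def[abs_def])
  have g: "g j \<in> C1c U" for j
  proof (induction j)
    case 0
    then show ?case
      using linear_subspace_zero[OF linear_subspace_C1c] by (simp add: g_def[abs_def])
  next
    case (Suc j)
    then show ?case
      using linear_subspace_add[OF linear_subspace_C1c Suc b[of j]] by (simp add: g_def[abs_def])
  qed
  have b0: "0 \<le> b n x" for n x
    by (simp add: b_def)
  then have g0: "0 \<le> g j x" for j x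
    by (simp add: g_def sum_nonneg)
  define \<phi> where "\<phi> j x = g j x * (real j / (1 + real j * g j x))" for j x
  have pos: "1 + real j * g j x > 0" for j x
    using g0[of j x] by (simp add: add_pos_nonneg)
  show ?thesis
  proof (rule that[of \<phi>])
    show "\<phi> j \<in> C1c U" for j
      using C1c_saturate[OF g[of j] g0, of "real j"] by (simp add: \<phi>_def[abs_def])
    show "0 \<le> \<phi> j x" for j x
      using g0[of j x] pos[of j x] by (simp add: \<phi>_def)
    show "\<phi> j x \<le> 1" for j x
      using pos[of j x] by (simp add: \<phi>_def field_simps)
    show "(\<lambda>j. \<phi> j x) \<longlonglongrightarrow> indicator U x" for x
    proof (cases "x \<in> U")
      case True
      then obtain m where m: "x \<in> ball (c m) (r m)"
        using U by blast
      \<comment> \<open>The contribution of one ball around x: a positive lower bound for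
        \<open>g j x\<close>, independent of j, as soon as \<open>m < j\<close>. It yields the rate
        1 / (j d).\<close>
      define d where "d = b m x"
      have "(norm (x - c m))\<^sup>2 < (r m)\<^sup>2"
        using m by (intro power_strict_mono) (auto simp: dist_norm norm_minus_commute)
      then have d: "d > 0"
        by (simp add: d_def b_def)
      have gd: "d \<le> g j x" if "m < j" for j
        unfolding d_def g_def using that b0 by (intro member_le_sum) auto
      have "(\<lambda>j. 1 - \<phi> j x) \<longlonglongrightarrow> 0"
      proof (rule Lim_null_comparison)
        show "\<forall>\<^sub>F j in sequentially. norm (1 - \<phi> j x) \<le> (1 / d) * (1 / real j)"
        proof (rule eventually_sequentiallyI[of "Suc m"])
          fix j
          assume j: "Suc m \<le> j"
          have "1 - \<phi> j x = 1 / (1 + real j * g j x)"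
            using pos[of j x] by (simp add: \<phi>_def field_simps)
          also have "norm \<dots> \<le> 1 / (real j * d)"
          proof -
            have "real j * d \<le> real j * g j x"
              using j by (intro mult_left_mono gd) auto
            then have "real j * d \<le> 1 + real j * g j x"
              by linarith
            moreover have "0 < real j * d"
              using j d by simp
            ultimately show ?thesis
              by (simp add: frac_le)
          qed
          finally show "norm (1 - \<phi> j x) \<le> (1 / d) * (1 / real j)"
            by (simp add: mult.commute)
        qed
        show "(\<lambda>j. (1 / d) * (1 / real j)) \<longlonglongrightarrow> 0"
          using tendsto_mult_left[OF lim_1_over_n[where 'a=real], of "1 / d"] by simp
      qed
      then have "(\<lambda>j. 1 - (1 - \<phi> j x)) \<longlonglongrightarrow> 1 - 0"
        by (intro tendsto_intros)
      then show ?thesis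
        using True by simp
    next
      case False
      have "b n x = 0" for n
      proof -
        have "r n \<le> norm (x - c n)"
          using False U by (auto simp: dist_norm norm_minus_commute not_less)
        then have "(r n)\<^sup>2 \<le> (norm (x - c n))\<^sup>2"
          using r[of n] by (intro power_mono) auto
        then show ?thesis
          by (simp add: b_def)
      qed
      then show ?thesis
        using False by (simp add: \<phi>_def g_def)
    qed
  qed
qed

lemma const_L2:
  assumes "\<Omega> \<in> lmeasurable"
  shows "(\<lambda>x. c) \<in> L2 \<Omega>"
  using finite_measure.integrable_const[OF finite_measure_lebesgue_on[OF assms]] by (simp add: L2_def)

text \<open>Dominated convergence along the approximation of the indicator, with majorant
  \<bar>g\<bar>. The majorant is integrable because g is in L2 and the domain has finite
  measure.\<close>

lemma integral_open_eq_0: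
  assumes \<Omega>: "\<Omega> \<in> lmeasurable" and g: "g \<in> L2 \<Omega>" and zero: "\<And>\<phi>. \<phi> \<in> C1c \<Omega> \<Longrightarrow> inner_L2 \<Omega> g \<phi> = 0"
    and U: "open U" "U \<subseteq> \<Omega>"
  shows "(LINT x | lebesgue_on \<Omega>. g x * indicator U x) = 0"
proof -
  obtain \<phi> where \<phi>: "\<And>j. \<phi> j \<in> C1c U" "\<And>j x. 0 \<le> \<phi> j x" "\<And>j x. \<phi> j x \<le> 1"
    "\<And>x. (\<lambda>j. \<phi> j x) \<longlonglongrightarrow> indicator U x"
    using C1c_approx_indicator_open[OF U(1)] by metis
  have \<Omega>s: "\<Omega> \<in> sets lebesgue"
    using \<Omega> by (rule fmeasurableD)
  have \<phi>': "\<phi> j \<in> C1c \<Omega>" for j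
    using \<phi>(1) C1c_mono[OF U(2)] by blast
  have int_g: "integrable (lebesgue_on \<Omega>) g"
    using L2_mult_integrable[OF g const_L2[OF \<Omega>, of 1]] by simp
  have "(\<lambda>j. LINT x | lebesgue_on \<Omega>. g x * \<phi> j x) \<longlonglongrightarrow> (LINT x | lebesgue_on \<Omega>. g x * indicator U x)"
  proof (rule integral_dominated_convergence[where w = "\<lambda>x. \<bar>g x\<bar>"])
    show "(\<lambda>x. g x * \<phi> j x) \<in> borel_measurable (lebesgue_on \<Omega>)" for j
      using L2_mult_integrable[OF g C1c_L2(1)[OF \<phi>'[of j] \<Omega>s]] by (rule borel_measurable_integrable)
    have "(indicator U :: _ \<Rightarrow> real) \<in> borel_measurable (lebesgue_on \<Omega>)"
      using U(1) by (intro measurable_restrict_space1 measurable_completion) simp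
    then show "(\<lambda>x. g x * indicator U x) \<in> borel_measurable (lebesgue_on \<Omega>)"
      by (intro borel_measurable_times borel_measurable_integrable[OF int_g])
    show "integrable (lebesgue_on \<Omega>) (\<lambda>x. \<bar>g x\<bar>)"
      using int_g by simp
    show "AE x in lebesgue_on \<Omega>. (\<lambda>j. g x * \<phi> j x) \<longlonglongrightarrow> g x * indicator U x"
      using \<phi>(4) by (intro AE_I2 tendsto_intros)
    show "AE x in lebesgue_on \<Omega>. norm (g x * \<phi> j x) \<le> \<bar>g x\<bar>" for j
      using \<phi>(2,3) by (intro AE_I2) (simp add: abs_mult mult_left_le)
  qed
  moreover have "(LINT x | lebesgue_on \<Omega>. g x * \<phi> j x) = 0" for j
    using zero[OF \<phi>'[of j]] by (simp add: inner_L2_def)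
  ultimately show ?thesis
    using LIMSEQ_unique[OF _ tendsto_const[of 0]] by simp
qed

text \<open>The positivity set E of g is merely measurable, so it is enclosed in an open set T with
  T - E small. The integral of g over the part of T in the domain vanishes; hence the integral over
  E equals minus the one over the excess, which Cauchy-Schwarz makes arbitrarily small.\<close>

lemma AE_nonpos_of_orthogonal_C1c:
  assumes \<Omega>: "open \<Omega>" "\<Omega> \<in> lmeasurable" and g: "g \<in> L2 \<Omega>"
    and zero: "\<And>\<phi>. \<phi> \<in> C1c \<Omega> \<Longrightarrow> inner_L2 \<Omega> g \<phi> = 0"
  shows "AE x in lebesgue_on \<Omega>. g x \<le> 0"
proof -
  let ?M = "lebesgue_on \<Omega>"
  have \<Omega>s: "\<Omega> \<in> sets lebesgue"
    using \<Omega>(2) by (rule fmeasurableD)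
  have gm: "g \<in> borel_measurable ?M"
    using g by (simp add: L2_def)
  define E where "E = {x \<in> \<Omega>. 0 < g x}"
  have "E \<in> sets ?M"
    using gm borel_measurable_less[of "\<lambda>x. 0" ?M g] by (simp add: E_def)
  then have E: "E \<in> sets lebesgue"
    using \<Omega>s by (simp add: sets_restrict_space_iff)
  \<comment> \<open>The squared L2 norm of an indicator is the measure of the set; this is how a
    small measure enters Cauchy-Schwarz.\<close>
  have ind: "indicator S \<in> L2 \<Omega> \<and> inner_L2 \<Omega> (indicator S) (indicator S) = measure lebesgue S"
    if "S \<in> sets lebesgue" "S \<subseteq> \<Omega>" for S
  proof -
    have SM: "S \<in> sets ?M"
      using that \<Omega>s by (simp add: sets_restrict_space_iff)
    have *: "S \<in> lmeasurable"
      using that \<Omega>(2) by (metis fmeasurableI2)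
    have i: "integrable ?M (indicator S :: _ \<Rightarrow> real)"
      using SM that(2) fmeasurableD2[OF *] \<Omega>s
      by (simp add: integrable_indicator_iff emeasure_restrict_space Int_absorb2 less_top)
    have sq: "(indicator S x :: real)\<^sup>2 = indicator S x" "indicator S x * indicator S x = (indicator S x :: real)" for x
      by (auto simp: indicator_def)
    have "inner_L2 \<Omega> (indicator S) (indicator S) = measure ?M (S \<inter> space ?M)"
      by (simp add: inner_L2_def sq)
    also have "\<dots> = measure lebesgue S"
      using that \<Omega>s by (simp add: measure_restrict_space Int_absorb2 Int_absorb1)
    finally show ?thesis
      using i SM by (simp add: L2_def sq)
  qed
  let ?I = "LINT x | ?M. g x * indicator E x"
  have small: "?I \<le> norm_L2 \<Omega> g * sqrt e" if e: "0 < e" for e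
  proof -
    obtain T where T: "open T" "E \<subseteq> T" "T - E \<in> lmeasurable" "emeasure lebesgue (T - E) < ennreal e"
      using sets_lebesgue_outer_open[OF E e] by metis
    \<comment> \<open>The excess of the open cover inside the domain. There g is nonpositive, but of
      no controlled size pointwise, whence the L2 bound.\<close>
    define D where "D = T \<inter> \<Omega> - E"
    have "T \<in> sets lebesgue"
      using T(1) by (simp add: sets_completionI_sets)
    then have Ds: "D \<in> sets lebesgue" "D \<subseteq> \<Omega>"
      using E \<Omega>s by (auto simp: D_def)
    have "measure lebesgue D \<le> measure lebesgue (T - E)"
      using T(3) Ds by (intro measure_mono_fmeasurable) (auto simp: D_def)
    also have "\<dots> \<le> e"
      using T(3,4) e by (simp add: emeasure_eq_measure2 ennreal_less_iff)
    finally have De: "measure lebesgue D \<le> e" .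
    have iE: "integrable ?M (\<lambda>x. g x * indicator E x)" and iD: "integrable ?M (\<lambda>x. g x * indicator D x)"
      using ind[OF E] ind[OF Ds] by (auto simp: E_def intro!: L2_mult_integrable[OF g])
    have "(LINT x | ?M. g x * indicator (T \<inter> \<Omega>) x) = 0"
      using integral_open_eq_0[OF \<Omega>(2) g zero, of "T \<inter> \<Omega>"] T(1) \<Omega>(1) by auto
    moreover have "(\<lambda>x. g x * indicator (T \<inter> \<Omega>) x) = (\<lambda>x. g x * indicator E x + g x * indicator D x)"
      using T(2) by (auto simp: D_def E_def indicator_def fun_eq_iff)
    ultimately have "?I = - inner_L2 \<Omega> g (indicator D)"
      using iE iD by (simp add: inner_L2_def)
    also have "\<dots> \<le> norm_L2 \<Omega> g * sqrt (inner_L2 \<Omega> (indicator D) (indicator D))"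
      using semi_inner_on_Cauchy_Schwarz[OF semi_inner_on_L2 g, of "indicator D"] ind[OF Ds]
      by (simp add: norm_L2_def)
    also have "\<dots> \<le> norm_L2 \<Omega> g * sqrt e"
      using ind[OF Ds] De semi_inner_on_nonneg[OF semi_inner_on_L2 g]
      by (intro mult_left_mono) (auto simp: norm_L2_def)
    finally show ?thesis .
  qed
  have "?I \<le> 0"
  proof (rule tendsto_lowerbound)
    have "((\<lambda>e. norm_L2 \<Omega> g * sqrt e) \<longlongrightarrow> norm_L2 \<Omega> g * sqrt 0) (at_right 0)"
      by (intro tendsto_intros)
    then show "((\<lambda>e. norm_L2 \<Omega> g * sqrt e) \<longlongrightarrow> 0) (at_right 0)"
      by simp
    show "\<forall>\<^sub>F e in at_right 0. ?I \<le> norm_L2 \<Omega> g * sqrt e"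
      using small by (auto simp: eventually_at_right_less intro: eventually_at_rightI[of 0 1])
  qed simp
  moreover have nn: "0 \<le> g x * indicator E x" for x
    by (auto simp: E_def indicator_def)
  moreover have iE: "integrable ?M (\<lambda>x. g x * indicator E x)"
    using ind[OF E] by (auto simp: E_def intro!: L2_mult_integrable[OF g])
  moreover have "0 \<le> ?I"
    using nn by (intro integral_nonneg_AE AE_I2)
  ultimately have "?I = 0"
    by linarith
  then have "AE x in ?M. g x * indicator E x = 0"
    using integral_nonneg_eq_0_iff_AE[OF iE] nn by simp
  then show ?thesis
    by (rule AE_mp) (auto intro!: AE_I2 simp: E_def indicator_def)
qed

lemma AE_eq_0_of_orthogonal_C1c:
  assumes \<Omega>: "open \<Omega>" "\<Omega> \<in> lmeasurable" and g: "g \<in> L2 \<Omega>"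
    and zero: "\<And>\<phi>. \<phi> \<in> C1c \<Omega> \<Longrightarrow> inner_L2 \<Omega> g \<phi> = 0"
  shows "AE x in lebesgue_on \<Omega>. g x = 0"
proof -
  have g': "(\<lambda>x. - g x) \<in> L2 \<Omega>"
    using linear_subspace_scale[OF linear_subspace_L2 g, of "-1"] by simp
  have "AE x in lebesgue_on \<Omega>. g x \<le> 0"
    by (rule AE_nonpos_of_orthogonal_C1c[OF assms])
  moreover have "AE x in lebesgue_on \<Omega>. - g x \<le> 0"
    using zero by (intro AE_nonpos_of_orthogonal_C1c[OF \<Omega> g']) (simp add: inner_L2_def)
  ultimately show ?thesis
    by eventually_elim simp
qed

section \<open>Sobolev spaces and the energy form\<close>

lemma L2_abs_dominated:
  assumes "g \<in> L2 \<Omega>" "h \<in> borel_measurable (lebesgue_on \<Omega>)" "\<And>x. x \<in> \<Omega> \<Longrightarrow> \<bar>h x\<bar> \<le> \<bar>g x\<bar>"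
    and "\<Omega> \<in> sets lebesgue"
  shows "h \<in> L2 \<Omega>" and "norm_L2 \<Omega> h \<le> norm_L2 \<Omega> g"
proof -
  have g: "integrable (lebesgue_on \<Omega>) (\<lambda>x. (g x)\<^sup>2)"
    using assms(1) by (simp add: L2_def)
  have le: "(h x)\<^sup>2 \<le> (g x)\<^sup>2" if "x \<in> \<Omega>" for x
    using assms(3)[OF that] by (simp add: abs_le_square_iff)
  have h: "integrable (lebesgue_on \<Omega>) (\<lambda>x. (h x)\<^sup>2)"
  proof (rule Bochner_Integration.integrable_bound[OF g])
    show "(\<lambda>x. (h x)\<^sup>2) \<in> borel_measurable (lebesgue_on \<Omega>)"
      using assms(2) by simp
    show "AE x in lebesgue_on \<Omega>. norm ((h x)\<^sup>2) \<le> norm ((g x)\<^sup>2)"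
      using le by (intro AE_I2) auto
  qed
  then show "h \<in> L2 \<Omega>"
    using assms(2) by (simp add: L2_def)
  have "(LINT x | lebesgue_on \<Omega>. (h x)\<^sup>2) \<le> (LINT x | lebesgue_on \<Omega>. (g x)\<^sup>2)"
    using le by (intro integral_mono[OF h g]) auto
  then show "norm_L2 \<Omega> h \<le> norm_L2 \<Omega> g"
    by (simp add: norm_L2_def inner_L2_def power2_eq_square)
qed

text \<open>Passing to components turns every condition into one about \<open>L2\<close> and
  \<open>inner_L2\<close>, so that bilinearity and the fundamental lemma apply to scalar
  functions.\<close>

lemma is_weak_gradient_iff:
  assumes "\<Omega> \<in> sets lebesgue"
  shows "is_weak_gradient \<Omega> v G \<longleftrightarrow> (\<forall>i. (\<lambda>x. G x $ i) \<in> L2 \<Omega>) \<and>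
    (\<forall>\<phi>\<in>C1c \<Omega>. \<forall>i. inner_L2 \<Omega> v (\<lambda>x. classical_gradient \<phi> x $ i) = - inner_L2 \<Omega> (\<lambda>x. G x $ i) \<phi>)"
proof -
  have norm: "(norm (G x))\<^sup>2 = (\<Sum>i\<in>UNIV. (G x $ i)\<^sup>2)" for x
    by (simp add: norm_vec_def L2_set_def sum_nonneg)
  have "G \<in> borel_measurable (lebesgue_on \<Omega>) \<and> integrable (lebesgue_on \<Omega>) (\<lambda>x. (norm (G x))\<^sup>2)
      \<longleftrightarrow> (\<forall>i. (\<lambda>x. G x $ i) \<in> L2 \<Omega>)" (is "?L \<longleftrightarrow> ?R")
  proof
    assume L: ?L
    show ?R
    proof
      fix i
      have m: "(\<lambda>x. G x $ i) \<in> borel_measurable (lebesgue_on \<Omega>)"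
        using borel_measurable_inner[of G "lebesgue_on \<Omega>" "\<lambda>x. axis i 1"] L by (simp add: inner_axis)
      have "(\<lambda>x. norm (G x)) \<in> L2 \<Omega>"
        using L measurable_compose[OF _ borel_measurable_norm] by (auto simp: L2_def)
      then show "(\<lambda>x. G x $ i) \<in> L2 \<Omega>"
        by (rule L2_abs_dominated(1)[OF _ m _ assms]) (simp add: component_le_norm_cart)
    qed
  next
    assume R: ?R
    have "G \<in> borel_measurable (lebesgue_on \<Omega>)"
    proof (subst borel_measurable_euclidean_space, rule ballI)
      fix b :: "real^'a"
      assume "b \<in> Basis"
      then obtain i where "b = axis i 1"
        by (auto simp: Basis_vec_def)
      then show "(\<lambda>x. G x \<bullet> b) \<in> borel_measurable (lebesgue_on \<Omega>)"
        using R by (simp add: inner_axis L2_def)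
    qed
    then show ?L
      using R by (simp add: norm L2_def)
  qed
  then show ?thesis
    by (auto simp: is_weak_gradient_def inner_L2_def)
qed

text \<open>Componentwise, the difference of two weak gradients is orthogonal to all test functions.
  Finitely many components leave a single null set.\<close>

lemma weak_gradient_unique_AE:
  assumes \<Omega>: "open \<Omega>" "\<Omega> \<in> lmeasurable" and G: "is_weak_gradient \<Omega> v G" and H: "is_weak_gradient \<Omega> v H"
  shows "AE x in lebesgue_on \<Omega>. G x = H x"
proof -
  have s: "\<Omega> \<in> sets lebesgue"
    using \<Omega>(2) by (rule fmeasurableD)
  have "AE x in lebesgue_on \<Omega>. G x $ i - H x $ i = 0" for i
  proof (rule AE_eq_0_of_orthogonal_C1c[OF \<Omega>])
    have Gi: "(\<lambda>x. G x $ i) \<in> L2 \<Omega>" and Hi: "(\<lambda>x. H x $ i) \<in> L2 \<Omega>"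
      using G H is_weak_gradient_iff[OF s] by blast+
    then show "(\<lambda>x. G x $ i - H x $ i) \<in> L2 \<Omega>"
      by (rule linear_subspace_diff[OF linear_subspace_L2])
    fix \<phi>
    assume \<phi>: "\<phi> \<in> C1c \<Omega>"
    have "- inner_L2 \<Omega> (\<lambda>x. G x $ i) \<phi> = - inner_L2 \<Omega> (\<lambda>x. H x $ i) \<phi>"
      using G H \<phi> by (simp add: is_weak_gradient_iff[OF s])
    then show "inner_L2 \<Omega> (\<lambda>x. G x $ i - H x $ i) \<phi> = 0"
      using semi_inner_on_diff[OF semi_inner_on_L2 Gi Hi C1c_L2(1)[OF \<phi> s]] by simp
  qed
  then have "AE x in lebesgue_on \<Omega>. \<forall>i. G x $ i - H x $ i = 0"
    by (simp add: AE_all_countable)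
  then show ?thesis
    by eventually_elim (simp add: vec_eq_iff)
qed

lemma is_weak_gradient_grad: "v \<in> H1 \<Omega> \<Longrightarrow> is_weak_gradient \<Omega> v (grad \<Omega> v)"
  unfolding grad_def H1_def by (metis (mono_tags, lifting) mem_Collect_eq someI_ex)

lemma is_weak_gradient_add:
  assumes s: "\<Omega> \<in> sets lebesgue" and v: "v \<in> L2 \<Omega>" "is_weak_gradient \<Omega> v G"
    and w: "w \<in> L2 \<Omega>" "is_weak_gradient \<Omega> w H"
  shows "is_weak_gradient \<Omega> (\<lambda>x. v x + w x) (\<lambda>x. G x + H x)"
proof -
  have add: "inner_L2 \<Omega> (\<lambda>x. a x + b x) c = inner_L2 \<Omega> a c + inner_L2 \<Omega> b c"
    if "a \<in> L2 \<Omega>" "b \<in> L2 \<Omega>" "c \<in> L2 \<Omega>" for a b c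
    using semi_inner_on_L2 that by (auto simp: semi_inner_on_def)
  have G: "(\<lambda>x. G x $ i) \<in> L2 \<Omega>" and H: "(\<lambda>x. H x $ i) \<in> L2 \<Omega>" for i
    using v(2) w(2) is_weak_gradient_iff[OF s] by blast+
  then have "(\<lambda>x. G x $ i + H x $ i) \<in> L2 \<Omega>" for i
    by (rule linear_subspace_add[OF linear_subspace_L2])
  moreover have "inner_L2 \<Omega> (\<lambda>x. v x + w x) (\<lambda>x. classical_gradient \<phi> x $ i)
      = - inner_L2 \<Omega> (\<lambda>x. G x $ i + H x $ i) \<phi>" if \<phi>: "\<phi> \<in> C1c \<Omega>" for \<phi> i
    using v(2) w(2) that add[OF v(1) w(1) C1c_L2(2)[OF \<phi> s]] add[OF G H C1c_L2(1)[OF \<phi> s]]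
    by (simp add: is_weak_gradient_iff[OF s])
  ultimately show ?thesis
    by (simp add: is_weak_gradient_iff[OF s])
qed

lemma is_weak_gradient_scale:
  assumes s: "\<Omega> \<in> sets lebesgue" and v: "v \<in> L2 \<Omega>" "is_weak_gradient \<Omega> v G"
  shows "is_weak_gradient \<Omega> (\<lambda>x. c * v x) (\<lambda>x. c *\<^sub>R G x)"
proof -
  have G: "(\<lambda>x. G x $ i) \<in> L2 \<Omega>" for i
    using v(2) is_weak_gradient_iff[OF s] by blast
  then have "(\<lambda>x. c * G x $ i) \<in> L2 \<Omega>" for i
    by (rule linear_subspace_scale[OF linear_subspace_L2])
  moreover have "inner_L2 \<Omega> (\<lambda>x. c * v x) (\<lambda>x. classical_gradient \<phi> x $ i)
      = - inner_L2 \<Omega> (\<lambda>x. c * G x $ i) \<phi>" if "\<phi> \<in> C1c \<Omega>" for \<phi> i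
    using v(2) that by (simp add: is_weak_gradient_iff[OF s]) (simp add: inner_L2_def mult.assoc)
  ultimately show ?thesis
    by (simp add: is_weak_gradient_iff[OF s])
qed

text \<open>Together with uniqueness, this identifies the chosen \<open>grad\<close> of a test
  function with the classical gradient almost everywhere, which the Poincare inequality relies
  on.\<close>

lemma is_weak_gradient_C1c:
  assumes s: "\<Omega> \<in> sets lebesgue" and \<phi>: "\<phi> \<in> C1c \<Omega>"
  shows "is_weak_gradient \<Omega> \<phi> (classical_gradient \<phi>)"
proof -
  have "inner_L2 \<Omega> \<phi> (\<lambda>x. classical_gradient \<psi> x $ i) = - inner_L2 \<Omega> (\<lambda>x. classical_gradient \<phi> x $ i) \<psi>"
    if \<psi>: "\<psi> \<in> C1c \<Omega>" for \<psi> i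
  proof -
    have "\<And>x. (\<psi> has_derivative (\<lambda>h. classical_gradient \<psi> x \<bullet> h)) (at x)"
      "continuous_on UNIV (classical_gradient \<psi>)"
      using \<psi> by (auto simp: C1c_def intro: has_derivative_classical_gradient)
    from integration_by_parts_C1c[OF \<phi> s this, of i] show ?thesis
      using L2_mult_integrable[OF C1c_L2(1)[OF \<phi> s] C1c_L2(2)[OF \<psi> s]]
        L2_mult_integrable[OF C1c_L2(1)[OF \<psi> s] C1c_L2(2)[OF \<phi> s]]
      by (simp add: inner_L2_def mult.commute)
  qed
  then show ?thesis
    using C1c_L2(2)[OF \<phi> s] by (simp add: is_weak_gradient_iff[OF s])
qed

lemma C1c_subset_H1: "\<Omega> \<in> sets lebesgue \<Longrightarrow> C1c \<Omega> \<subseteq> H1 \<Omega>"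
  using C1c_L2(1) is_weak_gradient_C1c unfolding H1_def by blast

lemma linear_subspace_H1:
  assumes "\<Omega> \<in> sets lebesgue"
  shows "linear_subspace (H1 \<Omega>)"
proof -
  have "(\<lambda>x. 0) \<in> H1 \<Omega>"
    using C1c_subset_H1[OF assms] linear_subspace_zero[OF linear_subspace_C1c] by blast
  moreover have "(\<lambda>x. v x + w x) \<in> H1 \<Omega>" if "v \<in> H1 \<Omega>" "w \<in> H1 \<Omega>" for v w
  proof -
    obtain G H where "v \<in> L2 \<Omega>" "is_weak_gradient \<Omega> v G" "w \<in> L2 \<Omega>" "is_weak_gradient \<Omega> w H"
      using \<open>v \<in> H1 \<Omega>\<close> \<open>w \<in> H1 \<Omega>\<close> unfolding H1_def by blast
    from is_weak_gradient_add[OF assms this] linear_subspace_add[OF linear_subspace_L2 this(1,3)]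
    show ?thesis
      unfolding H1_def by blast
  qed
  moreover have "(\<lambda>x. c * v x) \<in> H1 \<Omega>" if "v \<in> H1 \<Omega>" for c v
  proof -
    obtain G where "v \<in> L2 \<Omega>" "is_weak_gradient \<Omega> v G"
      using \<open>v \<in> H1 \<Omega>\<close> unfolding H1_def by blast
    from is_weak_gradient_scale[OF assms this] linear_subspace_scale[OF linear_subspace_L2 this(1)]
    show ?thesis
      unfolding H1_def by blast
  qed
  ultimately show ?thesis
    by (simp add: linear_subspace_def)
qed

lemma grad_add_AE:
  assumes \<Omega>: "open \<Omega>" "\<Omega> \<in> lmeasurable" and "v \<in> H1 \<Omega>" "w \<in> H1 \<Omega>"
  shows "AE x in lebesgue_on \<Omega>. grad \<Omega> (\<lambda>x. v x + w x) x = grad \<Omega> v x + grad \<Omega> w x"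
proof (rule weak_gradient_unique_AE[OF \<Omega>])
  have s: "\<Omega> \<in> sets lebesgue"
    using \<Omega>(2) by (rule fmeasurableD)
  show "is_weak_gradient \<Omega> (\<lambda>x. v x + w x) (grad \<Omega> (\<lambda>x. v x + w x))"
    by (intro is_weak_gradient_grad linear_subspace_add[OF linear_subspace_H1[OF s]] assms)
  show "is_weak_gradient \<Omega> (\<lambda>x. v x + w x) (\<lambda>x. grad \<Omega> v x + grad \<Omega> w x)"
    using assms by (intro is_weak_gradient_add s is_weak_gradient_grad) (auto simp: H1_def)
qed

lemma grad_scale_AE:
  assumes \<Omega>: "open \<Omega>" "\<Omega> \<in> lmeasurable" and "v \<in> H1 \<Omega>"
  shows "AE x in lebesgue_on \<Omega>. grad \<Omega> (\<lambda>x. c * v x) x = c *\<^sub>R grad \<Omega> v x"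
proof (rule weak_gradient_unique_AE[OF \<Omega>])
  have s: "\<Omega> \<in> sets lebesgue"
    using \<Omega>(2) by (rule fmeasurableD)
  show "is_weak_gradient \<Omega> (\<lambda>x. c * v x) (grad \<Omega> (\<lambda>x. c * v x))"
    by (intro is_weak_gradient_grad linear_subspace_scale[OF linear_subspace_H1[OF s]] assms)
  show "is_weak_gradient \<Omega> (\<lambda>x. c * v x) (\<lambda>x. c *\<^sub>R grad \<Omega> v x)"
    using assms by (intro is_weak_gradient_scale s is_weak_gradient_grad) (auto simp: H1_def)
qed

section \<open>The energy form\<close>

text \<open>With the identity matrix the energy form is the Dirichlet form, so the gradient part of
  the H^1 norm becomes an instance of everything proved for \<open>a_hat\<close>.\<close>

lemma spd_coefficient_mat_1: "spd_coefficient \<Omega> (\<lambda>x. mat 1)"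
proof -
  have "\<bar>(mat 1 :: real^'a^'a) $ i $ j\<bar> \<le> 1" for i j
    by (simp add: mat_def)
  then show ?thesis
    by (auto simp: spd_coefficient_def intro: exI[of _ 1])
qed

text \<open>Written out in entries, the integrand is a finite sum of bounded coefficients times
  products of two L2 functions.\<close>

lemma integrable_matrix_inner:
  assumes A: "spd_coefficient \<Omega> \<A>" and G: "\<And>i. (\<lambda>x. G x $ i) \<in> L2 \<Omega>" and H: "\<And>i. (\<lambda>x. H x $ i) \<in> L2 \<Omega>"
    and s: "\<Omega> \<in> sets lebesgue"
  shows "integrable (lebesgue_on \<Omega>) (\<lambda>x. (\<A> x *v G x) \<bullet> H x)"
proof -
  obtain K where K: "\<And>x i j. x \<in> \<Omega> \<Longrightarrow> \<bar>\<A> x $ i $ j\<bar> \<le> K"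
    using A unfolding spd_coefficient_def by blast
  have meas: "(\<lambda>x. \<A> x $ i $ j) \<in> borel_measurable (lebesgue_on \<Omega>)" for i j
    using A unfolding spd_coefficient_def by blast
  have "integrable (lebesgue_on \<Omega>) (\<lambda>x. \<A> x $ i $ j * (G x $ j * H x $ i))" for i j
  proof (rule Bochner_Integration.integrable_bound)
    show int: "integrable (lebesgue_on \<Omega>) (\<lambda>x. K * (G x $ j * H x $ i))"
      using L2_mult_integrable[OF G H] by simp
    show "(\<lambda>x. \<A> x $ i $ j * (G x $ j * H x $ i)) \<in> borel_measurable (lebesgue_on \<Omega>)"
      by (intro borel_measurable_times[OF meas] borel_measurable_integrable L2_mult_integrable[OF G H])
    have "\<bar>\<A> x $ i $ j\<bar> * \<bar>G x $ j * H x $ i\<bar> \<le> \<bar>K\<bar> * \<bar>G x $ j * H x $ i\<bar>" if "x \<in> \<Omega>" for x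
      using K[OF that, of i j] by (intro mult_right_mono) auto
    then show "AE x in lebesgue_on \<Omega>. norm (\<A> x $ i $ j * (G x $ j * H x $ i)) \<le> norm (K * (G x $ j * H x $ i))"
      by (intro AE_I2) (simp add: abs_mult)
  qed
  then have "integrable (lebesgue_on \<Omega>) (\<lambda>x. \<Sum>i\<in>UNIV. \<Sum>j\<in>UNIV. \<A> x $ i $ j * (G x $ j * H x $ i))"
    by simp
  then show ?thesis
    by (simp add: inner_vec_def matrix_vector_mult_def sum_distrib_right mult.assoc)
qed

lemma a_hat_integrable:
  assumes A: "spd_coefficient \<Omega> \<A>" and "v \<in> H1 \<Omega>" "w \<in> H1 \<Omega>" and s: "\<Omega> \<in> sets lebesgue"
  shows "integrable (lebesgue_on \<Omega>) (\<lambda>x. (\<A> x *v grad \<Omega> v x) \<bullet> grad \<Omega> w x)"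
  using is_weak_gradient_grad assms(2,3) is_weak_gradient_iff[OF s]
  by (intro integrable_matrix_inner[OF A _ _ s]) blast+

text \<open>Symmetry and positivity hold pointwise for the matrix. Linearity holds only under the
  integral, since the chosen gradient of a sum or multiple obeys the expected rule merely off a null
  set.\<close>

lemma semi_inner_on_a_hat:
  assumes A: "spd_coefficient \<Omega> \<A>" and \<Omega>: "open \<Omega>" "\<Omega> \<in> lmeasurable"
  shows "semi_inner_on (H1 \<Omega>) (a_hat \<Omega> \<A>)"
proof -
  have s: "\<Omega> \<in> sets lebesgue"
    using \<Omega>(2) by (rule fmeasurableD)
  note lin = linear_subspace_H1[OF s]
  note int = a_hat_integrable[OF A _ _ s]
  have "a_hat \<Omega> \<A> u v = a_hat \<Omega> \<A> v u" for u v
  proof -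
    have "(\<A> x *v p) \<bullet> q = (\<A> x *v q) \<bullet> p" if "x \<in> \<Omega>" for x p q
    proof -
      have "transpose (\<A> x) = \<A> x"
        using A that by (auto simp: spd_coefficient_def)
      then have "(\<A> x *v p) \<bullet> q = (p v* \<A> x) \<bullet> q"
        by (metis transpose_matrix_vector)
      then show ?thesis
        by (metis dot_lmul_matrix inner_commute)
    qed
    then show ?thesis
      unfolding a_hat_def by (intro Bochner_Integration.integral_cong) auto
  qed
  moreover have "0 \<le> a_hat \<Omega> \<A> u u" for u
  proof -
    obtain \<alpha> where \<alpha>: "\<alpha> > 0" "\<And>x \<xi>. x \<in> \<Omega> \<Longrightarrow> \<alpha> * (\<xi> \<bullet> \<xi>) \<le> (\<A> x *v \<xi>) \<bullet> \<xi>"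
      using A unfolding spd_coefficient_def by blast
    have "0 \<le> (\<A> x *v \<xi>) \<bullet> \<xi>" if "x \<in> \<Omega>" for x \<xi>
      using \<alpha>(1) by (intro order_trans[OF _ \<alpha>(2)[OF that]]) simp
    then show ?thesis
      unfolding a_hat_def by (intro integral_nonneg_AE AE_I2) auto
  qed
  moreover have "a_hat \<Omega> \<A> (\<lambda>x. u x + v x) w = a_hat \<Omega> \<A> u w + a_hat \<Omega> \<A> v w"
    if u: "u \<in> H1 \<Omega>" and v: "v \<in> H1 \<Omega>" and w: "w \<in> H1 \<Omega>" for u v w
  proof -
    have "a_hat \<Omega> \<A> (\<lambda>x. u x + v x) w
        = (LINT x | lebesgue_on \<Omega>. (\<A> x *v grad \<Omega> u x) \<bullet> grad \<Omega> w x + (\<A> x *v grad \<Omega> v x) \<bullet> grad \<Omega> w x)"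
      unfolding a_hat_def
    proof (rule integral_cong_AE)
      show "AE x in lebesgue_on \<Omega>. (\<A> x *v grad \<Omega> (\<lambda>x. u x + v x) x) \<bullet> grad \<Omega> w x
          = (\<A> x *v grad \<Omega> u x) \<bullet> grad \<Omega> w x + (\<A> x *v grad \<Omega> v x) \<bullet> grad \<Omega> w x"
        using grad_add_AE[OF \<Omega> u v]
        by eventually_elim (simp add: matrix_vector_right_distrib inner_add_left)
    qed (intro borel_measurable_add borel_measurable_integrable int linear_subspace_add[OF lin] u v w)+
    also have "\<dots> = a_hat \<Omega> \<A> u w + a_hat \<Omega> \<A> v w"
      unfolding a_hat_def by (rule Bochner_Integration.integral_add[OF int[OF u w] int[OF v w]])
    finally show ?thesis .
  qed
  moreover have "a_hat \<Omega> \<A> (\<lambda>x. c * u x) w = c * a_hat \<Omega> \<A> u w"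
    if u: "u \<in> H1 \<Omega>" and w: "w \<in> H1 \<Omega>" for c u w
  proof -
    have "a_hat \<Omega> \<A> (\<lambda>x. c * u x) w = (LINT x | lebesgue_on \<Omega>. c * ((\<A> x *v grad \<Omega> u x) \<bullet> grad \<Omega> w x))"
      unfolding a_hat_def
    proof (rule integral_cong_AE)
      show "AE x in lebesgue_on \<Omega>. (\<A> x *v grad \<Omega> (\<lambda>x. c * u x) x) \<bullet> grad \<Omega> w x
          = c * ((\<A> x *v grad \<Omega> u x) \<bullet> grad \<Omega> w x)"
        using grad_scale_AE[OF \<Omega> u, of c]
        by eventually_elim (simp add: matrix_vector_mult_scaleR)
    qed (intro borel_measurable_times borel_measurable_const borel_measurable_integrable int
        linear_subspace_scale[OF lin] u w)+
    then show ?thesis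
      by (simp add: a_hat_def)
  qed
  ultimately show ?thesis
    using lin by (auto simp: semi_inner_on_def)
qed

lemma norm_a_mat_1:
  "norm_a \<Omega> (\<lambda>x. mat 1) v = sqrt (LINT x | lebesgue_on \<Omega>. (norm (grad \<Omega> v x))\<^sup>2)"
  by (simp add: norm_a_def a_hat_def power2_norm_eq_inner)

section \<open>The H^1 norm, the closure of the test functions and the Poincare inequality\<close>

lemma semi_inner_on_plus:
  assumes "semi_inner_on W B" "semi_inner_on W B'"
  shows "semi_inner_on W (\<lambda>u v. B u v + B' u v)"
  using assms by (auto simp: semi_inner_on_def distrib_left)

lemma semi_inner_on_H1:
  assumes \<Omega>: "open \<Omega>" "\<Omega> \<in> lmeasurable"
  shows "semi_inner_on (H1 \<Omega>) (\<lambda>u v. inner_L2 \<Omega> u v + a_hat \<Omega> (\<lambda>x. mat 1) u v)"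
  by (intro semi_inner_on_plus semi_inner_on_a_hat spd_coefficient_mat_1 \<Omega>
      semi_inner_on_subset[OF semi_inner_on_L2] linear_subspace_H1 fmeasurableD[OF \<Omega>(2)])
    (auto simp: H1_def)

lemma norm_H1_eq: "norm_H1 \<Omega> v = sqrt (inner_L2 \<Omega> v v + a_hat \<Omega> (\<lambda>x. mat 1) v v)"
  unfolding norm_H1_def inner_L2_def a_hat_def power2_norm_eq_inner
  by (simp add: power2_eq_square)

lemma H10_subset_H1: "H10 \<Omega> \<subseteq> H1 \<Omega>" and H1_subset_L2: "H1 \<Omega> \<subseteq> L2 \<Omega>"
  by (auto simp: H10_def H1_def)

lemma norm_le_norm_H1:
  assumes \<Omega>: "open \<Omega>" "\<Omega> \<in> lmeasurable" and "v \<in> H1 \<Omega>"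
  shows "norm_L2 \<Omega> v \<le> norm_H1 \<Omega> v" and "norm_a \<Omega> (\<lambda>x. mat 1) v \<le> norm_H1 \<Omega> v"
  using semi_inner_on_nonneg[OF semi_inner_on_a_hat[OF spd_coefficient_mat_1 \<Omega>] assms(3)]
    semi_inner_on_nonneg[OF semi_inner_on_L2, of v \<Omega>] H1_subset_L2 assms(3)
  by (auto simp: norm_L2_def norm_a_def norm_H1_eq intro!: real_sqrt_le_mono)

text \<open>The approximating sequences are added and scaled. That the errors still tend to 0 rests
  on the triangle inequality for \<open>norm_H1\<close>, hence on uniqueness of weak
  gradients.\<close>

lemma linear_subspace_H10:
  assumes \<Omega>: "open \<Omega>" "\<Omega> \<in> lmeasurable"
  shows "linear_subspace (H10 \<Omega>)"
proof -
  have s: "\<Omega> \<in> sets lebesgue"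
    using \<Omega>(2) by (rule fmeasurableD)
  note lin = linear_subspace_H1[OF s] and B = semi_inner_on_H1[OF \<Omega>]
  have diff: "(\<lambda>x. v x - \<phi> x) \<in> H1 \<Omega>" if "v \<in> H1 \<Omega>" "\<phi> \<in> C1c \<Omega>" for v \<phi>
    using linear_subspace_diff[OF lin that(1)] C1c_subset_H1[OF s] that(2) by blast
  have zero: "(\<lambda>x. 0) \<in> H10 \<Omega>"
    using linear_subspace_zero[OF lin] linear_subspace_zero[OF linear_subspace_C1c]
    by (auto simp: H10_def norm_H1_eq semi_inner_on_zero[OF B] intro!: exI[of _ "\<lambda>j x. 0"])
  have add: "(\<lambda>x. v x + w x) \<in> H10 \<Omega>" if v: "v \<in> H10 \<Omega>" and w: "w \<in> H10 \<Omega>" for v w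
  proof -
    obtain \<phi> where \<phi>: "\<And>j. \<phi> j \<in> C1c \<Omega>" "(\<lambda>j. norm_H1 \<Omega> (\<lambda>x. v x - \<phi> j x)) \<longlonglongrightarrow> 0"
      using v by (auto simp: H10_def)
    obtain \<psi> where \<psi>: "\<And>j. \<psi> j \<in> C1c \<Omega>" "(\<lambda>j. norm_H1 \<Omega> (\<lambda>x. w x - \<psi> j x)) \<longlonglongrightarrow> 0"
      using w by (auto simp: H10_def)
    have vw: "v \<in> H1 \<Omega>" "w \<in> H1 \<Omega>"
      using v w H10_subset_H1 by auto
    have "(\<lambda>j. norm_H1 \<Omega> (\<lambda>x. (v x + w x) - (\<phi> j x + \<psi> j x))) \<longlonglongrightarrow> 0"
    proof (rule Lim_null_comparison)
      show "\<forall>\<^sub>F j in sequentially. norm (norm_H1 \<Omega> (\<lambda>x. (v x + w x) - (\<phi> j x + \<psi> j x)))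
          \<le> norm_H1 \<Omega> (\<lambda>x. v x - \<phi> j x) + norm_H1 \<Omega> (\<lambda>x. w x - \<psi> j x)"
      proof (rule always_eventually, rule allI)
        fix j
        have eq: "(\<lambda>x. (v x + w x) - (\<phi> j x + \<psi> j x)) = (\<lambda>x. (v x - \<phi> j x) + (w x - \<psi> j x))"
          by auto
        note d = diff[OF vw(1) \<phi>(1)[of j]] diff[OF vw(2) \<psi>(1)[of j]]
        show "norm (norm_H1 \<Omega> (\<lambda>x. (v x + w x) - (\<phi> j x + \<psi> j x)))
          \<le> norm_H1 \<Omega> (\<lambda>x. v x - \<phi> j x) + norm_H1 \<Omega> (\<lambda>x. w x - \<psi> j x)"
          unfolding eq norm_H1_eq
          using semi_inner_on_triangle[OF B d] semi_inner_on_nonneg[OF B linear_subspace_add[OF lin d]]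
          by simp
      qed
      show "(\<lambda>j. norm_H1 \<Omega> (\<lambda>x. v x - \<phi> j x) + norm_H1 \<Omega> (\<lambda>x. w x - \<psi> j x)) \<longlonglongrightarrow> 0"
        using tendsto_add[OF \<phi>(2) \<psi>(2)] by simp
    qed
    then show ?thesis
      using linear_subspace_add[OF lin vw] linear_subspace_add[OF linear_subspace_C1c \<phi>(1) \<psi>(1)]
      by (auto simp: H10_def intro!: exI[of _ "\<lambda>j x. \<phi> j x + \<psi> j x"])
  qed
  have scale: "(\<lambda>x. c * v x) \<in> H10 \<Omega>" if v: "v \<in> H10 \<Omega>" for c v
  proof -
    obtain \<phi> where \<phi>: "\<And>j. \<phi> j \<in> C1c \<Omega>" "(\<lambda>j. norm_H1 \<Omega> (\<lambda>x. v x - \<phi> j x)) \<longlonglongrightarrow> 0"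
      using v by (auto simp: H10_def)
    have v': "v \<in> H1 \<Omega>"
      using v H10_subset_H1 by auto
    have "norm_H1 \<Omega> (\<lambda>x. c * v x - c * \<phi> j x) = \<bar>c\<bar> * norm_H1 \<Omega> (\<lambda>x. v x - \<phi> j x)" for j
      using semi_inner_on_scale[OF B diff[OF v' \<phi>(1)], of c j] by (simp add: norm_H1_eq right_diff_distrib)
    then have "(\<lambda>j. norm_H1 \<Omega> (\<lambda>x. c * v x - c * \<phi> j x)) \<longlonglongrightarrow> 0"
      using tendsto_mult_left[OF \<phi>(2), of "\<bar>c\<bar>"] by simp
    then show ?thesis
      using linear_subspace_scale[OF lin v'] linear_subspace_scale[OF linear_subspace_C1c \<phi>(1)]
      by (auto simp: H10_def intro!: exI[of _ "\<lambda>j x. c * \<phi> j x"])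
  qed
  show ?thesis
    using zero add scale by (auto simp: linear_subspace_def)
qed

text \<open>Integrate \<open>\<phi>\<^sup>2\<close> by parts against the derivative of a coordinate function.\<close>

lemma Poincare_C1c:
  fixes \<Omega> :: "(real^'n) set"
  assumes \<Omega>: "open \<Omega>" "\<Omega> \<in> lmeasurable" and R: "\<And>x. x \<in> \<Omega> \<Longrightarrow> norm x \<le> R" "0 \<le> R" and \<phi>: "\<phi> \<in> C1c \<Omega>"
  shows "norm_L2 \<Omega> \<phi> \<le> 2 * R * norm_a \<Omega> (\<lambda>x. mat 1) \<phi>"
proof -
  have s: "\<Omega> \<in> sets lebesgue"
    using \<Omega>(2) by (rule fmeasurableD)
  let ?D = "classical_gradient \<phi>"
  obtain K where K: "\<And>x. (\<phi> has_derivative (\<lambda>h. ?D x \<bullet> h)) (at x)"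
    "continuous_on UNIV ?D" "continuous_on UNIV \<phi>" "compact K" "K \<subseteq> \<Omega>"
    "\<And>x. x \<notin> K \<Longrightarrow> \<phi> x = 0" "\<And>x. x \<notin> K \<Longrightarrow> ?D x = 0"
    using C1cE[OF \<phi>] by metis
  \<comment> \<open>Any coordinate direction will do; one exists because index types are
    nonempty.\<close>
  define i :: 'n where "i = undefined"
  note sq = C1c_mult[OF \<phi> K(1,2)]
  have Di: "(\<lambda>x. ?D x $ i) \<in> L2 \<Omega>"
    by (rule C1c_L2(2)[OF \<phi> s])
  have xD: "(\<lambda>x. x $ i * ?D x $ i) \<in> L2 \<Omega>"
    using K s by (intro continuous_compact_support_L2[of _ K] continuous_intros) auto
  have \<phi>L: "\<phi> \<in> L2 \<Omega>"
    by (rule C1c_L2(1)[OF \<phi> s])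
  have "((\<lambda>x::real^'n. x $ i) has_derivative (\<lambda>h. axis i 1 \<bullet> h)) (at x)" for x
    by (rule has_derivative_eq_rhs[OF bounded_linear_imp_has_derivative[OF bounded_linear_vec_nth]])
      (simp add: inner_axis')
  then have "(LINT x | lebesgue_on \<Omega>. \<phi> x * \<phi> x * (axis i 1 :: real^'n) $ i
      + x $ i * classical_gradient (\<lambda>x. \<phi> x * \<phi> x) x $ i) = 0"
    by (intro integration_by_parts_C1c[OF sq(1) s]) auto
  then have "(LINT x | lebesgue_on \<Omega>. \<phi> x * \<phi> x + 2 * (\<phi> x * (x $ i * ?D x $ i))) = 0"
    unfolding sq(2) by (simp add: algebra_simps)
  then have "inner_L2 \<Omega> \<phi> \<phi> = - 2 * inner_L2 \<Omega> \<phi> (\<lambda>x. x $ i * ?D x $ i)"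
    using L2_mult_integrable[OF \<phi>L \<phi>L] L2_mult_integrable[OF \<phi>L xD]
    by (simp add: inner_L2_def)
  also have "\<dots> \<le> 2 * \<bar>inner_L2 \<Omega> \<phi> (\<lambda>x. x $ i * ?D x $ i)\<bar>"
    by simp
  also have "\<dots> \<le> 2 * (norm_L2 \<Omega> \<phi> * norm_L2 \<Omega> (\<lambda>x. x $ i * ?D x $ i))"
    using semi_inner_on_Cauchy_Schwarz[OF semi_inner_on_L2 \<phi>L xD] by (simp add: norm_L2_def)
  \<comment> \<open>In the domain the weight x_i is at most R in modulus, and the classical partial
    derivative is almost everywhere a component of the chosen weak gradient.\<close>
  also have "\<dots> \<le> 2 * (norm_L2 \<Omega> \<phi> * (R * norm_a \<Omega> (\<lambda>x. mat 1) \<phi>))"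
  proof -
    have "norm_L2 \<Omega> (\<lambda>x. x $ i * ?D x $ i) \<le> norm_L2 \<Omega> (\<lambda>x. R * ?D x $ i)"
    proof (rule L2_abs_dominated(2)[OF _ _ _ s])
      show "(\<lambda>x. R * ?D x $ i) \<in> L2 \<Omega>"
        by (rule linear_subspace_scale[OF linear_subspace_L2 Di])
      show "(\<lambda>x. x $ i * ?D x $ i) \<in> borel_measurable (lebesgue_on \<Omega>)"
        using xD by (simp add: L2_def)
      show "\<bar>x $ i * ?D x $ i\<bar> \<le> \<bar>R * ?D x $ i\<bar>" if "x \<in> \<Omega>" for x
        using R(1)[OF that] R(2) component_le_norm_cart[of x i]
        by (auto simp: abs_mult intro!: mult_right_mono)
    qed
    also have "\<dots> = R * norm_L2 \<Omega> (\<lambda>x. ?D x $ i)"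
      using semi_inner_on_scale[OF semi_inner_on_L2 Di, of R] R(2) by (simp add: norm_L2_def)
    also have "norm_L2 \<Omega> (\<lambda>x. ?D x $ i) \<le> norm_a \<Omega> (\<lambda>x. mat 1) \<phi>"
    proof -
      have \<phi>1: "\<phi> \<in> H1 \<Omega>"
        using C1c_subset_H1[OF s] \<phi> by blast
      have "AE x in lebesgue_on \<Omega>. ?D x = grad \<Omega> \<phi> x"
        by (rule weak_gradient_unique_AE[OF \<Omega> is_weak_gradient_C1c[OF s \<phi>] is_weak_gradient_grad[OF \<phi>1]])
      then have "AE x in lebesgue_on \<Omega>. (?D x $ i)\<^sup>2 \<le> (norm (grad \<Omega> \<phi> x))\<^sup>2"
        by eventually_elim (simp add: abs_le_square_iff[symmetric] component_le_norm_cart)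
      then have "(LINT x | lebesgue_on \<Omega>. (?D x $ i)\<^sup>2) \<le> (LINT x | lebesgue_on \<Omega>. (norm (grad \<Omega> \<phi> x))\<^sup>2)"
        using Di is_weak_gradient_grad[OF \<phi>1]
        by (intro integral_mono_AE) (auto simp: L2_def is_weak_gradient_def)
      then show ?thesis
        by (simp add: norm_a_mat_1 norm_L2_def inner_L2_def power2_eq_square)
    qed
    finally have "norm_L2 \<Omega> (\<lambda>x. x $ i * ?D x $ i) \<le> R * norm_a \<Omega> (\<lambda>x. mat 1) \<phi>"
      using R(2) by (simp add: mult_left_mono)
    then show ?thesis
      using semi_inner_on_nonneg[OF semi_inner_on_L2 \<phi>L] by (simp add: norm_L2_def mult_left_mono)
  qed
  finally have "(norm_L2 \<Omega> \<phi>)\<^sup>2 \<le> norm_L2 \<Omega> \<phi> * (2 * R * norm_a \<Omega> (\<lambda>x. mat 1) \<phi>)"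
    using semi_inner_on_nonneg[OF semi_inner_on_L2 \<phi>L] by (simp add: norm_L2_def algebra_simps)
  moreover have "0 \<le> 2 * R * norm_a \<Omega> (\<lambda>x. mat 1) \<phi>"
    using R(2) semi_inner_on_nonneg[OF semi_inner_on_a_hat[OF spd_coefficient_mat_1 \<Omega>], of \<phi>]
      C1c_subset_H1[OF s] \<phi> by (auto simp: norm_a_def)
  ultimately show ?thesis
    by (cases "norm_L2 \<Omega> \<phi> > 0") (auto simp: power2_eq_square mult_le_cancel_left)
qed

text \<open>The inequality passes from test functions to their closure by continuity in the H^1
  norm, and from the Dirichlet form to the energy form by uniform ellipticity, which contributes the
  factor 1 / sqrt \<alpha>.\<close>

lemma Poincare:
  fixes \<Omega> :: "(real^'n) set"
  assumes A: "spd_coefficient \<Omega> \<A>" and \<Omega>: "open \<Omega>" "bounded \<Omega>"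
  obtains C where "C > 0" "\<And>v. v \<in> H10 \<Omega> \<Longrightarrow> norm_L2 \<Omega> v \<le> C * norm_a \<Omega> \<A> v"
proof -
  have lm: "\<Omega> \<in> lmeasurable"
    using \<Omega> by (simp add: bounded_set_imp_lmeasurable)
  then have s: "\<Omega> \<in> sets lebesgue"
    by (rule fmeasurableD)
  obtain R where R: "0 < R" "\<And>x. x \<in> \<Omega> \<Longrightarrow> norm x \<le> R"
    using \<Omega>(2) bounded_pos by blast
  let ?n1 = "norm_a \<Omega> (\<lambda>x. mat 1)"
  note B1 = semi_inner_on_a_hat[OF spd_coefficient_mat_1 \<Omega>(1) lm]
  have P1: "norm_L2 \<Omega> v \<le> 2 * R * ?n1 v" if v: "v \<in> H10 \<Omega>" for v
  proof -
    obtain \<phi> where \<phi>: "\<And>j. \<phi> j \<in> C1c \<Omega>" "(\<lambda>j. norm_H1 \<Omega> (\<lambda>x. v x - \<phi> j x)) \<longlonglongrightarrow> 0"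
      using v by (auto simp: H10_def)
    have v1: "v \<in> H1 \<Omega>" and \<phi>1: "\<phi> j \<in> H1 \<Omega>" for j
      using v \<phi>(1) H10_subset_H1 C1c_subset_H1[OF s] by auto
    have v2: "v \<in> L2 \<Omega>" and \<phi>2: "\<phi> j \<in> L2 \<Omega>" for j
      using v1 \<phi>1 H1_subset_L2 by auto
    \<comment> \<open>Replacing v by \<phi>_j costs once the L2 distance and 2 R times the gradient
      distance; both are below the H^1 distance, which tends to 0.\<close>
    have bound: "norm_L2 \<Omega> v - 2 * R * ?n1 v \<le> (1 + 2 * R) * norm_H1 \<Omega> (\<lambda>x. v x - \<phi> j x)" for j
    proof -
      have d: "(\<lambda>x. v x - \<phi> j x) \<in> H1 \<Omega>"
        by (rule linear_subspace_diff[OF linear_subspace_H1[OF s] v1 \<phi>1])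
      have "norm_L2 \<Omega> v \<le> norm_L2 \<Omega> (\<lambda>x. v x - \<phi> j x) + norm_L2 \<Omega> (\<phi> j)"
        using semi_inner_on_triangle[OF semi_inner_on_L2 linear_subspace_diff[OF linear_subspace_L2 v2 \<phi>2] \<phi>2, of j j]
        by (simp add: norm_L2_def)
      moreover have "norm_L2 \<Omega> (\<phi> j) \<le> 2 * R * ?n1 (\<phi> j)"
        using R by (intro Poincare_C1c \<Omega> lm \<phi>) auto
      moreover have "?n1 (\<phi> j) \<le> ?n1 (\<lambda>x. v x - \<phi> j x) + ?n1 v"
      proof -
        have "?n1 (\<phi> j) \<le> ?n1 (\<lambda>x. \<phi> j x - v x) + ?n1 v"
          using semi_inner_on_triangle[OF B1 linear_subspace_diff[OF linear_subspace_H1[OF s] \<phi>1 v1] v1, of j]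
          by (simp add: norm_a_def)
        then show ?thesis
          using semi_inner_on_minus_commute[OF B1 \<phi>1 v1, of j] by (simp add: norm_a_def)
      qed
      then have "2 * R * ?n1 (\<phi> j) \<le> 2 * R * (?n1 (\<lambda>x. v x - \<phi> j x) + ?n1 v)"
        using R(1) by (intro mult_left_mono) auto
      moreover have "norm_L2 \<Omega> (\<lambda>x. v x - \<phi> j x) \<le> norm_H1 \<Omega> (\<lambda>x. v x - \<phi> j x)"
        by (rule norm_le_norm_H1(1)[OF \<Omega>(1) lm d])
      moreover have "2 * R * ?n1 (\<lambda>x. v x - \<phi> j x) \<le> 2 * R * norm_H1 \<Omega> (\<lambda>x. v x - \<phi> j x)"
        using R(1) norm_le_norm_H1(2)[OF \<Omega>(1) lm d] by (intro mult_left_mono) auto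
      ultimately show ?thesis
        by (simp add: algebra_simps)
    qed
    have "norm_L2 \<Omega> v - 2 * R * ?n1 v \<le> 0"
    proof (rule tendsto_lowerbound)
      show "(\<lambda>j. (1 + 2 * R) * norm_H1 \<Omega> (\<lambda>x. v x - \<phi> j x)) \<longlonglongrightarrow> 0"
        using tendsto_mult_left[OF \<phi>(2), of "1 + 2 * R"] by simp
    qed (use bound in auto)
    then show ?thesis
      by simp
  qed
  obtain \<alpha> where \<alpha>: "\<alpha> > 0" "\<And>x \<xi>. x \<in> \<Omega> \<Longrightarrow> \<alpha> * (\<xi> \<bullet> \<xi>) \<le> (\<A> x *v \<xi>) \<bullet> \<xi>"
    using A unfolding spd_coefficient_def by blast
  have n1: "sqrt \<alpha> * ?n1 v \<le> norm_a \<Omega> \<A> v" if v: "v \<in> H1 \<Omega>" for v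
  proof -
    have "(LINT x | lebesgue_on \<Omega>. \<alpha> * ((mat 1 *v grad \<Omega> v x) \<bullet> grad \<Omega> v x)) \<le> a_hat \<Omega> \<A> v v"
      unfolding a_hat_def using \<alpha>(2) a_hat_integrable[OF spd_coefficient_mat_1 v v s]
      by (intro integral_mono a_hat_integrable[OF A v v s]) auto
    then have "sqrt (\<alpha> * a_hat \<Omega> (\<lambda>x. mat 1) v v) \<le> norm_a \<Omega> \<A> v"
      by (simp add: a_hat_def norm_a_def)
    then show ?thesis
      by (simp add: norm_a_def real_sqrt_mult)
  qed
  show ?thesis
  proof (rule that[of "2 * R / sqrt \<alpha>"])
    show "0 < 2 * R / sqrt \<alpha>"
      using R(1) \<alpha>(1) by simp
    fix v
    assume v: "v \<in> H10 \<Omega>"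
    then have "?n1 v \<le> norm_a \<Omega> \<A> v / sqrt \<alpha>"
      using n1[of v] H10_subset_H1 \<alpha>(1) by (auto simp: field_simps)
    then have "2 * R * ?n1 v \<le> 2 * R * (norm_a \<Omega> \<A> v / sqrt \<alpha>)"
      using R(1) by (intro mult_left_mono) auto
    then show "norm_L2 \<Omega> v \<le> 2 * R / sqrt \<alpha> * norm_a \<Omega> \<A> v"
      using P1[OF v] by simp
  qed
qed

section \<open>The correction step\<close>

lemma linear_subspace_fe_space:
  assumes \<Omega>: "open \<Omega>" "\<Omega> \<in> lmeasurable"
  shows "linear_subspace (fe_space \<Omega> \<T>)"
proof -
  note lin = linear_subspace_H10[OF \<Omega>]
  have "(\<lambda>x. 0) \<in> fe_space \<Omega> \<T>"
    using linear_subspace_zero[OF lin] by (auto simp: fe_space_def intro!: exI[of _ 0])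
  moreover have "(\<lambda>x. v x + w x) \<in> fe_space \<Omega> \<T>" if v: "v \<in> fe_space \<Omega> \<T>" and w: "w \<in> fe_space \<Omega> \<T>" for v w
  proof -
    have "\<exists>c g. \<forall>x\<in>T. v x + w x = c + g \<bullet> x" if T: "T \<in> \<T>" for T
    proof -
      obtain c g where "\<forall>x\<in>T. v x = c + g \<bullet> x"
        using v T unfolding fe_space_def by blast
      moreover obtain c' g' where "\<forall>x\<in>T. w x = c' + g' \<bullet> x"
        using w T unfolding fe_space_def by blast
      ultimately have "\<forall>x\<in>T. v x + w x = (c + c') + (g + g') \<bullet> x"
        by (simp add: inner_add_left)
      then show ?thesis
        by blast
    qed
    then show ?thesis
      using v w linear_subspace_add[OF lin, of v w] by (auto simp: fe_space_def intro: continuous_on_add)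
  qed
  moreover have "(\<lambda>x. a * v x) \<in> fe_space \<Omega> \<T>" if v: "v \<in> fe_space \<Omega> \<T>" for a v
  proof -
    have "\<exists>c g. \<forall>x\<in>T. a * v x = c + g \<bullet> x" if T: "T \<in> \<T>" for T
    proof -
      obtain c g where "\<forall>x\<in>T. v x = c + g \<bullet> x"
        using v T unfolding fe_space_def by blast
      then have "\<forall>x\<in>T. a * v x = a * c + (a *\<^sub>R g) \<bullet> x"
        by (simp add: distrib_left)
      then show ?thesis
        by blast
    qed
    then show ?thesis
      using v linear_subspace_scale[OF lin, of v a] by (auto simp: fe_space_def intro: continuous_on_mult_left)
  qed
  ultimately show ?thesis
    by (simp add: linear_subspace_def)
qed

lemma fe_space_subset_H10: "fe_space \<Omega> \<T> \<subseteq> H10 \<Omega>"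
  by (auto simp: fe_space_def)

lemma linear_subspace_add_span:
  assumes "linear_subspace W"
  shows "linear_subspace (add_span W w)"
proof -
  have "(\<lambda>x. 0) \<in> add_span W w"
    using linear_subspace_zero[OF assms] by (auto simp: add_span_def intro!: exI[of _ "\<lambda>x. 0"] exI[of _ 0])
  moreover have "(\<lambda>x. a x + b x) \<in> add_span W w" if ab: "a \<in> add_span W w" "b \<in> add_span W w" for a b
  proof -
    obtain v c v' c' where "a = (\<lambda>x. v x + c * w x)" "b = (\<lambda>x. v' x + c' * w x)" "v \<in> W" "v' \<in> W"
      using ab unfolding add_span_def by blast
    then show ?thesis
      using linear_subspace_add[OF assms, of v v']
      by (auto simp: add_span_def algebra_simps intro!: exI[of _ "\<lambda>x. v x + v' x"] exI[of _ "c + c'"])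
  qed
  moreover have "(\<lambda>x. d * a x) \<in> add_span W w" if a: "a \<in> add_span W w" for a d
  proof -
    obtain v c where "a = (\<lambda>x. v x + c * w x)" "v \<in> W"
      using a unfolding add_span_def by blast
    then show ?thesis
      using linear_subspace_scale[OF assms, of v d]
      by (auto simp: add_span_def algebra_simps intro!: exI[of _ "\<lambda>x. d * v x"] exI[of _ "d * c"])
  qed
  ultimately show ?thesis
    by (simp add: linear_subspace_def)
qed

lemma subset_add_span: "W \<subseteq> add_span W w"
  by (auto simp: add_span_def intro!: exI[of _ 0])

lemma mem_add_span: "linear_subspace W \<Longrightarrow> w \<in> add_span W w"
  using linear_subspace_zero[of W] by (auto simp: add_span_def intro!: exI[of _ "\<lambda>x. 0"] exI[of _ 1])

lemma add_span_subset:
  assumes "linear_subspace V" "W \<subseteq> V" "w \<in> V"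
  shows "add_span W w \<subseteq> V"
  using assms by (auto simp: add_span_def intro!: linear_subspace_add[OF assms(1)] linear_subspace_scale[OF assms(1)])

lemma norm_a_nonneg:
  assumes "semi_inner_on W (a_hat \<Omega> \<A>)" "v \<in> W"
  shows "0 \<le> norm_a \<Omega> \<A> v"
  using semi_inner_on_nonneg[OF assms] by (simp add: norm_a_def)

lemma best_approx_le:
  assumes B: "semi_inner_on W (a_hat \<Omega> \<A>)" and "u \<in> W" "V \<subseteq> W" "v \<in> V"
  shows "best_approx \<Omega> \<A> V u \<le> norm_a \<Omega> \<A> (\<lambda>x. u x - v x)"
  unfolding best_approx_def
proof (rule cINF_lower[OF bdd_belowI2 assms(4)])
  have lin: "linear_subspace W"
    using B by (simp add: semi_inner_on_def)
  show "0 \<le> norm_a \<Omega> \<A> (\<lambda>x. u x - w x)" if "w \<in> V" for w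
    using that assms(3) by (intro norm_a_nonneg[OF B] linear_subspace_diff[OF lin assms(2)]) auto
qed

lemma best_approx_nonneg:
  assumes B: "semi_inner_on W (a_hat \<Omega> \<A>)" and "u \<in> W" "V \<subseteq> W" "V \<noteq> {}"
  shows "0 \<le> best_approx \<Omega> \<A> V u"
  unfolding best_approx_def
proof (rule cINF_greatest[OF assms(4)])
  have lin: "linear_subspace W"
    using B by (simp add: semi_inner_on_def)
  show "0 \<le> norm_a \<Omega> \<A> (\<lambda>x. u x - w x)" if "w \<in> V" for w
    using that assms(3) by (intro norm_a_nonneg[OF B] linear_subspace_diff[OF lin assms(2)]) auto
qed

section \<open>Error of one correction step\<close>

text \<open>\<open>a_form\<close> is a single integral; admissibility of f is what permits splitting
  off the nonlinear term, so that the eigenvalue equation can be compared with the linear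
  problem.\<close>

lemma a_hat_eq_of_eigenpair:
  assumes A: "spd_coefficient \<Omega> \<A>" and f: "admissible_nonlinearity \<Omega> f" and s: "\<Omega> \<in> sets lebesgue"
    and V: "V \<subseteq> H10 \<Omega>" and eig: "is_eigenpair \<Omega> \<A> f V (\<mu>, w)" and v: "v \<in> V"
  shows "a_hat \<Omega> \<A> w v = \<mu> * inner_L2 \<Omega> w v - (LINT x | lebesgue_on \<Omega>. f x (w x) * v x)"
proof -
  have w: "w \<in> V" and eq: "a_form \<Omega> \<A> f w v = \<mu> * inner_L2 \<Omega> w v"
    using eig v by (auto simp: is_eigenpair_def)
  have "integrable (lebesgue_on \<Omega>) (\<lambda>x. f x (w x) * v x)"
    using f w v V by (auto simp: admissible_nonlinearity_def)
  moreover have "integrable (lebesgue_on \<Omega>) (\<lambda>x. (\<A> x *v grad \<Omega> w x) \<bullet> grad \<Omega> v x)"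
    using w v V H10_subset_H1 by (intro a_hat_integrable[OF A _ _ s]) blast+
  ultimately show ?thesis
    using eq by (simp add: a_form_def a_hat_def)
qed

text \<open>The energy of the difference z equals a residual that is linear in z, so one factor
  \<parallel>z\<parallel> cancels. The sum on the right has the form of the left side of the
  estimate assumed for the iterates; substituting that estimate later produces the factor
  \<eta>_a(V_H).\<close>

lemma linear_problem_error:
  assumes A: "spd_coefficient \<Omega> \<A>" and f: "admissible_nonlinearity \<Omega> f" and \<Omega>: "open \<Omega>" "\<Omega> \<in> lmeasurable"
    and asA: "assumption_A \<Omega> \<A> f C\<^sub>f" and "0 \<le> C\<^sub>f"
    and Poi: "\<And>v. v \<in> H10 \<Omega> \<Longrightarrow> norm_L2 \<Omega> v \<le> C\<^sub>P * norm_a \<Omega> \<A> v" and "0 \<le> C\<^sub>P"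
    and V: "linear_subspace V" "V \<subseteq> H10 \<Omega>" and eig: "is_eigenpair \<Omega> \<A> f V (\<mu>h, uh)"
    and w: "w \<in> V" "inner_L2 \<Omega> w w = 1"
    and wh: "wh \<in> V" "\<And>v. v \<in> V \<Longrightarrow> a_hat \<Omega> \<A> wh v = inner_L2 \<Omega> (\<lambda>x. \<mu> * w x - f x (w x)) v"
    and M: "\<bar>\<mu>h\<bar> \<le> M" "1 \<le> M"
  shows "norm_a \<Omega> \<A> (\<lambda>x. uh x - wh x)
    \<le> (M * C\<^sub>P + C\<^sub>f) * (\<bar>\<mu>h - \<mu>\<bar> + norm_L2 \<Omega> (\<lambda>x. uh x - w x))"
proof -
  have s: "\<Omega> \<in> sets lebesgue"
    using \<Omega>(2) by (rule fmeasurableD)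
  note B = semi_inner_on_a_hat[OF A \<Omega>]
  have sub1: "V \<subseteq> H1 \<Omega>" and sub2: "V \<subseteq> L2 \<Omega>"
    using V(2) H10_subset_H1 H1_subset_L2 by blast+
  have uh: "uh \<in> V"
    using eig by (simp add: is_eigenpair_def)
  define z where "z = (\<lambda>x. uh x - wh x)"
  define e where "e = (\<lambda>x. uh x - w x)"
  define d where "d = \<bar>\<mu>h - \<mu>\<bar> + norm_L2 \<Omega> e"
  have z: "z \<in> V" and e: "e \<in> V"
    unfolding z_def e_def by (intro linear_subspace_diff[OF V(1)] uh wh w)+
  have L2: "uh \<in> L2 \<Omega>" "w \<in> L2 \<Omega>" "z \<in> L2 \<Omega>" "e \<in> L2 \<Omega>"
    using uh w z e sub2 by auto
  have fuz: "integrable (lebesgue_on \<Omega>) (\<lambda>x. f x (uh x) * z x)"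
    and fwz: "integrable (lebesgue_on \<Omega>) (\<lambda>x. f x (w x) * z x)"
    using f uh w z V(2) by (auto simp: admissible_nonlinearity_def)
  have "a_hat \<Omega> \<A> z z = a_hat \<Omega> \<A> uh z - a_hat \<Omega> \<A> wh z"
    using semi_inner_on_diff[OF B, of uh wh z, folded z_def] uh wh(1) z sub1 by blast
  also have "a_hat \<Omega> \<A> uh z = \<mu>h * inner_L2 \<Omega> uh z - (LINT x | lebesgue_on \<Omega>. f x (uh x) * z x)"
    by (rule a_hat_eq_of_eigenpair[OF A f s V(2) eig z])
  also have "a_hat \<Omega> \<A> wh z = \<mu> * inner_L2 \<Omega> w z - (LINT x | lebesgue_on \<Omega>. f x (w x) * z x)"
    using wh(2)[OF z] fwz L2_mult_integrable[OF L2(2,3)]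
    by (simp add: inner_L2_def left_diff_distrib mult.assoc)
  \<comment> \<open>The splitting \<mu>h uh - \<mu> w = \<mu>h (uh - w) + (\<mu>h - \<mu>) w: the
    eigenvalue error then multiplies w, whose L2 norm is 1, and only \<mu>h needs an a priori
    bound.\<close>
  also have "(\<mu>h * inner_L2 \<Omega> uh z - (LINT x | lebesgue_on \<Omega>. f x (uh x) * z x))
      - (\<mu> * inner_L2 \<Omega> w z - (LINT x | lebesgue_on \<Omega>. f x (w x) * z x))
    = \<mu>h * inner_L2 \<Omega> e z + (\<mu>h - \<mu>) * inner_L2 \<Omega> w z - inner_L2 \<Omega> (\<lambda>x. f x (uh x) - f x (w x)) z"
  proof -
    have "inner_L2 \<Omega> (\<lambda>x. f x (uh x) - f x (w x)) z
        = (LINT x | lebesgue_on \<Omega>. f x (uh x) * z x) - (LINT x | lebesgue_on \<Omega>. f x (w x) * z x)"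
      using fuz fwz by (simp add: inner_L2_def left_diff_distrib)
    moreover have "inner_L2 \<Omega> uh z = inner_L2 \<Omega> e z + inner_L2 \<Omega> w z"
      unfolding e_def using semi_inner_on_diff[OF semi_inner_on_L2 L2(1-3)] by simp
    ultimately show ?thesis
      by (simp add: algebra_simps)
  qed
  also have "\<dots> \<le> \<bar>\<mu>h\<bar> * \<bar>inner_L2 \<Omega> e z\<bar> + \<bar>\<mu>h - \<mu>\<bar> * \<bar>inner_L2 \<Omega> w z\<bar>
      + \<bar>inner_L2 \<Omega> (\<lambda>x. f x (uh x) - f x (w x)) z\<bar>"
    by (simp flip: abs_mult)
  also have "\<dots> \<le> M * (norm_L2 \<Omega> e * norm_L2 \<Omega> z) + \<bar>\<mu>h - \<mu>\<bar> * (1 * norm_L2 \<Omega> z)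
      + C\<^sub>f * norm_L2 \<Omega> e * norm_a \<Omega> \<A> z"
  proof (intro add_mono mult_mono[OF M(1)] mult_left_mono)
    show "\<bar>inner_L2 \<Omega> e z\<bar> \<le> norm_L2 \<Omega> e * norm_L2 \<Omega> z"
      using semi_inner_on_Cauchy_Schwarz[OF semi_inner_on_L2 L2(4,3)] by (simp add: norm_L2_def)
    show "\<bar>inner_L2 \<Omega> w z\<bar> \<le> 1 * norm_L2 \<Omega> z"
      using semi_inner_on_Cauchy_Schwarz[OF semi_inner_on_L2 L2(2,3)] w(2) by (simp add: norm_L2_def)
    show "\<bar>inner_L2 \<Omega> (\<lambda>x. f x (uh x) - f x (w x)) z\<bar> \<le> C\<^sub>f * norm_L2 \<Omega> e * norm_a \<Omega> \<A> z"
      using asA uh w(1) z V(2) unfolding assumption_A_def e_def by blast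
  qed (use M(2) in auto)
  \<comment> \<open>Because M is at least 1, it can also be put in front of the eigenvalue error,
    which merges the first two terms into \<open>M * d\<close>.\<close>
  also have "\<dots> \<le> M * d * norm_L2 \<Omega> z + C\<^sub>f * d * norm_a \<Omega> \<A> z"
  proof -
    have nz: "0 \<le> norm_L2 \<Omega> z" and ne: "0 \<le> norm_L2 \<Omega> e" and na: "0 \<le> norm_a \<Omega> \<A> z"
      using semi_inner_on_nonneg[OF semi_inner_on_L2 L2(3)] semi_inner_on_nonneg[OF semi_inner_on_L2 L2(4)]
        norm_a_nonneg[OF B] z sub1 by (auto simp: norm_L2_def)
    have "1 * (\<bar>\<mu>h - \<mu>\<bar> * norm_L2 \<Omega> z) \<le> M * (\<bar>\<mu>h - \<mu>\<bar> * norm_L2 \<Omega> z)"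
      using M(2) nz by (intro mult_right_mono) auto
    moreover have "C\<^sub>f * norm_L2 \<Omega> e * norm_a \<Omega> \<A> z \<le> C\<^sub>f * d * norm_a \<Omega> \<A> z"
      using assms(6) na by (intro mult_right_mono mult_left_mono) (auto simp: d_def)
    ultimately show ?thesis
      by (simp add: d_def algebra_simps)
  qed
  also have "\<dots> \<le> M * d * (C\<^sub>P * norm_a \<Omega> \<A> z) + C\<^sub>f * d * norm_a \<Omega> \<A> z"
  proof -
    have "0 \<le> M * d"
      using M(2) semi_inner_on_nonneg[OF semi_inner_on_L2 L2(4)] by (simp add: d_def norm_L2_def)
    then show ?thesis
      using Poi z V(2) by (intro add_right_mono mult_left_mono) auto
  qed
  also have "\<dots> = ((M * C\<^sub>P + C\<^sub>f) * d) * norm_a \<Omega> \<A> z"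
    by (simp add: algebra_simps)
  finally have "norm_a \<Omega> \<A> z * norm_a \<Omega> \<A> z \<le> ((M * C\<^sub>P + C\<^sub>f) * d) * norm_a \<Omega> \<A> z"
    using semi_inner_on_nonneg[OF B, of z] z sub1 by (auto simp: norm_a_def)
  moreover have "0 \<le> (M * C\<^sub>P + C\<^sub>f) * d"
    using M(2) assms(6,8) semi_inner_on_nonneg[OF semi_inner_on_L2 L2(4)] by (simp add: d_def norm_L2_def)
  \<comment> \<open>If the norm of z is 0 it cannot be cancelled, but then the nonnegativity of the
    right side suffices.\<close>
  ultimately have "norm_a \<Omega> \<A> z \<le> (M * C\<^sub>P + C\<^sub>f) * d"
    by (cases "norm_a \<Omega> \<A> z > 0") (auto simp: mult_le_cancel_right)
  then show ?thesis
    by (simp add: z_def d_def e_def)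
qed

text \<open>This is the origin of \<gamma>. Since \<open>wt\<close> lies in the enriched space, the
  best approximation error is at most (\<theta> + (1 + \<theta>) K \<eta>) times the old error; the
  quasi-optimality factor \<open>1 + C\<^sub>u * \<eta>\<close> then multiplies it.\<close>

lemma correction_step_contraction:
  assumes B: "semi_inner_on X (a_hat \<Omega> \<A>)" and X: "uh \<in> X" "w \<in> X" "wh \<in> X" "wt \<in> X" "W \<subseteq> X" and wtW: "wt \<in> W"
    and lin: "norm_a \<Omega> \<A> (\<lambda>x. uh x - wh x) \<le> K * \<eta> * norm_a \<Omega> \<A> (\<lambda>x. uh x - w x)"
    and mg: "norm_a \<Omega> \<A> (\<lambda>x. wh x - wt x) \<le> \<theta> * norm_a \<Omega> \<A> (\<lambda>x. wh x - w x)"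
    and B2: "norm_a \<Omega> \<A> (\<lambda>x. uh x - w' x) \<le> (1 + C\<^sub>u * \<eta>W) * best_approx \<Omega> \<A> W uh"
    and "\<eta>W \<le> \<eta>" "0 \<le> \<eta>" "0 \<le> C\<^sub>u" "0 \<le> \<theta>"
  shows "norm_a \<Omega> \<A> (\<lambda>x. uh x - w' x)
    \<le> (\<theta> + (C\<^sub>u * \<theta> + (1 + \<theta>) * K * (1 + C\<^sub>u * \<eta>)) * \<eta>) * norm_a \<Omega> \<A> (\<lambda>x. uh x - w x)"
proof -
  let ?N = "norm_a \<Omega> \<A>"
  define e where "e = ?N (\<lambda>x. uh x - w x)"
  \<comment> \<open>The multigrid rate refers to the distance of the initial guess from the solution
    of the linear problem, not from the discrete eigenfunction; the triangle inequality
    translates.\<close>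
  have "?N (\<lambda>x. wh x - w x) \<le> ?N (\<lambda>x. wh x - uh x) + e"
    using semi_inner_on_triangle_diff[OF B X(3,1,2)] by (simp add: norm_a_def e_def)
  also have "?N (\<lambda>x. wh x - uh x) = ?N (\<lambda>x. uh x - wh x)"
    using semi_inner_on_minus_commute[OF B X(3,1)] by (simp add: norm_a_def)
  also have "\<dots> \<le> K * \<eta> * e"
    using lin by (simp add: e_def)
  finally have "\<theta> * ?N (\<lambda>x. wh x - w x) \<le> \<theta> * (K * \<eta> * e + e)"
    using \<open>0 \<le> \<theta>\<close> by (intro mult_left_mono) auto
  then have "?N (\<lambda>x. wh x - wt x) \<le> \<theta> * (K * \<eta> * e + e)"
    using mg by linarith
  moreover have "?N (\<lambda>x. uh x - wt x) \<le> ?N (\<lambda>x. uh x - wh x) + ?N (\<lambda>x. wh x - wt x)"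
    using semi_inner_on_triangle_diff[OF B X(1,3,4)] by (simp add: norm_a_def)
  moreover have "best_approx \<Omega> \<A> W uh \<le> ?N (\<lambda>x. uh x - wt x)"
    by (rule best_approx_le[OF B X(1,5) wtW])
  ultimately have ba: "best_approx \<Omega> \<A> W uh \<le> K * \<eta> * e + \<theta> * (K * \<eta> * e + e)"
    using lin by (simp add: e_def)
  have ba0: "0 \<le> best_approx \<Omega> \<A> W uh"
    using wtW by (intro best_approx_nonneg[OF B X(1,5)]) auto
  have "?N (\<lambda>x. uh x - w' x) \<le> (1 + C\<^sub>u * \<eta>W) * best_approx \<Omega> \<A> W uh"
    by (rule B2)
  also have "\<dots> \<le> (1 + C\<^sub>u * \<eta>) * best_approx \<Omega> \<A> W uh"
    using ba0 assms by (intro mult_right_mono add_left_mono mult_left_mono) auto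
  also have "\<dots> \<le> (1 + C\<^sub>u * \<eta>) * (K * \<eta> * e + \<theta> * (K * \<eta> * e + e))"
    using ba assms by (intro mult_left_mono) auto
  also have "\<dots> = (\<theta> + (C\<^sub>u * \<theta> + (1 + \<theta>) * K * (1 + C\<^sub>u * \<eta>)) * \<eta>) * e"
    by (simp add: algebra_simps)
  finally show ?thesis
    by (simp add: e_def)
qed

text \<open>The fixed point of \<open>\<epsilon> \<mapsto> r (\<beta> \<epsilon> + D)\<close> bounds the errors relative to \<open>\<delta>\<close>.\<close>

lemma geometric_error_recursion:
  fixes \<epsilon> \<delta> :: "nat \<Rightarrow> real"
  assumes "0 \<le> r" "\<beta> * r < 1" "0 \<le> D" "\<And>k. k \<in> {1..n} \<Longrightarrow> 0 \<le> \<delta> k" "\<epsilon> 1 = 0"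
    and step: "\<And>k. k \<in> {2..n} \<Longrightarrow> \<epsilon> k \<le> r * (D * \<delta> k + \<epsilon> (k - 1))"
    and \<delta>: "\<And>k. k \<in> {2..n} \<Longrightarrow> \<delta> (k - 1) = \<beta> * \<delta> k"
    and "k \<in> {1..n}"
  shows "\<epsilon> k \<le> D * (r / (1 - \<beta> * r)) * \<delta> k"
  using \<open>k \<in> {1..n}\<close>
proof (induction k)
  case (Suc k)
  show ?case
  proof (cases "k = 0")
    case True
    then show ?thesis
      using assms(1-5) Suc.prems by simp
  next
    case False
    then have k: "k \<in> {1..n}" "Suc k \<in> {2..n}"
      using Suc.prems by auto
    have "\<epsilon> (Suc k) \<le> r * (D * \<delta> (Suc k) + \<epsilon> k)"
      using step[OF k(2)] by simp
    also have "\<dots> \<le> r * (D * \<delta> (Suc k) + D * (r / (1 - \<beta> * r)) * (\<beta> * \<delta> (Suc k)))"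
      using Suc.IH[OF k(1)] \<delta>[OF k(2)] assms(1) by (intro mult_left_mono add_left_mono) auto
    \<comment> \<open>The fixed point property in the form 1 + \<beta> r / (1 - \<beta> r) = 1 / (1
      - \<beta> r).\<close>
    also have "\<dots> = D * (r / (1 - \<beta> * r)) * \<delta> (Suc k)"
      using assms(2) by (simp add: field_simps)
    finally show ?thesis .
  qed
qed simp

section \<open>Error of the full multigrid scheme\<close>

theorem theorem3p2:
  fixes \<Omega> :: "(real^'n) set"
    and \<A> :: "real^'n \<Rightarrow> real^'n^'n"
    and f :: "real^'n \<Rightarrow> real \<Rightarrow> real"
    and \<mu> :: real and u :: "real^'n \<Rightarrow> real"
    and \<sigma> \<beta> C\<^sub>u C\<^sub>f C\<^sub>0 :: real
  assumes "CARD('n) = 2 \<or> CARD('n) = 3"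
    and "bounded_lipschitz_domain \<Omega>"
    and "spd_coefficient \<Omega> \<A>"
    and "admissible_nonlinearity \<Omega> f"
    and "is_eigenpair \<Omega> \<A> f (H10 \<Omega>) (\<mu>, u)"
    and "simple_eigenvalue \<Omega> \<A> f (\<mu>, u)"
    and "\<beta> > 1" and "C\<^sub>u > 0" and "C\<^sub>f > 0" and "C\<^sub>0 > 0"
    and "assumption_A \<Omega> \<A> f C\<^sub>f"
  shows "\<exists>Ct\<^sub>u>0. \<exists>C>0.
    \<forall>(\<M> :: (real^'n) set set set) (ep :: 'n approx) (\<eta> :: 'n fn set \<Rightarrow> real)
      (\<T>H :: (real^'n) set set) (\<T> :: nat \<Rightarrow> (real^'n) set set) (MG :: 'n solver)
      (n :: nat) (p :: nat) (m :: nat) (\<theta> :: real) lam w wh wt Lam U.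
      mesh_family \<Omega> \<A> f \<sigma> \<M> ep \<and>
      assumption_B1 \<Omega> \<A> (\<mu>, u) \<M> ep \<eta> C\<^sub>u \<and>
      assumption_B2 \<Omega> \<A> f \<M> ep \<eta> C\<^sub>u \<and>
      mesh_hierarchy \<Omega> \<A> u \<M> \<eta> \<beta> C\<^sub>0 \<T>H \<T> n \<and>
      full_multigrid \<Omega> \<A> f ep MG \<T>H \<T> n p m lam w wh wt Lam U \<and>
      0 \<le> \<theta> \<and> mg_error_reduction \<Omega> \<A> \<theta> n p w wh wt \<and>
      iterates_estimate \<Omega> \<A> ep C\<^sub>u (\<eta> (fe_space \<Omega> \<T>H)) \<T> n p lam w \<longrightarrow>
      (let \<eta>H = \<eta> (fe_space \<Omega> \<T>H);
           \<gamma> = \<theta> + (C\<^sub>u * \<theta> + (1 + \<theta>) * (Ct\<^sub>u + C\<^sub>f) * (1 + C\<^sub>u * \<eta>H)) * \<eta>H;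
           \<delta> = best_approx \<Omega> \<A> (fe_space \<Omega> (\<T> n)) u;
           (\<mu>h, uh) = ep (fe_space \<Omega> (\<T> n))
       in \<beta> * \<gamma> ^ p < 1 \<longrightarrow>
          norm_a \<Omega> \<A> (\<lambda>x. uh x - U n x) \<le> C * (\<gamma> ^ p / (1 - \<beta> * \<gamma> ^ p)) * \<delta> \<and>
          \<bar>\<mu>h - Lam n\<bar> + norm_L2 \<Omega> (\<lambda>x. uh x - U n x)
            \<le> C * (\<gamma> ^ p / (1 - \<beta> * \<gamma> ^ p)) * \<eta>H * \<delta>)"
proof -

  \<comment> \<open>Norm rules and constants chosen before the meshes\<close>
  have \<Omega>: "open \<Omega>" "\<Omega> \<in> lmeasurable"
    using assms(2) by (auto simp: bounded_lipschitz_domain_def intro: bounded_set_imp_lmeasurable)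
  then have s: "\<Omega> \<in> sets lebesgue"
    by (blast intro: fmeasurableD)
  let ?N = "norm_a \<Omega> \<A>"
  note A = assms(3)
  note B = semi_inner_on_subset[OF semi_inner_on_a_hat[OF A \<Omega>] linear_subspace_H10[OF \<Omega>] H10_subset_H1]
  note linH = linear_subspace_H10[OF \<Omega>]
  obtain C\<^sub>P where C\<^sub>P: "C\<^sub>P > 0" "\<And>v. v \<in> H10 \<Omega> \<Longrightarrow> norm_L2 \<Omega> v \<le> C\<^sub>P * ?N v"
    using Poincare[OF A \<Omega>(1)] assms(2) by (auto simp: bounded_lipschitz_domain_def)
  have u: "u \<in> H10 \<Omega>"
    using assms(5) by (simp add: is_eigenpair_def)
  have N0: "0 \<le> ?N v" if "v \<in> H10 \<Omega>" for v
    by (rule norm_a_nonneg[OF B that])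
  have Ndiff: "0 \<le> ?N (\<lambda>x. v x - w x)" if "v \<in> H10 \<Omega>" "w \<in> H10 \<Omega>" for v w
    by (intro N0 linear_subspace_diff[OF linH] that)
  have Ntri: "?N (\<lambda>x. v x - w x) \<le> ?N (\<lambda>x. v x - z x) + ?N (\<lambda>x. z x - w x)"
    if "v \<in> H10 \<Omega>" "z \<in> H10 \<Omega>" "w \<in> H10 \<Omega>" for v z w
    using semi_inner_on_triangle_diff[OF B that] by (simp add: norm_a_def)
  have Ncomm: "?N (\<lambda>x. v x - w x) = ?N (\<lambda>x. w x - v x)" if "v \<in> H10 \<Omega>" "w \<in> H10 \<Omega>" for v w
    using semi_inner_on_minus_commute[OF B that] by (simp add: norm_a_def)
  \<comment> \<open>\<open>E\<close> dominates the quasi-optimality factor of B1 on every level once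
    \<open>\<eta>H \<le> 1 / C\<^sub>f\<close> is known.\<close>
  define E where "E = 1 + C\<^sub>u / C\<^sub>f"
  \<comment> \<open>By B1 a discrete eigenvalue differs from \<mu> by at most
    \<open>C\<^sub>u / C\<^sub>f\<close> times the energy error of the discrete eigenfunction,
    itself at most \<open>E\<close> times the norm of u. The summand 1 secures the
    \<open>1 \<le> M\<close> that \<open>linear_problem_error\<close> asks for.\<close>
  define M where "M = 1 + \<bar>\<mu>\<bar> + C\<^sub>u / C\<^sub>f * (E * ?N u)"
  \<comment> \<open>The constant of \<open>linear_problem_error\<close> times the
    \<open>C\<^sub>u\<close> of the estimate for the iterates.\<close>
  define Ct\<^sub>u where "Ct\<^sub>u = C\<^sub>u * (M * C\<^sub>P + C\<^sub>f)"
  \<comment> \<open>Two neighbouring levels contribute E \<delta>_k + E \<delta>_(k-1) = E (1 +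
    \<beta>) \<delta>_k. The factor \<open>1 + C\<^sub>u\<close> in \<open>C\<close> makes it exceed
    both \<open>D\<close> and \<open>C\<^sub>u * D\<close>, the constants of the two claims.\<close>
  define D where "D = E * (1 + \<beta>)"
  define C where "C = D * (1 + C\<^sub>u)"
  have E1: "1 \<le> E"
    using \<open>C\<^sub>u > 0\<close> \<open>C\<^sub>f > 0\<close> by (simp add: E_def)
  have M1: "1 \<le> M"
    using \<open>C\<^sub>u > 0\<close> \<open>C\<^sub>f > 0\<close> E1 N0[OF u] by (simp add: M_def)
  have Ctu: "Ct\<^sub>u > 0"
    using M1 C\<^sub>P(1) \<open>C\<^sub>u > 0\<close> \<open>C\<^sub>f > 0\<close> by (simp add: Ct\<^sub>u_def add_pos_pos)
  have D0: "0 < D"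
    using E1 \<open>\<beta> > 1\<close> by (simp add: D_def)
  have C0: "0 < C"
    using D0 \<open>C\<^sub>u > 0\<close> by (simp add: C_def)
  show ?thesis
  proof (rule exI[of _ Ct\<^sub>u], rule conjI[OF Ctu], rule exI[of _ C], rule conjI[OF C0], intro allI impI, elim conjE)
    fix \<M> :: "(real^'n) set set set" and ep :: "'n approx" and \<eta> :: "'n fn set \<Rightarrow> real"
      and \<T>H :: "(real^'n) set set" and \<T> :: "nat \<Rightarrow> (real^'n) set set" and MG :: "'n solver"
      and n p m :: nat and \<theta> :: real and lam w wh wt Lam U
    assume fam: "mesh_family \<Omega> \<A> f \<sigma> \<M> ep" and B1: "assumption_B1 \<Omega> \<A> (\<mu>, u) \<M> ep \<eta> C\<^sub>u"
      and B2: "assumption_B2 \<Omega> \<A> f \<M> ep \<eta> C\<^sub>u" and hier: "mesh_hierarchy \<Omega> \<A> u \<M> \<eta> \<beta> C\<^sub>0 \<T>H \<T> n"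
      and fmg: "full_multigrid \<Omega> \<A> f ep MG \<T>H \<T> n p m lam w wh wt Lam U"
      and \<theta>: "0 \<le> \<theta>" and red: "mg_error_reduction \<Omega> \<A> \<theta> n p w wh wt"
      and est: "iterates_estimate \<Omega> \<A> ep C\<^sub>u (\<eta> (fe_space \<Omega> \<T>H)) \<T> n p lam w"

    \<comment> \<open>The mesh hierarchy\<close>
    define VH where "VH = fe_space \<Omega> \<T>H"
    define V where "V k = fe_space \<Omega> (\<T> k)" for k
    define \<eta>H where "\<eta>H = \<eta> VH"
    define \<gamma> where "\<gamma> = \<theta> + (C\<^sub>u * \<theta> + (1 + \<theta>) * (Ct\<^sub>u + C\<^sub>f) * (1 + C\<^sub>u * \<eta>H)) * \<eta>H"
    define \<delta> where "\<delta> k = best_approx \<Omega> \<A> (V k) u" for k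
    define lb where "lb k = fst (ep (V k))" for k
    define ub where "ub k = snd (ep (V k))" for k
    have ep: "ep (V k) = (lb k, ub k)" for k
      by (simp add: lb_def ub_def)
    have n1: "1 \<le> n" and mem: "k \<in> {1..n} \<Longrightarrow> \<T> k \<in> \<M>" for k
      using hier by (auto simp: mesh_hierarchy_def)
    have linV: "linear_subspace (V k)" and V10: "V k \<subseteq> H10 \<Omega>" for k
      unfolding V_def by (rule linear_subspace_fe_space[OF \<Omega>], rule fe_space_subset_H10)
    have linVH: "linear_subspace VH"
      unfolding VH_def by (rule linear_subspace_fe_space[OF \<Omega>])
    have Vne: "V k \<noteq> {}" for k
      using linear_subspace_zero[OF linV] by blast
    have \<delta>0: "0 \<le> \<delta> k" for k
      unfolding \<delta>_def by (rule best_approx_nonneg[OF B u V10 Vne])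
    \<comment> \<open>Zero is a competitor in the infimum; this bound is free of the mesh, as
      \<open>M\<close> must be.\<close>
    have \<delta>u: "\<delta> k \<le> ?N u" for k
      using best_approx_le[OF B u V10 linear_subspace_zero[OF linV]] by (simp add: \<delta>_def)
    have \<delta>\<beta>: "\<delta> (k - 1) = \<beta> * \<delta> k" if "k \<in> {2..n}" for k
      using hier that \<open>\<beta> > 1\<close> unfolding mesh_hierarchy_def \<delta>_def V_def by (simp add: field_simps)
    \<comment> \<open>A priori \<eta> may have any sign; nonnegativity on the coarse space is read
      off the approximation relation.\<close>
    have "C\<^sub>0 * \<delta> 1 \<le> \<eta>H"
      using hier by (simp add: mesh_hierarchy_def \<delta>_def V_def \<eta>H_def VH_def)
    then have \<eta>H0: "0 \<le> \<eta>H"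
      using mult_nonneg_nonneg[of C\<^sub>0 "\<delta> 1"] \<delta>0[of 1] \<open>C\<^sub>0 > 0\<close> by linarith
    have step_sub: "V (k - 1) \<subseteq> V k" if "k \<in> {2..n}" for k
      using hier that by (auto simp: mesh_hierarchy_def V_def)
    have VHV: "VH \<subseteq> V k" if "k \<in> {1..n}" for k
      using that
    proof (induction k)
      case (Suc k)
      show ?case
      proof (cases "k = 0")
        case True
        then show ?thesis
          using hier by (simp add: mesh_hierarchy_def V_def VH_def)
      next
        case False
        then show ?thesis
          using Suc step_sub[of "Suc k"] by auto
      qed
    qed simp
    \<comment> \<open>The coarse value thus serves for all level spaces and for all enriched spaces
      at once.\<close>
    have \<eta>_mono: "\<eta> W \<le> \<eta>H" if "linear_subspace W" "VH \<subseteq> W" "W \<subseteq> H10 \<Omega>" for W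
      using B1 linVH that unfolding assumption_B1_def \<eta>H_def by auto
    have eig: "is_eigenpair \<Omega> \<A> f (V k) (lb k, ub k)" if "k \<in> {1..n}" for k
      using fam mem[OF that] ep[of k] unfolding mesh_family_def V_def by metis
    have ubV: "ub k \<in> V k" and ub10: "ub k \<in> H10 \<Omega>" if "k \<in> {1..n}" for k
      using eig[OF that] V10[of k] by (auto simp: is_eigenpair_def)
    have "let \<eta>H = \<eta> VH; \<gamma> = \<theta> + (C\<^sub>u * \<theta> + (1 + \<theta>) * (Ct\<^sub>u + C\<^sub>f) * (1 + C\<^sub>u * \<eta>H)) * \<eta>H;
        \<delta> = best_approx \<Omega> \<A> (V n) u; (\<mu>h, uh) = ep (V n)
      in \<beta> * \<gamma> ^ p < 1 \<longrightarrow> ?N (\<lambda>x. uh x - U n x) \<le> C * (\<gamma> ^ p / (1 - \<beta> * \<gamma> ^ p)) * \<delta> \<and>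
          \<bar>\<mu>h - Lam n\<bar> + norm_L2 \<Omega> (\<lambda>x. uh x - U n x) \<le> C * (\<gamma> ^ p / (1 - \<beta> * \<gamma> ^ p)) * \<eta>H * \<delta>"
      unfolding \<eta>H_def[symmetric] Let_def \<gamma>_def[symmetric] \<delta>_def[symmetric] ep prod.case
    proof (rule impI)

      \<comment> \<open>Consequences of the smallness condition\<close>
      assume cond: "\<beta> * \<gamma> ^ p < 1"
      \<comment> \<open>Without correction steps the power is 1 and the condition would read \<beta>
        < 1.\<close>
      have p0: "0 < p"
        using cond \<open>\<beta> > 1\<close> by (cases p) auto
      \<comment> \<open>A bound that does not involve \<open>Ct\<^sub>u\<close>: that summand is
        dropped and the remaining factors are estimated below by 1.\<close>
      have \<gamma>\<theta>: "C\<^sub>f * \<eta>H \<le> \<gamma>"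
      proof -
        have "C\<^sub>f * 1 \<le> (Ct\<^sub>u + C\<^sub>f) * (1 + C\<^sub>u * \<eta>H)"
          using Ctu \<open>C\<^sub>f > 0\<close> \<open>C\<^sub>u > 0\<close> \<eta>H0 by (intro mult_mono) auto
        also have "\<dots> \<le> (1 + \<theta>) * ((Ct\<^sub>u + C\<^sub>f) * (1 + C\<^sub>u * \<eta>H))"
          using Ctu \<open>C\<^sub>f > 0\<close> \<open>C\<^sub>u > 0\<close> \<eta>H0 \<theta> by (simp add: distrib_right)
        also have "\<dots> \<le> C\<^sub>u * \<theta> + (1 + \<theta>) * (Ct\<^sub>u + C\<^sub>f) * (1 + C\<^sub>u * \<eta>H)"
          using \<theta> \<open>C\<^sub>u > 0\<close> by (simp add: mult.assoc)
        finally have "C\<^sub>f * \<eta>H \<le> (C\<^sub>u * \<theta> + (1 + \<theta>) * (Ct\<^sub>u + C\<^sub>f) * (1 + C\<^sub>u * \<eta>H)) * \<eta>H"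
          using \<eta>H0 by (intro mult_right_mono) auto
        then show ?thesis
          using \<theta> by (simp add: \<gamma>_def)
      qed
      then have \<gamma>0: "0 \<le> \<gamma>"
        using mult_nonneg_nonneg[of C\<^sub>f \<eta>H] \<eta>H0 \<open>C\<^sub>f > 0\<close> by linarith
      have "\<gamma> < 1"
      proof (rule ccontr)
        assume "\<not> \<gamma> < 1"
        then have "1 * 1 \<le> \<beta> * \<gamma> ^ p"
          using \<open>\<beta> > 1\<close> by (intro mult_mono one_le_power) auto
        then show False
          using cond by simp
      qed
      then have \<eta>H1: "\<eta>H \<le> 1 / C\<^sub>f"
        using \<gamma>\<theta> \<open>C\<^sub>f > 0\<close> by (simp add: field_simps)
      then have Cu\<eta>: "C\<^sub>u * \<eta>H \<le> C\<^sub>u / C\<^sub>f"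
        using mult_left_mono[OF \<eta>H1, of C\<^sub>u] \<open>C\<^sub>u > 0\<close> by simp

      \<comment> \<open>Mesh-independent bounds for the discrete eigenpairs\<close>
      have exact: "?N (\<lambda>x. u x - ub k x) \<le> E * \<delta> k" and lbM: "\<bar>lb k\<bar> \<le> M" if k: "k \<in> {1..n}" for k
      proof -
        let ?err = "?N (\<lambda>x. u x - ub k x)"
        have b1: "?err \<le> (1 + C\<^sub>u * \<eta> (V k)) * \<delta> k"
          and b2: "\<bar>\<mu> - lb k\<bar> + norm_L2 \<Omega> (\<lambda>x. u x - ub k x) \<le> C\<^sub>u * \<eta> (V k) * ?err"
          using B1 mem[OF k] ep[of k] by (auto simp: assumption_B1_def \<delta>_def V_def Let_def dest!: bspec)
        have "C\<^sub>u * \<eta> (V k) \<le> C\<^sub>u * \<eta>H"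
          using \<eta>_mono[OF linV VHV[OF k] V10] \<open>C\<^sub>u > 0\<close> by (intro mult_left_mono) auto
        then have \<eta>k: "C\<^sub>u * \<eta> (V k) \<le> C\<^sub>u / C\<^sub>f"
          using Cu\<eta> by linarith
        have "(1 + C\<^sub>u * \<eta> (V k)) * \<delta> k \<le> E * \<delta> k"
          using \<eta>k \<delta>0[of k] by (intro mult_right_mono) (auto simp: E_def)
        then show err: "?err \<le> E * \<delta> k"
          using b1 by linarith
        have "(\<lambda>x. u x - ub k x) \<in> L2 \<Omega>"
          using linear_subspace_diff[OF linH u ub10[OF k]] H10_subset_H1 H1_subset_L2 by blast
        then have "0 \<le> norm_L2 \<Omega> (\<lambda>x. u x - ub k x)"
          using semi_inner_on_nonneg[OF semi_inner_on_L2] by (simp add: norm_L2_def)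
        then have "\<bar>\<mu> - lb k\<bar> \<le> C\<^sub>u * \<eta> (V k) * ?err"
          using b2 by linarith
        also have "\<dots> \<le> C\<^sub>u / C\<^sub>f * ?err"
          using \<eta>k Ndiff[OF u ub10[OF k]] by (intro mult_right_mono)
        also have "\<dots> \<le> C\<^sub>u / C\<^sub>f * (E * ?N u)"
        proof (rule mult_left_mono)
          show "?err \<le> E * ?N u"
            using err mult_left_mono[OF \<delta>u[of k], of E] E1 by linarith
        qed (use \<open>C\<^sub>u > 0\<close> \<open>C\<^sub>f > 0\<close> in simp)
        finally show "\<bar>lb k\<bar> \<le> M"
          by (simp add: M_def)
      qed

      \<comment> \<open>The iterates are normalised elements of the level spaces\<close>
      have start: "lam k 0 = Lam (k - 1)" "w k 0 = U (k - 1)" "Lam k = lam k p" "U k = w k p"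
        and mgstep: "\<And>l. l < p \<Longrightarrow> eigen_mg_step \<Omega> \<A> f ep MG VH (lam k l) (w k l)
            (V k) m (wh k l) (wt k l) (lam k (Suc l)) (w k (Suc l))" if "k \<in> {2..n}" for k
        using fmg that unfolding full_multigrid_def VH_def V_def by auto
      have U1: "Lam 1 = lb 1" "U 1 = ub 1"
        using fmg ep[of 1] by (auto simp: full_multigrid_def V_def)
      have next_iter: "w k (Suc l) \<in> V k \<and> inner_L2 \<Omega> (w k (Suc l)) (w k (Suc l)) = 1"
        if k: "k \<in> {2..n}" and l: "l < p" for k l
      proof -
        have "is_eigenpair \<Omega> \<A> f (add_span VH (wt k l)) (lam k (Suc l), w k (Suc l))" "wt k l \<in> V k"
          using mgstep[OF k l] by (auto simp: eigen_mg_step_def Let_def)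
        moreover have "VH \<subseteq> V k"
          using k by (intro VHV) auto
        ultimately show ?thesis
          using add_span_subset[OF linV[of k]] by (auto simp: is_eigenpair_def)
      qed
      have Uk: "U k \<in> V k \<and> inner_L2 \<Omega> (U k) (U k) = 1" if k: "k \<in> {1..n}" for k
      proof (cases "k = 1")
        case True
        then show ?thesis
          using eig[OF k] U1 by (simp add: is_eigenpair_def)
      next
        case False
        then have "k \<in> {2..n}"
          using k by auto
        \<comment> \<open>The output of the level is \<open>w k (Suc (p - 1))\<close>, an
          eigenfunction of an enriched space, because p is positive.\<close>
        then show ?thesis
          using next_iter[of k "p - 1"] start(4)[of k] p0 by simp
      qed
      have iter: "w k l \<in> V k \<and> inner_L2 \<Omega> (w k l) (w k l) = 1" if k: "k \<in> {2..n}" and l: "l \<le> p" for k l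
      proof (cases l)
        case 0
        \<comment> \<open>The initial iterate is the output of the coarser level; nestedness puts it
          into the current space.\<close>
        have "k - 1 \<in> {1..n}"
          using k by auto
        then show ?thesis
          using Uk[of "k - 1"] start(2)[OF k] step_sub[OF k] 0 by auto
      next
        case (Suc l')
        then show ?thesis
          using next_iter[OF k, of l'] l by simp
      qed

      \<comment> \<open>One correction step of the scheme\<close>
      have step: "?N (\<lambda>x. ub k x - w k (Suc l) x) \<le> \<gamma> * ?N (\<lambda>x. ub k x - w k l x)"
        and step2: "\<bar>lb k - lam k (Suc l)\<bar> + norm_L2 \<Omega> (\<lambda>x. ub k x - w k (Suc l) x)
          \<le> C\<^sub>u * \<eta>H * ?N (\<lambda>x. ub k x - w k (Suc l) x)"
        if k: "k \<in> {2..n}" and l: "l < p" for k l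
      proof -
        have k1: "k \<in> {1..n}"
          using k by auto
        define W where "W = add_span VH (wt k l)"
        have wh: "wh k l \<in> V k" "\<And>v. v \<in> V k \<Longrightarrow>
            a_hat \<Omega> \<A> (wh k l) v = inner_L2 \<Omega> (\<lambda>x. lam k l * w k l x - f x (w k l x)) v"
          and wt: "wt k l \<in> V k" and epW: "ep W = (lam k (Suc l), w k (Suc l))"
          and eigW: "is_eigenpair \<Omega> \<A> f W (lam k (Suc l), w k (Suc l))"
          using mgstep[OF k l] by (auto simp: eigen_mg_step_def Let_def W_def)
        have linW: "linear_subspace W" and WV: "W \<subseteq> V k" and VHW: "VH \<subseteq> W" and wtW: "wt k l \<in> W"
          unfolding W_def
          by (rule linear_subspace_add_span[OF linVH], rule add_span_subset[OF linV VHV[OF k1] wt],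
              rule subset_add_span, rule mem_add_span[OF linVH])
        have W10: "W \<subseteq> H10 \<Omega>"
          using WV V10 by blast
        have wk: "w k l \<in> V k" "inner_L2 \<Omega> (w k l) (w k l) = 1"
          using iter[OF k, of l] l by auto
        have wk': "w k (Suc l) \<in> H10 \<Omega>"
          using next_iter[OF k l] V10 by blast
        have e1: "\<bar>lb k - lam k l\<bar> + norm_L2 \<Omega> (\<lambda>x. ub k x - w k l x) \<le> C\<^sub>u * \<eta>H * ?N (\<lambda>x. ub k x - w k l x)"
          using est k l ep[of k] unfolding iterates_estimate_def \<eta>H_def VH_def V_def by (auto dest!: bspec)
        have b1: "?N (\<lambda>x. ub k x - w k (Suc l) x) \<le> (1 + C\<^sub>u * \<eta> W) * best_approx \<Omega> \<A> W (ub k)"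
          and b2: "\<bar>lb k - lam k (Suc l)\<bar> + norm_L2 \<Omega> (\<lambda>x. ub k x - w k (Suc l) x)
            \<le> C\<^sub>u * \<eta> W * ?N (\<lambda>x. ub k x - w k (Suc l) x)"
        proof -
          have "linear_subspace W \<and> W \<subseteq> fe_space \<Omega> (\<T> k) \<and> is_eigenpair \<Omega> \<A> f W (ep W)"
            using linW WV eigW epW by (simp add: V_def)
          then have "let (\<mu>h, uh) = ep (V k); (\<mu>w, uw) = ep W; err = ?N (\<lambda>x. uh x - uw x) in
             err \<le> (1 + C\<^sub>u * \<eta> W) * best_approx \<Omega> \<A> W uh \<and>
             \<bar>\<mu>h - \<mu>w\<bar> + norm_L2 \<Omega> (\<lambda>x. uh x - uw x) \<le> C\<^sub>u * \<eta> W * err"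
            using B2 mem[OF k1] unfolding assumption_B2_def V_def by blast
          then show "?N (\<lambda>x. ub k x - w k (Suc l) x) \<le> (1 + C\<^sub>u * \<eta> W) * best_approx \<Omega> \<A> W (ub k)"
            and "\<bar>lb k - lam k (Suc l)\<bar> + norm_L2 \<Omega> (\<lambda>x. ub k x - w k (Suc l) x)
            \<le> C\<^sub>u * \<eta> W * ?N (\<lambda>x. ub k x - w k (Suc l) x)"
            by (simp_all add: ep epW Let_def)
        qed
        have \<eta>W: "\<eta> W \<le> \<eta>H"
          by (rule \<eta>_mono[OF linW VHW W10])
        have "?N (\<lambda>x. ub k x - wh k l x)
            \<le> (M * C\<^sub>P + C\<^sub>f) * (\<bar>lb k - lam k l\<bar> + norm_L2 \<Omega> (\<lambda>x. ub k x - w k l x))"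
          using C\<^sub>P \<open>C\<^sub>f > 0\<close> M1
          by (intro linear_problem_error[OF A assms(4) \<Omega> assms(11) _ _ _ linV V10 eig[OF k1] wk wh lbM[OF k1]]) auto
        also have "\<dots> \<le> (M * C\<^sub>P + C\<^sub>f) * (C\<^sub>u * \<eta>H * ?N (\<lambda>x. ub k x - w k l x))"
          using e1 C\<^sub>P(1) \<open>C\<^sub>f > 0\<close> M1 by (intro mult_left_mono) auto
        also have "\<dots> = Ct\<^sub>u * \<eta>H * ?N (\<lambda>x. ub k x - w k l x)"
          by (simp add: Ct\<^sub>u_def)
        \<comment> \<open>Enlarged to the constant that stands in \<gamma>, so that the contraction
          lemma returns \<gamma> literally.\<close>
        also have "\<dots> \<le> (Ct\<^sub>u + C\<^sub>f) * \<eta>H * ?N (\<lambda>x. ub k x - w k l x)"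
          using \<open>C\<^sub>f > 0\<close> \<eta>H0 Ndiff[OF ub10[OF k1], of "w k l"] wk(1) V10[of k]
          by (intro mult_right_mono) auto
        finally have lin: "?N (\<lambda>x. ub k x - wh k l x) \<le> (Ct\<^sub>u + C\<^sub>f) * \<eta>H * ?N (\<lambda>x. ub k x - w k l x)" .
        have mg: "?N (\<lambda>x. wh k l x - wt k l x) \<le> \<theta> * ?N (\<lambda>x. wh k l x - w k l x)"
          using red k l by (simp add: mg_error_reduction_def)
        have mem10: "ub k \<in> H10 \<Omega>" "w k l \<in> H10 \<Omega>" "wh k l \<in> H10 \<Omega>" "wt k l \<in> H10 \<Omega>"
          using ub10[OF k1] wk(1) wh(1) wt V10[of k] by auto
        show "?N (\<lambda>x. ub k x - w k (Suc l) x) \<le> \<gamma> * ?N (\<lambda>x. ub k x - w k l x)"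
          unfolding \<gamma>_def
          by (rule correction_step_contraction[OF B mem10 W10 wtW lin mg b1 \<eta>W \<eta>H0 _ \<theta>]) (use \<open>C\<^sub>u > 0\<close> in simp)
        have "C\<^sub>u * \<eta> W * ?N (\<lambda>x. ub k x - w k (Suc l) x) \<le> C\<^sub>u * \<eta>H * ?N (\<lambda>x. ub k x - w k (Suc l) x)"
          using \<eta>W \<open>C\<^sub>u > 0\<close> Ndiff[OF ub10[OF k1] wk'] by (intro mult_right_mono mult_left_mono) auto
        then show "\<bar>lb k - lam k (Suc l)\<bar> + norm_L2 \<Omega> (\<lambda>x. ub k x - w k (Suc l) x)
            \<le> C\<^sub>u * \<eta>H * ?N (\<lambda>x. ub k x - w k (Suc l) x)"
          using b2 by linarith
      qed

      \<comment> \<open>Recursion over the levels\<close>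
      define \<epsilon> where "\<epsilon> k = ?N (\<lambda>x. ub k x - U k x)" for k
      have recursion: "\<epsilon> k \<le> \<gamma> ^ p * (D * \<delta> k + \<epsilon> (k - 1))" if k: "k \<in> {2..n}" for k
      proof -
        have k1: "k \<in> {1..n}" "k - 1 \<in> {1..n}"
          using k by auto
        have U10: "U (k - 1) \<in> H10 \<Omega>"
          using Uk[OF k1(2)] V10 by blast
        have "?N (\<lambda>x. ub k x - w k l x) \<le> \<gamma> ^ l * ?N (\<lambda>x. ub k x - w k 0 x)" if "l \<le> p" for l
          using that
        proof (induction l)
          case (Suc l)
          then have "\<gamma> * ?N (\<lambda>x. ub k x - w k l x) \<le> \<gamma> * (\<gamma> ^ l * ?N (\<lambda>x. ub k x - w k 0 x))"
            using \<gamma>0 by (intro mult_left_mono) auto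
          then show ?case
            using step[OF k, of l] Suc.prems by (simp add: mult.assoc)
        qed simp
        from this[of p] have "\<epsilon> k \<le> \<gamma> ^ p * ?N (\<lambda>x. ub k x - U (k - 1) x)"
          by (simp add: \<epsilon>_def start[OF k])
        also have "\<dots> \<le> \<gamma> ^ p * (D * \<delta> k + \<epsilon> (k - 1))"
        proof (rule mult_left_mono)
          \<comment> \<open>The path from the new discrete eigenfunction to the old output runs
            through u and the old discrete eigenfunction, since B1 compares each level only with
            u.\<close>
          have "?N (\<lambda>x. ub k x - U (k - 1) x) \<le> ?N (\<lambda>x. ub k x - u x) + ?N (\<lambda>x. u x - ub (k - 1) x) + \<epsilon> (k - 1)"
            using Ntri[OF ub10[OF k1(1)] u U10] Ntri[OF u ub10[OF k1(2)] U10] by (simp add: \<epsilon>_def)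
          also have "\<dots> \<le> E * \<delta> k + E * \<delta> (k - 1) + \<epsilon> (k - 1)"
            using exact[OF k1(1)] exact[OF k1(2)] Ncomm[OF u ub10[OF k1(1)]] by simp
          also have "\<dots> = D * \<delta> k + \<epsilon> (k - 1)"
            unfolding \<delta>\<beta>[OF k] D_def by (simp add: algebra_simps)
          finally show "?N (\<lambda>x. ub k x - U (k - 1) x) \<le> D * \<delta> k + \<epsilon> (k - 1)" .
        qed (use \<gamma>0 in simp)
        finally show ?thesis .
      qed
      have \<epsilon>1: "\<epsilon> 1 = 0"
        unfolding \<epsilon>_def U1 norm_a_def using semi_inner_on_zero[OF B] by simp
      let ?q = "\<gamma> ^ p / (1 - \<beta> * \<gamma> ^ p)"
      have q0: "0 \<le> ?q"
        using \<gamma>0 cond by simp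
      have \<epsilon>n: "\<epsilon> n \<le> D * ?q * \<delta> n"
        using \<gamma>0 D0 n1 by (intro geometric_error_recursion[of _ \<beta> D n \<delta> \<epsilon>, OF _ cond _ \<delta>0 \<epsilon>1 recursion \<delta>\<beta>]) auto
      have DC: "D * ?q * \<delta> n \<le> C * ?q * \<delta> n" and DC': "C\<^sub>u * D * ?q * \<delta> n \<le> C * ?q * \<delta> n"
        using D0 \<open>C\<^sub>u > 0\<close> q0 \<delta>0[of n] unfolding C_def
        by (intro mult_right_mono; simp add: algebra_simps)+

      \<comment> \<open>The eigenvalue and L2 errors\<close>
      \<comment> \<open>For n = 1 the output is the discrete eigenpair itself and both sides are 0.
        Otherwise Assumption B2 is read at the last correction step, with index
        \<open>p - 1\<close>.\<close>
      have "\<bar>lb n - Lam n\<bar> + norm_L2 \<Omega> (\<lambda>x. ub n x - U n x) \<le> C\<^sub>u * \<eta>H * \<epsilon> n"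
      proof (cases "n = 1")
        case True
        show ?thesis
          unfolding True \<epsilon>1 U1 norm_L2_def using semi_inner_on_zero[OF semi_inner_on_L2[of \<Omega>]] by simp
      next
        case False
        then have "n \<in> {2..n}"
          using n1 by auto
        then show ?thesis
          using step2[of n "p - 1"] start[of n] p0 by (simp add: \<epsilon>_def)
      qed
      also have "\<dots> \<le> C\<^sub>u * \<eta>H * (D * ?q * \<delta> n)"
        using \<epsilon>n \<eta>H0 \<open>C\<^sub>u > 0\<close> by (intro mult_left_mono) auto
      also have "\<dots> = (C\<^sub>u * D * ?q * \<delta> n) * \<eta>H"
        by simp
      also have "\<dots> \<le> (C * ?q * \<delta> n) * \<eta>H"
        by (rule mult_right_mono[OF DC' \<eta>H0])
      also have "\<dots> = C * ?q * \<eta>H * \<delta> n"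
        by simp
      finally show "?N (\<lambda>x. ub n x - U n x) \<le> C * ?q * \<delta> n \<and>
          \<bar>lb n - Lam n\<bar> + norm_L2 \<Omega> (\<lambda>x. ub n x - U n x) \<le> C * ?q * \<eta>H * \<delta> n"
        using \<epsilon>n DC by (simp add: \<epsilon>_def)
    qed
    then show "let \<eta>H = \<eta> (fe_space \<Omega> \<T>H);
           \<gamma> = \<theta> + (C\<^sub>u * \<theta> + (1 + \<theta>) * (Ct\<^sub>u + C\<^sub>f) * (1 + C\<^sub>u * \<eta>H)) * \<eta>H;
           \<delta> = best_approx \<Omega> \<A> (fe_space \<Omega> (\<T> n)) u;
           (\<mu>h, uh) = ep (fe_space \<Omega> (\<T> n))
       in \<beta> * \<gamma> ^ p < 1 \<longrightarrow>
          ?N (\<lambda>x. uh x - U n x) \<le> C * (\<gamma> ^ p / (1 - \<beta> * \<gamma> ^ p)) * \<delta> \<and>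
          \<bar>\<mu>h - Lam n\<bar> + norm_L2 \<Omega> (\<lambda>x. uh x - U n x)
            \<le> C * (\<gamma> ^ p / (1 - \<beta> * \<gamma> ^ p)) * \<eta>H * \<delta>"
      unfolding VH_def V_def .
  qed
qed

end
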